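(* Let $\mathbb{K}$ be a field of arbitrary characteristic and let $\mathcal{A}$ be an affine line arrangement in $V=\mathbb{K}^2$ such that $|\mathcal{A}|=2n+r$ with $n,r\in\mathbb{Z}_{\ge0}$ and $\chi(\mathcal{A},t)=(t-n)(t-n-r)$. Assume the following two conditions: (1) $\mathcal{A}$ contains a free arrangement $\mathcal{B}$ with $\exp_0(\mathcal{B})=(n-s,n-1)$ for an integer $s\ge1$; and (2) there is no subarrangement $\mathcal{C}\subset\mathcal{A}$ such that $\mathcal{B}\subset\mathcal{C}$ and $\chi(\mathcal{C},t)=(t-n-u+1)(t-n+s)$ with $u>r+1$. Then $\mathcal{A}$ is free. In particular, the freeness of such $\mathcal{A}$ depends only on the combinatorics.
   Context: An affine line arrangement $\mathcal{A}$ in $V=\mathbb{K}^2$ is a finite set of affine lines in $V$; a subarrangement is a subset. $L(\mathcal{A})$ is the set of all nonempty intersections of subsets of $\mathcal{A}$ (including $V$, the empty intersection), a poset under inclusion. Define $\mu(V)=1$ and $\mu(X)=-\sum_{Y\in L(\mathcal{A}),\,X\subsetneq Y\subset V}\mu(Y)$; the characteristic polynomial is $\chi(\mathcal{A},t)=\sum_{X\in L(\mathcal{A})}\mu(X)t^{\dim X}$. "The freeness of such $\mathcal{A}$ depends only on the combinatorics" means: for two arrangements in $V$ that both satisfy the hypotheses and have isomorphic posets $L$, one is free if and only if the other is. Freeness: let $S=\mathbb{K}[x,y,z]$. The cone $c\mathcal{A}$ is the central arrangement in $\mathbb{K}^3$ consisting of the plane $z=0$ and the planes $cH=\{\alpha_{cH}=0\}$,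 $H\in\mathcal{A}$, where $\alpha_{cH}$ is the homogenization by $z$ of a degree one polynomial defining $H$. Let $D(c\mathcal{A})=\{\theta\in\mathrm{Der}\,S\mid \theta(\alpha_{cH})\in S\alpha_{cH}\ (\forall H\in\mathcal{A}),\ \theta(z)\in Sz\}$, where $\mathrm{Der}\,S$ is the module of $\mathbb{K}$-derivations of $S$. $\mathcal{A}$ is free with exponents $\exp_0(\mathcal{A})=(d_1,d_2)$ if $D(c\mathcal{A})$ is a free $S$-module with a homogeneous basis $\theta_E=x\partial_x+y\partial_y+z\partial_z,\theta_1,\theta_2$ with $\deg\theta_i=d_i$ (the degree of a homogeneous derivation is the polynomial degree of its coefficients). *)

theory Defs
  imports
    "HOL-Analysis.Cartesian_Space"
    "HOL-Computational_Algebra.Polynomial"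
    "HOL-Library.Function_Algebras"
begin

section \<open>Affine line arrangements in the plane and their combinatorics\<close>

definition line :: "'k::field \<Rightarrow> 'k \<Rightarrow> 'k \<Rightarrow> ('k ^ 2) set" where
  "line a b c = {v. a * v $ 1 + b * v $ 2 + c = 0}"

definition arrangement :: "('k::field ^ 2) set set \<Rightarrow> bool" where
  "arrangement A \<longleftrightarrow>
     finite A \<and> (\<forall>H\<in>A. \<exists>a b c. (a \<noteq> 0 \<or> b \<noteq> 0) \<and> H = line a b c)"

text \<open>The empty intersection is \<open>\<Inter>{} = UNIV\<close>, the whole plane.\<close>

definition intersection_poset :: "('k ^ 2) set set \<Rightarrow> ('k ^ 2) set set" where
  "intersection_poset A = {\<Inter>F | F. F \<subseteq> A \<and> \<Inter>F \<noteq> {}}"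

definition poset_isomorphic :: "'a set set \<Rightarrow> 'b set set \<Rightarrow> bool" where
  "poset_isomorphic P Q \<longleftrightarrow>
     (\<exists>f. bij_betw f P Q \<and> (\<forall>X\<in>P. \<forall>Y\<in>P. X \<subseteq> Y \<longleftrightarrow> f X \<subseteq> f Y))"

text \<open>Dimension of a nonempty affine subspace: dimension of its space of directions.\<close>

definition flat_dim :: "('k::field ^ 2) set \<Rightarrow> nat" where
  "flat_dim X = vec.dim {p - q | p q. p \<in> X \<and> q \<in> X}"

lemma finite_intersection_poset: "finite A \<Longrightarrow> finite (intersection_poset A)"
  by (rule finite_subset[of _ "Inter ` Pow A"]) (auto simp: intersection_poset_def)

text \<open>The guard \<open>finite A\<close> is needed only for termination.\<close>

function mobius :: "('k ^ 2) set set \<Rightarrow> ('k ^ 2) set \<Rightarrow> int" where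
  "mobius A X =
     (if X = UNIV then 1
      else if finite A then - (\<Sum>Y\<in>{Y \<in> intersection_poset A. X \<subset> Y}. mobius A Y)
      else 0)"
  by auto
termination
proof (relation "measure (\<lambda>(A, X). card {Y \<in> intersection_poset A. X \<subset> Y})")
  fix A :: "('k ^ 2) set set" and X Y
  assume "finite A" and Y: "Y \<in> {Y \<in> intersection_poset A. X \<subset> Y}"
  have "{Z \<in> intersection_poset A. Y \<subset> Z} \<subset> {Z \<in> intersection_poset A. X \<subset> Z}"
    using Y by blast
  then show "((A, Y), (A, X)) \<in> measure (\<lambda>(A, X). card {Y \<in> intersection_poset A. X \<subset> Y})"
    using finite_intersection_poset[OF \<open>finite A\<close>] by (simp add: psubset_card_mono)
qed simp

declare mobius.simps [simp del]

definition char_poly :: "('k::field ^ 2) set set \<Rightarrow> int poly" where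
  "char_poly A = (\<Sum>X\<in>intersection_poset A. monom (mobius A X) (flat_dim X))"


section \<open>Derivations of the polynomial ring in three variables\<close>

text \<open>
  The ring \<open>S = K[x,y,z]\<close> is represented as \<open>K[x][y][z]\<close>: the innermost variable is
  \<open>x\<close> and the outermost one is \<open>z\<close>.
\<close>

type_synonym 'k poly3 = "'k poly poly poly"

definition Const3 :: "'k::field \<Rightarrow> 'k poly3" where "Const3 c = [:[:[:c:]:]:]"
definition X3 :: "'k::field poly3" where "X3 = [:[:[:0, 1:]:]:]"
definition Y3 :: "'k::field poly3" where "Y3 = [:[:0, 1:]:]"
definition Z3 :: "'k::field poly3" where "Z3 = [:0, 1:]"

definition homogeneous :: "nat \<Rightarrow> 'k::field poly3 \<Rightarrow> bool" where
  "homogeneous d f \<longleftrightarrow>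
     (\<forall>i j k. coeff (coeff (coeff f k) j) i \<noteq> 0 \<longrightarrow> i + j + k = d)"

definition derivation :: "('k::field poly3 \<Rightarrow> 'k poly3) \<Rightarrow> bool" where
  "derivation \<theta> \<longleftrightarrow>
     (\<forall>f g. \<theta> (f + g) = \<theta> f + \<theta> g) \<and>
     (\<forall>c f. \<theta> (Const3 c * f) = Const3 c * \<theta> f) \<and>
     (\<forall>f g. \<theta> (f * g) = f * \<theta> g + g * \<theta> f)"

text \<open>The coefficients of \<open>\<theta>\<close> along \<open>\<partial>\<^sub>x\<close>, \<open>\<partial>\<^sub>y\<close>, \<open>\<partial>\<^sub>z\<close> are its values on the three variables.\<close>

definition homogeneous_derivation :: "nat \<Rightarrow> ('k::field poly3 \<Rightarrow> 'k poly3) \<Rightarrow> bool" where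
  "homogeneous_derivation d \<theta> \<longleftrightarrow>
     derivation \<theta> \<and> homogeneous d (\<theta> X3) \<and> homogeneous d (\<theta> Y3) \<and> homogeneous d (\<theta> Z3)"

definition euler :: "'k::field poly3 \<Rightarrow> 'k poly3" where
  "euler f = X3 * map_poly (map_poly pderiv) f + Y3 * map_poly pderiv f + Z3 * pderiv f"

definition der_scale :: "'k::field poly3 \<Rightarrow> ('k poly3 \<Rightarrow> 'k poly3) \<Rightarrow> 'k poly3 \<Rightarrow> 'k poly3" where
  "der_scale p \<theta> = (\<lambda>f. p * \<theta> f)"

interpretation der: module "der_scale :: 'k::field poly3 \<Rightarrow> _"
  by unfold_locales (auto simp: der_scale_def fun_eq_iff algebra_simps)


section \<open>Freeness\<close>

text \<open>
  All linear forms of the planes \<open>cH\<close> of the cone, together with \<open>z\<close>.  A form defining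
  \<open>cH\<close> is the homogenization \<open>a x + b y + c z\<close> of a polynomial \<open>a x + b y + c\<close> defining \<open>H\<close>;
  it is unique up to a nonzero scalar, and every choice of it is included.
\<close>

definition cone_forms :: "('k::field ^ 2) set set \<Rightarrow> 'k poly3 set" where
  "cone_forms A = insert Z3
     {Const3 a * X3 + Const3 b * Y3 + Const3 c * Z3 | a b c.
        (a \<noteq> 0 \<or> b \<noteq> 0) \<and> line a b c \<in> A}"

definition log_derivations :: "('k::field ^ 2) set set \<Rightarrow> ('k poly3 \<Rightarrow> 'k poly3) set" where
  "log_derivations A = {\<theta>. derivation \<theta> \<and> (\<forall>\<alpha>\<in>cone_forms A. \<alpha> dvd \<theta> \<alpha>)}"

definition free_with_exponents :: "('k::field ^ 2) set set \<Rightarrow> nat \<Rightarrow> nat \<Rightarrow> bool" where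
  "free_with_exponents A d\<^sub>1 d\<^sub>2 \<longleftrightarrow>
     (\<exists>\<theta>\<^sub>1 \<theta>\<^sub>2. homogeneous_derivation d\<^sub>1 \<theta>\<^sub>1 \<and> homogeneous_derivation d\<^sub>2 \<theta>\<^sub>2 \<and>
        distinct [euler, \<theta>\<^sub>1, \<theta>\<^sub>2] \<and>
        der.independent {euler, \<theta>\<^sub>1, \<theta>\<^sub>2} \<and>
        der.span {euler, \<theta>\<^sub>1, \<theta>\<^sub>2} = log_derivations A)"

definition free_arrangement :: "('k::field ^ 2) set set \<Rightarrow> bool" where
  "free_arrangement A \<longleftrightarrow> (\<exists>d\<^sub>1 d\<^sub>2. free_with_exponents A d\<^sub>1 d\<^sub>2)"


section \<open>The hypotheses on an arrangement\<close>

text \<open>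
  Exponents are natural numbers, so \<open>exp\<^sub>0(B) = (n - s, n - 1)\<close> is expressed by equations over
  the integers, which rules out \<open>s > n\<close>.
\<close>

definition has_free_subarrangement_condition ::
    "('k::field ^ 2) set set \<Rightarrow> nat \<Rightarrow> nat \<Rightarrow> ('k ^ 2) set set \<Rightarrow> int \<Rightarrow> bool" where
  "has_free_subarrangement_condition A n r B s \<longleftrightarrow>
     arrangement A \<and>
     card A = 2 * n + r \<and>
     char_poly A = [:- int n, 1:] * [:- int n - int r, 1:] \<and>
     B \<subseteq> A \<and> 1 \<le> s \<and>
     (\<exists>d\<^sub>1 d\<^sub>2. int d\<^sub>1 = int n - s \<and> int d\<^sub>2 = int n - 1 \<and> free_with_exponents B d\<^sub>1 d\<^sub>2) \<and>
     \<not> (\<exists>C u. B \<subseteq> C \<and> C \<subseteq> A \<and> u > int r + 1 \<and>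
            char_poly C = [:- int n - u + 1, 1:] * [:- int n + s, 1:])"

end

theory Submission
  imports Defs
begin

text \<open>
  Setting \<open>z = 1\<close> and subtracting a multiple of the Euler derivation turns a derivation in \<open>D(cA)\<close>
  into a polynomial vector field \<open>(f, g)\<close> on the plane that is tangent to every line of \<open>A\<close>.
  Conversely such a field of degree at most \<open>m\<close> homogenizes to a derivation of degree \<open>m\<close>.  Freeness
  with exponents \<open>(d, e)\<close> becomes the criterion of Saito in the plane: there are two logarithmic
  fields of degrees at most \<open>d\<close> and \<open>e\<close>, with \<open>d + e = |A|\<close>, whose determinant is a nonzero constant
  times the product \<open>Q\<close> of the linear forms (\<open>free_imp_affine_free\<close>, \<open>affine_free_imp_free\<close>).

  On the combinatorial side \<open>\<chi>(A, t) = t^2 - |A| t + b2(A)\<close>, and adding a line \<open>H\<close> raises \<open>b2\<close> by the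
  number \<open>n_H\<close> of points in which \<open>H\<close> meets the lines already present (\<open>char_poly_eq\<close>, \<open>b2_insert\<close>).

  The two sides are linked by restricting the component of a logarithmic field normal to a new
  line \<open>H\<close> to that line.  The result is a polynomial in one variable that is always divisible by one
  fixed polynomial, and in high degrees every multiple of it occurs (\<open>restr_normal_factor\<close>,
  \<open>restr_normal_surj\<close>).  This has three consequences.  A field of degree \<open>d\<close> with \<open>d + n_H < |A|\<close> is
  automatically tangent to \<open>H\<close>.  Counting dimensions line by line gives \<open>b2(A) = d e\<close> for a free
  arrangement with exponents \<open>(d, e)\<close>.  And if \<open>A\<close> is free with exponents \<open>(d, e)\<close>, then \<open>n_H = e\<close>
  makes the enlarged arrangement free with exponents \<open>(d + 1, e)\<close>, while \<open>n_H < e\<close> makes it free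
  with exponents \<open>(d, e + 1)\<close>.

  The theorem follows by squeezing \<open>b2(A) = n (n + r)\<close>.  Write \<open>(d, e) = (n - s, n - 1)\<close> and enlarge \<open>B\<close>
  inside \<open>A\<close> to a maximal \<open>C\<close> that is free with exponents \<open>(d, e + k)\<close> for some \<open>k\<close>; hypothesis (2) gives
  \<open>k \<le> r + 1\<close>.  By maximality each remaining line meets \<open>C\<close> in at least \<open>e + k\<close> points.  If \<open>k \<ge> 1\<close>, these
  lower bounds already add up to \<open>(n + j) (n + r - j) \<ge> n (n + r)\<close> with \<open>j = k - 1\<close>.  So equality holds
  throughout: every line meets its predecessors in exactly \<open>e + k\<close> points, whatever the order in which
  the lines are added, and each addition preserves freeness.  If \<open>k = 0\<close>, then \<open>C = B\<close> and each
  remaining line meets \<open>B\<close> in at least \<open>n - 1\<close> points.  Now enlarge \<open>B\<close> to a maximal \<open>D\<close> that is free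
  with exponents \<open>(d + i, e)\<close>.  Each remaining line meets \<open>D\<close> in at least \<open>n\<close> points, for with exactly
  \<open>n - 1\<close> points it could be added to \<open>D\<close>; comparing \<open>b2\<close> yields \<open>i \<ge> s\<close>, and the same squeeze applies
  with the two exponents exchanged.
\<close>

section \<open>Ring homomorphisms out of polynomial rings\<close>

definition ring_hom :: "('a::comm_ring_1 \<Rightarrow> 'b::comm_ring_1) \<Rightarrow> bool" where
  "ring_hom h \<longleftrightarrow> h 1 = 1 \<and> (\<forall>a b. h (a + b) = h a + h b) \<and> (\<forall>a b. h (a * b) = h a * h b)"

text \<open>
  The homomorphism that maps the coefficients by \<open>h\<close> and the variable to \<open>u\<close>.  Iterating it
  describes every substitution into a polynomial in several variables.
\<close>

definition eval_hom :: "('a::comm_ring_1 \<Rightarrow> 'b::comm_ring_1) \<Rightarrow> 'b \<Rightarrow> 'a poly \<Rightarrow> 'b" where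
  "eval_hom h u f = poly (map_poly h f) u"

lemma ring_hom_0: assumes "ring_hom h" shows "h 0 = 0"
proof -
  have "h (0 + 0) = h 0 + h 0" using assms unfolding ring_hom_def by blast
  then show ?thesis by simp
qed

lemma ring_hom_simps:
  assumes "ring_hom h"
  shows "h 1 = 1" "h (a + b) = h a + h b" "h (a * b) = h a * h b"
    "h 0 = 0" "h (- a) = - h a" "h (a - b) = h a - h b" "h (a ^ n) = h a ^ n"
proof -
  show h1: "h 1 = 1" and ha: "h (a + b) = h a + h b" and hm: "h (a * b) = h a * h b" for a b
    using assms by (auto simp: ring_hom_def)
  show h0: "h 0 = 0" using assms by (rule ring_hom_0)
  show hn: "h (- a) = - h a" for a using ha[of a "- a"] h0 by (simp add: eq_neg_iff_add_eq_0 add.commute)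
  show "h (a - b) = h a - h b" using ha[of a "- b"] hn[of b] by simp
  show "h (a ^ n) = h a ^ n" by (induction n) (simp_all add: h1 hm)
qed

lemma ring_hom_sum: "ring_hom h \<Longrightarrow> h (sum f A) = (\<Sum>x\<in>A. h (f x))"
  by (induction A rule: infinite_finite_induct) (simp_all add: ring_hom_simps)

lemma ring_hom_prod: "ring_hom h \<Longrightarrow> h (prod f A) = (\<Prod>x\<in>A. h (f x))"
  by (induction A rule: infinite_finite_induct) (simp_all add: ring_hom_simps)

lemma ring_hom_dvd: "ring_hom h \<Longrightarrow> a dvd b \<Longrightarrow> h a dvd h b"
  by (auto elim!: dvdE simp: ring_hom_simps)

lemma ring_hom_compose: "ring_hom h \<Longrightarrow> ring_hom g \<Longrightarrow> ring_hom (\<lambda>x. g (h x))"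
  by (simp add: ring_hom_def)

lemma ring_hom_ident: "ring_hom (\<lambda>x. x)"
  by (simp add: ring_hom_def)

lemma ring_hom_const: "ring_hom (\<lambda>c. [:c:])"
  by (simp add: ring_hom_def one_pCons)

lemma eval_hom_pCons [simp]: "h 0 = 0 \<Longrightarrow> eval_hom h u (pCons c p) = h c + u * eval_hom h u p"
  by (simp add: eval_hom_def map_poly_pCons)

lemma eval_hom_0 [simp]: "eval_hom h u 0 = 0"
  by (simp add: eval_hom_def)

lemma ring_hom_eval_hom:
  assumes h: "ring_hom h"
  shows "ring_hom (eval_hom h u)"
proof -
  note [simp] = ring_hom_simps[OF h]
  have add: "eval_hom h u (p + q) = eval_hom h u p + eval_hom h u q" for p q
    by (induction p q rule: poly_induct2) (simp_all add: algebra_simps)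
  have smult: "eval_hom h u (Polynomial.smult a q) = h a * eval_hom h u q" for a q
    by (induction q) (simp_all add: algebra_simps)
  have "eval_hom h u (p * q) = eval_hom h u p * eval_hom h u q" for p q
    by (induction p) (simp_all add: add smult algebra_simps)
  moreover have "eval_hom h u 1 = 1" by (simp add: one_pCons)
  ultimately show ?thesis using add by (simp add: ring_hom_def)
qed

lemma ring_hom_poly: "ring_hom (\<lambda>f. poly f u)"
  by (simp add: ring_hom_def)

lemma ring_hom_map_const: "ring_hom h \<Longrightarrow> ring_hom (map_poly (\<lambda>c. [:h c:]))"
proof -
  assume h: "ring_hom h"
  have hc: "ring_hom (\<lambda>c. [:[:h c:]:])"
    using ring_hom_compose[OF ring_hom_compose[OF h ring_hom_const] ring_hom_const] .
  have "map_poly (\<lambda>c. [:h c:]) f = eval_hom (\<lambda>c. [:[:h c:]:]) [:0,1:] f" for f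
    by (induction f) (simp_all add: ring_hom_simps[OF h] map_poly_pCons)
  then show ?thesis using ring_hom_eval_hom[OF hc] by (simp add: ring_hom_def)
qed

section \<open>The grading by total degree\<close>

text \<open>
  Given the grading \<open>g\<close> of the coefficient ring, the variable \<open>x\<close> is replaced by \<open>x w\<close> with a new outer
  variable \<open>w\<close>, so that the coefficient of \<open>w^m\<close> is the homogeneous component of degree \<open>m\<close>.  Because this
  is a ring homomorphism, total degrees and homogeneous components of products are read off from
  ordinary polynomial multiplication in \<open>w\<close>.
\<close>

definition grade :: "('a::comm_ring_1 \<Rightarrow> 'a poly) \<Rightarrow> 'a poly \<Rightarrow> 'a poly poly" where
  "grade g = eval_hom (\<lambda>r. map_poly (\<lambda>c. [:c:]) (g r)) [:0, [:0, 1:]:]"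

lemma ring_hom_grade: "ring_hom g \<Longrightarrow> ring_hom (grade g)"
  unfolding grade_def
  by (rule ring_hom_eval_hom, rule ring_hom_compose[of g], assumption)
     (rule ring_hom_map_const[OF ring_hom_ident])

lemma coeff_grade:
  assumes g: "ring_hom g"
  shows "coeff (coeff (grade g f) m) i = (if i \<le> m then coeff (g (coeff f i)) (m - i) else 0)"
proof (induction f arbitrary: m i)
  case 0
  then show ?case by (simp add: grade_def ring_hom_simps[OF g])
next
  case (pCons c f)
  have "grade g (pCons c f) = map_poly (\<lambda>c. [:c:]) (g c) + [:0, [:0, 1:]:] * grade g f"
    unfolding grade_def by (simp add: ring_hom_simps[OF g])
  also have "[:0, [:0, 1:]:] * grade g f = pCons 0 (Polynomial.smult [:0, 1:] (grade g f))"
    by simp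
  finally have "coeff (coeff (grade g (pCons c f)) m) i =
      coeff [:coeff (g c) m:] i + (case m of 0 \<Rightarrow> 0 | Suc n \<Rightarrow> coeff (pCons 0 (coeff (grade g f) n)) i)"
    by (cases m; cases i) (simp_all add: coeff_map_poly)
  also have "\<dots> = (if i \<le> m then coeff (g (coeff (pCons c f) i)) (m - i) else 0)"
    by (cases i; cases m) (simp_all add: pCons.IH)
  finally show ?case .
qed

abbreviation grade1 :: "'k::comm_ring_1 poly \<Rightarrow> 'k poly poly" where
  "grade1 \<equiv> grade (\<lambda>c. [:c:])"

abbreviation grade2 :: "'k::comm_ring_1 poly poly \<Rightarrow> 'k poly poly poly" where
  "grade2 \<equiv> grade grade1"

abbreviation grade3 :: "'k::comm_ring_1 poly poly poly \<Rightarrow> 'k poly poly poly poly" where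
  "grade3 \<equiv> grade grade2"

lemma ring_hom_grade1: "ring_hom (grade1 :: 'k::comm_ring_1 poly \<Rightarrow> _)"
  by (rule ring_hom_grade[OF ring_hom_const])

lemma ring_hom_grade2: "ring_hom (grade2 :: 'k::comm_ring_1 poly poly \<Rightarrow> _)"
  by (rule ring_hom_grade[OF ring_hom_grade1])

lemma ring_hom_grade3: "ring_hom (grade3 :: 'k::comm_ring_1 poly poly poly \<Rightarrow> _)"
  by (rule ring_hom_grade[OF ring_hom_grade2])

lemma coeff_grade1: "coeff (coeff (grade1 f) m) i = (if i = m then coeff f i else 0)"
  by (auto simp: coeff_grade[OF ring_hom_const] coeff_pCons split: nat.splits)

lemma coeff_grade2:
  "coeff (coeff (coeff (grade2 f) m) j) i = (if i + j = m then coeff (coeff f j) i else 0)"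
  by (auto simp: coeff_grade[OF ring_hom_grade1] coeff_grade1)

lemma coeff_grade3:
  "coeff (coeff (coeff (coeff (grade3 f) m) k) j) i =
     (if i + j + k = m then coeff (coeff (coeff f k) j) i else 0)"
  by (auto simp: coeff_grade[OF ring_hom_grade2] coeff_grade2)

lemma poly_grade_1:
  assumes g: "ring_hom g" and "\<And>r. poly (g r) 1 = r"
  shows "poly (grade g f) 1 = f"
proof (induction f)
  case (pCons c f)
  have "poly (map_poly (\<lambda>c. [:c:]) p) 1 = [:poly p 1:]" for p :: "'a poly"
    by (induction p) (simp_all add: map_poly_pCons)
  then show ?case using pCons assms(2)
    by (simp add: grade_def ring_hom_simps[OF g])
qed (simp add: grade_def)

lemma poly_grade1_1: "poly (grade1 f) 1 = f"
  by (rule poly_grade_1[OF ring_hom_const]) simp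

lemma poly_grade2_1 [simp]: "poly (grade2 f) 1 = f"
  by (rule poly_grade_1[OF ring_hom_grade1 poly_grade1_1])

lemma poly_grade3_1 [simp]: "poly (grade3 f) 1 = f"
  by (rule poly_grade_1[OF ring_hom_grade2 poly_grade2_1])

lemma grade2_eq_0_iff [simp]: "grade2 f = 0 \<longleftrightarrow> f = 0"
  by (metis poly_grade2_1 poly_0 ring_hom_0 ring_hom_grade2)

definition tdeg :: "'k::comm_ring_1 poly poly \<Rightarrow> nat" where
  "tdeg f = degree (grade2 f)"

lemma tdeg_0 [simp]: "tdeg 0 = 0"
  by (simp add: tdeg_def ring_hom_0[OF ring_hom_grade2])

lemma tdeg_mult:
  fixes f g :: "'k::idom poly poly"
  shows "f \<noteq> 0 \<Longrightarrow> g \<noteq> 0 \<Longrightarrow> tdeg (f * g) = tdeg f + tdeg g"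
  by (simp add: tdeg_def ring_hom_simps[OF ring_hom_grade2] degree_mult_eq)

lemma tdeg_mult_le: "tdeg f \<le> a \<Longrightarrow> tdeg g \<le> b \<Longrightarrow> tdeg (f * g) \<le> a + b"
  using degree_mult_le[of "grade2 f" "grade2 g"]
  by (simp add: tdeg_def ring_hom_simps[OF ring_hom_grade2])

lemma tdeg_add_le: "tdeg f \<le> m \<Longrightarrow> tdeg g \<le> m \<Longrightarrow> tdeg (f + g) \<le> m"
  by (simp add: tdeg_def ring_hom_simps[OF ring_hom_grade2] degree_add_le)

lemma tdeg_minus [simp]: "tdeg (- f) = tdeg f"
  by (simp add: tdeg_def ring_hom_simps[OF ring_hom_grade2])

lemma tdeg_diff_le: "tdeg f \<le> m \<Longrightarrow> tdeg g \<le> m \<Longrightarrow> tdeg (f - g) \<le> m"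
  by (simp add: tdeg_def ring_hom_simps[OF ring_hom_grade2] degree_diff_le)

lemma tdeg_le_iff: "tdeg f \<le> m \<longleftrightarrow> (\<forall>i j. i + j > m \<longrightarrow> coeff (coeff f j) i = 0)"
proof
  assume "tdeg f \<le> m"
  then have z: "coeff (grade2 f) k = 0" if "k > m" for k
    using that by (simp add: tdeg_def coeff_eq_0)
  show "\<forall>i j. i + j > m \<longrightarrow> coeff (coeff f j) i = 0"
  proof (intro allI impI)
    fix i j assume "i + j > m"
    then show "coeff (coeff f j) i = 0" using z[of "i + j"] coeff_grade2[of f "i + j" j i] by simp
  qed
next
  assume "\<forall>i j. i + j > m \<longrightarrow> coeff (coeff f j) i = 0"
  then show "tdeg f \<le> m"
    unfolding tdeg_def by (intro degree_le) (auto simp: poly_eq_iff coeff_grade2)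
qed

lemma tdeg_pCons_le_iff:
  "tdeg (pCons c f) \<le> m \<longleftrightarrow> degree c \<le> m \<and> (f = 0 \<or> (0 < m \<and> tdeg f \<le> m - 1))"
proof
  assume A: "tdeg (pCons c f) \<le> m"
  have "degree c \<le> m"
    using A unfolding tdeg_le_iff by (intro degree_le) (metis add_0_right coeff_pCons_0)
  moreover have z: "coeff (coeff f j) i = 0" if "i + Suc j > m" for i j
    using A that unfolding tdeg_le_iff by (metis coeff_pCons_Suc)
  have "f = 0 \<or> (0 < m \<and> tdeg f \<le> m - 1)"
  proof (cases "m = 0")
    case True
    then have "f = 0" using z by (auto simp: poly_eq_iff)
    then show ?thesis by simp
  next
    case False
    then show ?thesis using z by (auto simp: tdeg_le_iff)
  qed
  ultimately show "degree c \<le> m \<and> (f = 0 \<or> (0 < m \<and> tdeg f \<le> m - 1))" by simp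
next
  assume A: "degree c \<le> m \<and> (f = 0 \<or> (0 < m \<and> tdeg f \<le> m - 1))"
  show "tdeg (pCons c f) \<le> m"
    unfolding tdeg_le_iff
  proof (intro allI impI)
    fix i j assume "i + j > m"
    then show "coeff (coeff (pCons c f) j) i = 0"
      using A by (cases j) (auto simp: coeff_eq_0 tdeg_le_iff)
  qed
qed

lemma tdeg_const [simp]: "tdeg [:[:c:]:] = 0"
  using tdeg_pCons_le_iff[of "[:c:]" 0 0] by simp

lemma tdeg_1 [simp]: "tdeg 1 = 0"
  by (simp add: one_pCons)

lemma tdeg_eq_0_const:
  assumes "tdeg f = 0" obtains c where "f = [:[:c:]:]"
proof -
  obtain c g where f: "f = pCons c g" by (cases f)
  with assms have "degree c \<le> 0" "g = 0" using tdeg_pCons_le_iff[of c g 0] by auto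
  then show thesis using f that degree_eq_zeroE[of c] by auto
qed

section \<open>Affine lines and restriction of polynomials to a line\<close>

definition is_line :: "('k::field ^ 2) set \<Rightarrow> bool" where
  "is_line H \<longleftrightarrow> (\<exists>a b c. (a \<noteq> 0 \<or> b \<noteq> 0) \<and> H = line a b c)"

text \<open>
  A line determines its equation up to a scalar; one equation is chosen once and for all.
\<close>

definition line_coeffs :: "('k::field ^ 2) set \<Rightarrow> 'k \<times> 'k \<times> 'k" where
  "line_coeffs H = (SOME (a, b, c). (a \<noteq> 0 \<or> b \<noteq> 0) \<and> H = line a b c)"

abbreviation "la H \<equiv> fst (line_coeffs H)"
abbreviation "lb H \<equiv> fst (snd (line_coeffs H))"
abbreviation "lc H \<equiv> snd (snd (line_coeffs H))"

lemma line_coeffs: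
  assumes "is_line H"
  shows "la H \<noteq> 0 \<or> lb H \<noteq> 0" "H = line (la H) (lb H) (lc H)"
proof -
  obtain a b c where abc: "(a \<noteq> 0 \<or> b \<noteq> 0) \<and> H = line a b c"
    using assms unfolding is_line_def by blast
  have "(\<lambda>(a, b, c). (a \<noteq> 0 \<or> b \<noteq> 0) \<and> H = line a b c) (line_coeffs H)"
    unfolding line_coeffs_def by (rule someI[of _ "(a, b, c)"]) (simp only: prod.case abc)
  then show "la H \<noteq> 0 \<or> lb H \<noteq> 0" "H = line (la H) (lb H) (lc H)"
    by (simp_all only: case_prod_beta)
qed

definition lform :: "'k::field \<Rightarrow> 'k \<Rightarrow> 'k \<Rightarrow> 'k poly poly" where
  "lform a b c = [:[:c, a:], [:b:]:]"

definition alpha :: "('k::field ^ 2) set \<Rightarrow> 'k poly poly" where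
  "alpha H = lform (la H) (lb H) (lc H)"

lemma lform_nonzero: "a \<noteq> 0 \<or> b \<noteq> 0 \<Longrightarrow> lform a b c \<noteq> 0"
  by (auto simp: lform_def)

lemma tdeg_lform: assumes "a \<noteq> 0 \<or> b \<noteq> 0" shows "tdeg (lform a b c) = 1"
proof -
  have "tdeg (lform a b c) \<le> 1" by (simp add: lform_def tdeg_pCons_le_iff)
  moreover have "\<not> tdeg (lform a b c) \<le> 0" using assms tdeg_pCons_le_iff[of "[:c, a:]" "[:[:b:]:]" 0]
    unfolding lform_def by auto
  ultimately show ?thesis by simp
qed

lemma alpha_nonzero: "is_line H \<Longrightarrow> alpha H \<noteq> 0"
  unfolding alpha_def by (intro lform_nonzero line_coeffs)

lemma tdeg_alpha: "is_line H \<Longrightarrow> tdeg (alpha H) = 1"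
  unfolding alpha_def by (intro tdeg_lform line_coeffs)

definition base :: "('k::field ^ 2) set \<Rightarrow> 'k ^ 2" where
  "base H = (SOME v. v \<in> H)"

lemma line_nonempty:
  assumes "a \<noteq> 0 \<or> b \<noteq> 0" shows "\<exists>v. v \<in> line a b (c :: 'k::field)"
proof (cases "a = 0")
  case True
  then have "(vector [0, - c / b] :: 'k ^ 2) \<in> line a b c" using assms
    by (simp add: line_def)
  then show ?thesis ..
next
  case False
  then have "(vector [- c / a, 0] :: 'k ^ 2) \<in> line a b c" using assms
    by (simp add: line_def)
  then show ?thesis ..
qed

lemma base_in: assumes "is_line H" shows "base H \<in> H"
proof -
  obtain v where "v \<in> H" using assms line_nonempty unfolding is_line_def by metis
  then show ?thesis unfolding base_def by (rule someI)
qed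

lemma in_line_iff:
  assumes "is_line H"
  shows "v \<in> H \<longleftrightarrow> la H * v $ 1 + lb H * v $ 2 + lc H = 0"
proof -
  have "v \<in> line (la H) (lb H) (lc H) \<longleftrightarrow> la H * v $ 1 + lb H * v $ 2 + lc H = 0"
    by (simp add: line_def)
  then show ?thesis by (simp only: line_coeffs(2)[OF assms, symmetric])
qed

lemma base_eq: "is_line H \<Longrightarrow> la H * base H $ 1 + lb H * base H $ 2 + lc H = 0"
  using base_in in_line_iff by blast

text \<open>
  Substitution of the parametrization \<open>t \<mapsto> base H + t (- lb H, la H)\<close> of \<open>H\<close>.
\<close>

definition restr :: "('k::field ^ 2) set \<Rightarrow> 'k poly poly \<Rightarrow> 'k poly" where
  "restr H = eval_hom (eval_hom (\<lambda>k. [:k:]) [:base H $ 1, - lb H:]) [:base H $ 2, la H:]"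

lemma ring_hom_restr: "ring_hom (restr H)"
  unfolding restr_def by (intro ring_hom_eval_hom ring_hom_const)

lemmas restr_simps = ring_hom_simps[OF ring_hom_restr]

lemma ring_hom_eval_const: "ring_hom (eval_hom (\<lambda>k. [:k::'k::field:]) u)"
  by (intro ring_hom_eval_hom ring_hom_const)

lemma eval_const_const [simp]: "eval_hom (\<lambda>k. [:k::'k::field:]) u [:c:] = [:c:]"
  by simp

lemma restr_const [simp]: "restr H [:[:c:]:] = [:c:]"
  unfolding restr_def by (simp add: ring_hom_simps[OF ring_hom_eval_const])

lemma restr_lform:
  "restr H (lform a b c) =
     [:a * base H $ 1 + b * base H $ 2 + c, b * la H - a * lb H:]"
  unfolding restr_def lform_def by (simp add: ring_hom_simps[OF ring_hom_eval_const])

lemma restr_alpha_self: "is_line H \<Longrightarrow> restr H (alpha H) = 0"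
  unfolding alpha_def restr_lform by (simp add: base_eq)

lemma degree_eval_const_le:
  assumes "degree (u::'k::field poly) \<le> 1"
  shows "degree (eval_hom (\<lambda>k. [:k:]) u c) \<le> degree c"
proof (induction c)
  case (pCons a c)
  then show ?case
  proof (cases "c = 0")
    case False
    have "degree (u * eval_hom (\<lambda>k. [:k:]) u c) \<le> 1 + degree c"
      using degree_mult_le[of u "eval_hom (\<lambda>k. [:k:]) u c"] assms pCons.IH by linarith
    then show ?thesis using False by (simp add: degree_add_le)
  qed simp
qed simp

lemma degree_linear_le: "degree [:a, b:] \<le> 1"
  by (intro degree_le) (auto simp: coeff_pCons split: nat.splits)

lemma degree_restr_le: "tdeg f \<le> m \<Longrightarrow> degree (restr H f) \<le> m"
proof (induction f arbitrary: m)
  case 0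
  then show ?case by (simp add: restr_simps)
next
  case (pCons c f)
  have r: "restr H (pCons c f) = eval_hom (\<lambda>k. [:k:]) [:base H $ 1, - lb H:] c
            + [:base H $ 2, la H:] * restr H f"
    unfolding restr_def by (simp add: ring_hom_simps[OF ring_hom_eval_const])
  have c: "degree c \<le> m" and f: "f = 0 \<or> (0 < m \<and> tdeg f \<le> m - 1)"
    using pCons.prems by (simp_all add: tdeg_pCons_le_iff)
  have d1: "degree (eval_hom (\<lambda>k. [:k:]) [:base H $ 1, - lb H:] c) \<le> m"
    using le_trans[OF degree_eval_const_le[OF degree_linear_le] c] .
  have d2: "degree ([:base H $ 2, la H:] * restr H f) \<le> m"
  proof (cases "f = 0")
    case True
    then show ?thesis by (simp add: restr_simps)
  next
    case False
    then have "degree (restr H f) \<le> m - 1" "0 < m" using f pCons.IH by auto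
    then show ?thesis
      using degree_mult_le[of "[:base H $ 2, la H:]" "restr H f"]
        degree_linear_le[of "base H $ 2" "la H"] by linarith
  qed
  show ?case unfolding r using d1 d2 by (intro degree_add_le)
qed

text \<open>
  The direction of \<open>H\<close> is nonzero, so some polynomial of degree one restricts to the parameter \<open>t\<close>.
  Substituting it for \<open>t\<close> extends \<open>h\<close> to the plane without raising the degree.
\<close>

lemma restr_lift:
  assumes H: "is_line H" and h: "degree h \<le> e"
  obtains f where "tdeg f \<le> e" "restr H f = h"
proof -
  obtain l where l: "tdeg l \<le> 1" "restr H l = [:0, 1:]"
  proof (cases "la H = 0")
    case False
    have "restr H (lform 0 (1 / la H) (- base H $ 2 / la H)) = [:0,1:]"
      using False by (simp add: restr_lform)
    then show thesis using that[of "lform 0 (1 / la H) (- base H $ 2 / la H)"] False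
      by (simp add: tdeg_lform)
  next
    case True
    then have b: "lb H \<noteq> 0" using line_coeffs(1)[OF H] by simp
    have "restr H (lform (- 1 / lb H) 0 (base H $ 1 / lb H)) = [:0,1:]"
      using b by (simp add: restr_lform)
    then show thesis using that[of "lform (- 1 / lb H) 0 (base H $ 1 / lb H)"] b
      by (simp add: tdeg_lform)
  qed
  have "\<exists>f. tdeg f \<le> e \<and> restr H f = h"
    using h
  proof (induction h arbitrary: e)
    case 0
    have "tdeg 0 \<le> e" "restr H 0 = 0" by (simp_all add: restr_simps)
    then show ?case by blast
  next
    case (pCons c h)
    show ?case
    proof (cases "h = 0")
      case True
      then have "tdeg [:[:c:]:] \<le> e" "restr H [:[:c:]:] = pCons c h" by simp_all
      then show ?thesis by blast
    next
      case False
      then have e: "degree h \<le> e - 1" "e = 1 + (e - 1)" using pCons.prems by simp_all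
      then obtain f where f: "tdeg f \<le> e - 1" "restr H f = h" using pCons.IH by blast
      have "tdeg (l * f) \<le> e" using tdeg_mult_le[OF l(1) f(1)] e(2) by simp
      then have "tdeg ([:[:c:]:] + l * f) \<le> e" by (intro tdeg_add_le) simp_all
      moreover have "restr H ([:[:c:]:] + l * f) = pCons c h"
        by (simp add: restr_simps l f)
      ultimately show ?thesis by blast
    qed
  qed
  then show thesis using that by blast
qed

lemma eval_const_eq_pcompose: "eval_hom (\<lambda>k. [:k::'k::field:]) u c = pcompose c u"
  by (simp add: eval_hom_def pcompose_altdef)

text \<open>
  If the line is not vertical, its form is monic in \<open>y\<close> up to a constant, and the remainder after
  division is a polynomial in \<open>x\<close> alone, on which restriction is injective.  For a vertical line
  restriction amounts to evaluating the coefficients at the abscissa.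
\<close>

lemma restr_eq_0_iff:
  assumes H: "is_line H"
  shows "restr H f = 0 \<longleftrightarrow> alpha H dvd f"
proof
  assume "alpha H dvd f"
  then show "restr H f = 0"
    by (auto elim!: dvdE simp: restr_simps restr_alpha_self[OF H])
next
  assume 0: "restr H f = 0"
  show "alpha H dvd f"
  proof (cases "lb H = 0")
    case False
    define s where "s = [:- lc H / lb H, - la H / lb H:]"
    have al: "alpha H = [:[:lb H:]:] * [:- s, 1:]"
      using False by (simp add: alpha_def lform_def s_def)
    have "[:- s, 1:] dvd f - [:poly f s:]"
      by (subst poly_eq_0_iff_dvd[symmetric]) simp
    then obtain q where q: "f - [:poly f s:] = [:- s, 1:] * q" by (elim dvdE)
    have inv: "[:[:lb H:]:] * [:[:1 / lb H:]:] = 1"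
      using False by (simp add: one_pCons)
    have "alpha H * ([:[:1 / lb H:]:] * q) = ([:[:lb H:]:] * [:[:1 / lb H:]:]) * ([:- s, 1:] * q)"
      unfolding al by (simp only: ac_simps)
    then have "f - [:poly f s:] = alpha H * ([:[:1 / lb H:]:] * q)"
      by (simp only: q inv mult_1_left)
    then have f: "f = alpha H * ([:[:1 / lb H:]:] * q) + [:poly f s:]" by (simp add: algebra_simps)
    have "restr H f = restr H [:poly f s:]"
      by (subst f) (simp only: restr_simps restr_alpha_self[OF H] mult_zero_left add_0_left)
    also have "\<dots> = pcompose (poly f s) [:base H $ 1, - lb H:]"
      unfolding restr_def by (simp add: ring_hom_simps[OF ring_hom_eval_const] eval_const_eq_pcompose)
    finally have "pcompose (poly f s) [:base H $ 1, - lb H:] = 0" using 0 by simp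
    then have "poly f s = 0" using False by (subst (asm) pcompose_eq_0_iff) auto
    then show ?thesis using f by (metis add.right_neutral dvd_triv_left pCons_0_0)
  next
    case True
    then have a: "la H \<noteq> 0" using line_coeffs(1)[OF H] by simp
    define x0 where "x0 = base H $ 1"
    have al: "alpha H = [:Polynomial.smult (la H) [:- x0, 1:]:]"
      using base_eq[OF H] True by (simp add: alpha_def lform_def x0_def add_eq_0_iff)
    have "restr H f = pcompose (map_poly (\<lambda>q. poly q x0) f) [:base H $ 2, la H:]"
    proof (induction f)
      case 0
      then show ?case by (simp add: restr_simps)
    next
      case (pCons c f)
      have "restr H (pCons c f) = eval_hom (\<lambda>k. [:k:]) [:base H $ 1, - lb H:] c
            + [:base H $ 2, la H:] * restr H f"
        unfolding restr_def by (simp add: ring_hom_simps[OF ring_hom_eval_const])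
      moreover have "eval_hom (\<lambda>k. [:k:]) [:base H $ 1, - lb H:] c = [:poly c x0:]"
        unfolding True x0_def by (simp add: eval_const_eq_pcompose pcompose_altdef, induction c)
          (simp_all add: map_poly_pCons)
      ultimately show ?case using pCons.IH by (simp add: map_poly_pCons pcompose_pCons)
    qed
    then have "map_poly (\<lambda>q. poly q x0) f = 0"
      using 0 a by (simp add: pcompose_eq_0_iff)
    then have "poly (coeff f n) x0 = 0" for n
      by (metis (no_types, lifting) coeff_0 coeff_map_poly poly_0)
    then have "Polynomial.smult (la H) [:- x0, 1:] dvd coeff f n" for n
      using a unfolding poly_eq_0_iff_dvd by (simp only: smult_dvd_iff if_False)
    then show ?thesis unfolding al by (simp add: const_poly_dvd_iff)
  qed
qed

section \<open>Logarithmic vector fields in the plane\<close>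

type_synonym 'k field2 = "'k poly poly \<times> 'k poly poly"

abbreviation K2 :: "'k::field \<Rightarrow> 'k poly poly" where "K2 c \<equiv> [:[:c:]:]"

lemma K2_mult: "K2 a * K2 b = K2 (a * b)"
  by simp

lemma K2_dvd_cancel:
  assumes "a \<noteq> 0" "p dvd K2 a * f"
  shows "p dvd f"
proof -
  have "K2 (1 / a) * (K2 a * f) = (K2 (1 / a) * K2 a) * f" by (simp only: ac_simps)
  also have "K2 (1 / a) * K2 a = 1" using assms(1) by (simp add: one_pCons)
  finally have "f = K2 (1 / a) * (K2 a * f)" by simp
  then show ?thesis using assms(2) by (metis dvd_mult)
qed

definition normal :: "('k::field ^ 2) set \<Rightarrow> 'k field2 \<Rightarrow> 'k poly poly" where
  "normal H \<theta> = K2 (la H) * fst \<theta> + K2 (lb H) * snd \<theta>"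

definition log_fields :: "('k::field ^ 2) set set \<Rightarrow> 'k field2 set" where
  "log_fields A = {\<theta>. \<forall>H\<in>A. alpha H dvd normal H \<theta>}"

definition det2 :: "'k::field field2 \<Rightarrow> 'k field2 \<Rightarrow> 'k poly poly" where
  "det2 \<theta> \<eta> = fst \<theta> * snd \<eta> - snd \<theta> * fst \<eta>"

definition defining_poly :: "('k::field ^ 2) set set \<Rightarrow> 'k poly poly" where
  "defining_poly A = (\<Prod>H\<in>A. alpha H)"

definition field_deg_le :: "'k::field field2 \<Rightarrow> nat \<Rightarrow> bool" where
  "field_deg_le \<theta> m \<longleftrightarrow> tdeg (fst \<theta>) \<le> m \<and> tdeg (snd \<theta>) \<le> m"

definition field_scale :: "'k::field poly poly \<Rightarrow> 'k field2 \<Rightarrow> 'k field2" where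
  "field_scale p \<theta> = (p * fst \<theta>, p * snd \<theta>)"

definition meets :: "('k ^ 2) set set \<Rightarrow> ('k ^ 2) set \<Rightarrow> nat" where
  "meets C H = card (H \<inter> \<Union>C)"

lemma normal_add: "normal H (\<theta> + \<eta>) = normal H \<theta> + normal H \<eta>"
  by (simp add: normal_def algebra_simps del: mult_pCons_left mult_pCons_right)

lemma normal_scale: "normal H (field_scale p \<theta>) = p * normal H \<theta>"
  by (simp add: normal_def field_scale_def algebra_simps del: mult_pCons_left mult_pCons_right)

lemma log_fields_add: "\<theta> \<in> log_fields A \<Longrightarrow> \<eta> \<in> log_fields A \<Longrightarrow> \<theta> + \<eta> \<in> log_fields A"
  by (simp add: log_fields_def normal_add)

lemma log_fields_scale: "\<theta> \<in> log_fields A \<Longrightarrow> field_scale p \<theta> \<in> log_fields A"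
  by (simp add: log_fields_def normal_scale)

lemma log_fields_insert:
  "\<theta> \<in> log_fields (insert H A) \<longleftrightarrow> \<theta> \<in> log_fields A \<and> alpha H dvd normal H \<theta>"
  by (auto simp: log_fields_def)

lemma field_deg_le_add: "field_deg_le \<theta> m \<Longrightarrow> field_deg_le \<eta> m \<Longrightarrow> field_deg_le (\<theta> + \<eta>) m"
  by (simp add: field_deg_le_def tdeg_add_le)

lemma field_deg_le_scale:
  "tdeg p \<le> a \<Longrightarrow> field_deg_le \<theta> b \<Longrightarrow> field_deg_le (field_scale p \<theta>) (a + b)"
  by (simp add: field_deg_le_def field_scale_def tdeg_mult_le)

lemma tdeg_normal: "field_deg_le \<theta> m \<Longrightarrow> tdeg (normal H \<theta>) \<le> m"
  using tdeg_mult_le[of "K2 (la H)" 0 "fst \<theta>" m] tdeg_mult_le[of "K2 (lb H)" 0 "snd \<theta>" m]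
  unfolding normal_def field_deg_le_def by (intro tdeg_add_le) simp_all

text \<open>
  On \<open>H\<close> both fields are tangent to \<open>H\<close>, hence linearly dependent.
\<close>

lemma alpha_dvd_det2:
  assumes H: "is_line H" and "alpha H dvd normal H \<theta>" "alpha H dvd normal H \<eta>"
  shows "alpha H dvd det2 \<theta> \<eta>"
proof -
  have 1: "K2 (la H) * det2 \<theta> \<eta> = normal H \<theta> * snd \<eta> - normal H \<eta> * snd \<theta>"
    unfolding det2_def normal_def by (simp add: algebra_simps del: mult_pCons_left mult_pCons_right)
  have 2: "K2 (lb H) * det2 \<theta> \<eta> = normal H \<eta> * fst \<theta> - normal H \<theta> * fst \<eta>"
    unfolding det2_def normal_def by (simp add: algebra_simps del: mult_pCons_left mult_pCons_right)
  have "alpha H dvd K2 (la H) * det2 \<theta> \<eta>" "alpha H dvd K2 (lb H) * det2 \<theta> \<eta>"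
    unfolding 1 2 using assms by (auto intro!: dvd_diff dvd_mult2)
  then show ?thesis using line_coeffs(1)[OF H] K2_dvd_cancel by blast
qed

lemma proportional_lines:
  fixes a b c a' b' c' :: "'k::field"
  assumes "a \<noteq> 0 \<or> b \<noteq> 0" "a' \<noteq> 0 \<or> b' \<noteq> 0"
    "a * x + b * y + c = 0" "a' * x + b' * y + c' = 0" "b' * a - a' * b = 0"
  obtains k where "k \<noteq> 0" "a' = k * a" "b' = k * b" "c' = k * c"
proof -
  obtain k where k: "a' = k * a" "b' = k * b"
  proof (cases "a = 0")
    case True
    then have "b \<noteq> 0" "a' = 0" using assms by auto
    then show thesis using that[of "b' / b"] True by simp
  next
    case False
    have "b' = a' / a * b" using assms(5) False by (simp add: field_simps)
    then show thesis using that[of "a' / a"] False by simp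
  qed
  have "k \<noteq> 0" using k assms(2) by auto
  moreover have "c' = k * c"
  proof -
    have "k * (a * x + b * y + c) + (c' - k * c) = 0"
      using assms(4) unfolding k by (simp add: algebra_simps)
    then show ?thesis using assms(3) by simp
  qed
  ultimately show thesis using that k by blast
qed

lemma line_eqI:
  assumes H: "is_line H" and H': "is_line H'" and 0: "restr H (alpha H') = 0"
  shows "H = H'"
proof -
  have z: "la H' * base H $ 1 + lb H' * base H $ 2 + lc H' = 0" "lb H' * la H - la H' * lb H = 0"
    using 0 unfolding alpha_def restr_lform by simp_all
  obtain k where k: "k \<noteq> 0" "la H' = k * la H" "lb H' = k * lb H" "lc H' = k * lc H"
    using proportional_lines[OF line_coeffs(1)[OF H] line_coeffs(1)[OF H'] base_eq[OF H] z] by blast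
  have "v \<in> H \<longleftrightarrow> v \<in> H'" for v
  proof -
    have "la H' * v $ 1 + lb H' * v $ 2 + lc H' = k * (la H * v $ 1 + lb H * v $ 2 + lc H)"
      unfolding k by (simp add: algebra_simps)
    then show ?thesis using k(1) by (simp add: in_line_iff[OF H] in_line_iff[OF H'])
  qed
  then show ?thesis by blast
qed

lemma restr_defining_poly: "restr H (defining_poly A) = (\<Prod>H'\<in>A. restr H (alpha H'))"
  unfolding defining_poly_def by (rule ring_hom_prod[OF ring_hom_restr])

lemma restr_defining_poly_nonzero:
  assumes "is_line H" "\<And>H'. H' \<in> A \<Longrightarrow> is_line H'" "H \<notin> A"
  shows "restr H (defining_poly A) \<noteq> 0"
proof (cases "finite A")
  case True
  then show ?thesis unfolding restr_defining_poly using assms line_eqI by (auto simp: prod_zero_iff)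
qed (simp add: restr_defining_poly)

lemma defining_poly_nonzero: "(\<And>H. H \<in> A \<Longrightarrow> is_line H) \<Longrightarrow> defining_poly A \<noteq> 0"
  by (cases "finite A") (auto simp: defining_poly_def alpha_nonzero)

lemma defining_poly_insert:
  "finite A \<Longrightarrow> H \<notin> A \<Longrightarrow> defining_poly (insert H A) = alpha H * defining_poly A"
  by (simp add: defining_poly_def)

lemma tdeg_defining_poly:
  "finite A \<Longrightarrow> (\<And>H. H \<in> A \<Longrightarrow> is_line H) \<Longrightarrow> tdeg (defining_poly A) = card A"
proof (induction A rule: finite_induct)
  case (insert H A)
  then show ?case
    by (simp add: defining_poly_insert tdeg_mult alpha_nonzero defining_poly_nonzero tdeg_alpha)
qed (simp add: defining_poly_def)

text \<open>
  The forms of distinct lines are coprime in the following sense: restricted to a further line, the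
  product of the others is a nonzero element of a domain, so the form of that line has to divide the
  remaining cofactor.
\<close>

lemma defining_poly_dvd:
  assumes "finite A" "\<And>H. H \<in> A \<Longrightarrow> is_line H" "\<And>H. H \<in> A \<Longrightarrow> alpha H dvd f"
  shows "defining_poly A dvd f"
  using assms
proof (induction A rule: finite_induct)
  case (insert H A)
  then obtain s where s: "f = defining_poly A * s" by (metis dvdE insertCI)
  have H: "is_line H" using insert by simp
  have "restr H (defining_poly A) * restr H s = 0"
    using insert.prems(2)[of H] by (simp add: restr_eq_0_iff[OF H, symmetric] s restr_simps)
  moreover have "restr H (defining_poly A) \<noteq> 0"
    using insert by (intro restr_defining_poly_nonzero) auto
  ultimately have "alpha H dvd s" by (simp add: restr_eq_0_iff[OF H])
  then show ?case using insert by (simp add: s defining_poly_insert mult.commute mult_dvd_mono)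
qed (simp add: defining_poly_def)

lemma alpha_dvd_defining_poly: "finite A \<Longrightarrow> H \<in> A \<Longrightarrow> alpha H dvd defining_poly A"
  by (simp add: defining_poly_def dvd_prodI)

section \<open>Split univariate polynomials\<close>

abbreviation "root_set q \<equiv> {t. poly q t = 0}"

text \<open>
  Splitting into linear factors, expressed by counting the roots with multiplicity.
\<close>

definition splits :: "'k::field poly \<Rightarrow> bool" where
  "splits q \<longleftrightarrow> q \<noteq> 0 \<and> degree q = (\<Sum>t\<in>root_set q. order t q)"

lemma splits_const: "c \<noteq> 0 \<Longrightarrow> splits [:c:]"
  by (simp add: splits_def)

lemma order_linear: 
  assumes "(a::'k::field) \<noteq> 0" shows "order t [:b, a:] = (if poly [:b, a:] t = 0 then 1 else 0)"
proof -
  have "order t [:b,a:] \<le> 1" using order_degree[of "[:b,a:]" t] assms by simp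
  moreover have "order t [:b,a:] \<noteq> 0 \<longleftrightarrow> poly [:b,a:] t = 0"
    using assms order_root[of "[:b,a:]" t] by auto
  ultimately show ?thesis by auto
qed

lemma splits_linear:
  assumes "(a::'k::field) \<noteq> 0" shows "splits [:b, a:]"
proof -
  have "root_set [:b,a:] = {- b / a}" using assms
    by (auto simp: field_simps eq_neg_iff_add_eq_0 add.commute)
  then show ?thesis unfolding splits_def using assms
    by (simp add: order_linear)
qed

lemma sum_order_superset:
  assumes "finite T" "root_set q \<subseteq> T" "q \<noteq> 0"
  shows "(\<Sum>t\<in>root_set q. order t q) = (\<Sum>t\<in>T. order t q)"
  using assms by (intro sum.mono_neutral_left) (auto simp: order_root)

lemma splits_mult:
  assumes "splits p" "splits q" shows "splits (p * q)"
proof -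
  have n: "p \<noteq> 0" "q \<noteq> 0" using assms by (auto simp: splits_def)
  let ?T = "root_set (p * q)"
  have T: "finite ?T" using n by (intro poly_roots_finite) simp
  have "degree (p * q) = (\<Sum>t\<in>root_set p. order t p) + (\<Sum>t\<in>root_set q. order t q)"
    using assms n by (simp add: splits_def degree_mult_eq)
  also have "(\<Sum>t\<in>root_set p. order t p) = (\<Sum>t\<in>?T. order t p)"
    using T n by (intro sum_order_superset) auto
  also have "(\<Sum>t\<in>root_set q. order t q) = (\<Sum>t\<in>?T. order t q)"
    using T n by (intro sum_order_superset) auto
  also have "(\<Sum>t\<in>?T. order t p) + (\<Sum>t\<in>?T. order t q) = (\<Sum>t\<in>?T. order t (p * q))"
    using n by (simp add: order_mult sum.distrib)
  finally show ?thesis using n by (simp add: splits_def)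
qed

lemma splits_prod: "(\<And>x. x \<in> A \<Longrightarrow> splits (f x)) \<Longrightarrow> splits (prod f A)"
  by (induction A rule: infinite_finite_induct)
     (auto intro: splits_mult simp: splits_const[of 1, unfolded one_pCons[symmetric]])

text \<open>
  Powers of distinct linear factors are coprime: the order at a new root is not affected by the
  factors already split off.
\<close>

lemma prod_linear_power_dvd:
  fixes f :: "'k::field poly"
  assumes "finite T" "\<And>t. t \<in> T \<Longrightarrow> [:- t, 1:] ^ k t dvd f"
  shows "(\<Prod>t\<in>T. [:- t, 1:] ^ k t) dvd f"
  using assms
proof (induction T rule: finite_induct)
  case (insert t T)
  show ?case
  proof (cases "f = 0")
    case False
    obtain s where s: "f = (\<Prod>t\<in>T. [:- t, 1:] ^ k t) * s" using insert by (metis dvdE insertCI)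
    have s0: "s \<noteq> 0" and P0: "(\<Prod>t\<in>T. [:- t, 1:] ^ k t) \<noteq> 0" using False s by auto
    have "poly (\<Prod>t\<in>T. [:- t, 1:] ^ k t) t \<noteq> 0"
      using insert by (simp add: poly_prod)
    then have "order t (\<Prod>t\<in>T. [:- t, 1:] ^ k t) = 0" by (simp add: order_0I)
    then have "order t f = order t s" using False unfolding s by (subst order_mult) auto
    moreover have "k t \<le> order t f" using insert.prems[of t] False by (simp add: order_divides)
    ultimately have "[:- t, 1:] ^ k t dvd s" by (simp add: order_divides)
    then show ?thesis using insert by (simp add: s mult.commute mult_dvd_mono)
  qed simp
qed simp

text \<open>
  For a polynomial that splits, this is the quotient by its radical, up to a constant.
\<close>

definition radical_quotient :: "'k::field poly \<Rightarrow> 'k poly" where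
  "radical_quotient q = (\<Prod>t\<in>root_set q. [:- t, 1:] ^ (order t q - 1))"

lemma radical_quotient_nonzero: "radical_quotient q \<noteq> 0"
  by (cases "finite (root_set q)") (simp_all add: radical_quotient_def)

lemma degree_prod_linear_power:
  "finite T \<Longrightarrow> degree (\<Prod>t\<in>T. [:- t, 1:: 'k::field:] ^ k t) = (\<Sum>t\<in>T. k t)"
  by (subst degree_prod_eq_sum_degree) (simp_all add: degree_power_eq)

lemma splits_radical_quotient:
  assumes "splits q"
  obtains c where "c \<noteq> 0" "q = Polynomial.smult c (radical_quotient q * (\<Prod>t\<in>root_set q. [:- t, 1:]))"
    "degree q = degree (radical_quotient q) + card (root_set q)"
proof -
  have q0: "q \<noteq> 0" and dq: "degree q = (\<Sum>t\<in>root_set q. order t q)" using assms by (auto simp: splits_def)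
  let ?T = "root_set q"
  have T: "finite ?T" using q0 by (rule poly_roots_finite)
  have o: "order t q \<noteq> 0" if "t \<in> ?T" for t using that q0 by (simp add: order_root)
  have eq: "radical_quotient q * (\<Prod>t\<in>?T. [:- t, 1:]) = (\<Prod>t\<in>?T. [:- t, 1:] ^ order t q)"
    unfolding radical_quotient_def prod.distrib[symmetric]
  proof (rule prod.cong[OF refl])
    fix t assume "t \<in> ?T"
    then obtain k where "order t q = Suc k" using o by (metis not0_implies_Suc)
    then show "[:- t, 1:] ^ (order t q - 1) * [:- t, 1:] = [:- t, 1:] ^ order t q" by (simp add: mult.commute)
  qed
  have "(\<Prod>t\<in>?T. [:- t, 1:] ^ order t q) dvd q"
    using T q0 by (intro prod_linear_power_dvd) (simp_all add: order_divides)
  then obtain s where s: "q = (\<Prod>t\<in>?T. [:- t, 1:] ^ order t q) * s" by (elim dvdE)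
  let ?P = "\<Prod>t\<in>?T. [:- t, 1:] ^ order t q"
  have n: "?P \<noteq> 0" "s \<noteq> 0" using s q0 by auto
  have dP: "degree ?P = degree q" unfolding dq using T by (rule degree_prod_linear_power)
  have "degree q = degree ?P + degree s" using degree_mult_eq[OF n] s by simp
  then have "degree s = 0" using dP by simp
  then obtain c where c: "s = [:c:]" by (elim degree_eq_zeroE)
  have "q = ?P * [:c:]" using s unfolding c .
  then have qc: "q = Polynomial.smult c ?P" by simp
  have "degree (\<Prod>t\<in>?T. [:- t, 1::'a:]) = card ?T"
    using degree_prod_linear_power[OF T, of "\<lambda>_. 1"] by simp
  moreover have "(\<Prod>t\<in>?T. [:- t, 1::'a:]) \<noteq> 0" using T by simp
  ultimately have "degree ?P = degree (radical_quotient q) + card ?T"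
    unfolding eq[symmetric] by (subst degree_mult_eq) (simp_all add: radical_quotient_nonzero)
  then show thesis using that[of c] qc eq c n dP by simp
qed

text \<open>
  Lagrange interpolation: the difference of \<open>r\<close> and its interpolant has more roots than its degree
  allows.
\<close>

lemma lagrange_basis_spans:
  fixes r :: "'k::field poly"
  assumes T: "finite T" and r: "r = 0 \<or> degree r < card T"
  obtains c where "r = (\<Sum>t\<in>T. Polynomial.smult (c t) (\<Prod>s\<in>T - {t}. [:- s, 1:]))"
proof -
  let ?R = "\<lambda>t. \<Prod>s\<in>T - {t}. [:- s, 1:] :: 'k poly"
  define c where "c t = poly r t / poly (?R t) t" for t
  define d where "d = r - (\<Sum>t\<in>T. Polynomial.smult (c t) (?R t))"
  show thesis
  proof (cases "T = {}")
    case True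
    then show ?thesis using that r by simp
  next
    case False
    then have cT: "card T > 0" using T by (simp add: card_gt_0_iff)
    have nz: "poly (?R t) t \<noteq> 0" for t using T by (simp add: poly_prod)
    have z: "poly (?R s) t = 0" if "s \<in> T" "t \<in> T" "s \<noteq> t" for s t
      using that T by (auto simp: poly_prod intro!: prod_zero bexI[of _ t])
    have root: "poly d t = 0" if t: "t \<in> T" for t
    proof -
      have "(\<Sum>s\<in>T. c s * poly (?R s) t) = (\<Sum>s\<in>{t}. c s * poly (?R s) t)"
        using T t z by (intro sum.mono_neutral_right) auto
      also have "\<dots> = poly r t" using nz[of t] by (simp add: c_def)
      finally show ?thesis by (simp add: d_def poly_sum)
    qed
    have "degree (?R t) < card T" if "t \<in> T" for t
      using degree_prod_linear_power[of "T - {t}" "\<lambda>_. 1"] T that cT by (simp add: card_Diff_singleton)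
    then have "degree (\<Sum>t\<in>T. Polynomial.smult (c t) (?R t)) < card T"
      using cT by (intro degree_sum_less) (auto intro: le_less_trans[OF degree_smult_le])
    then have dd: "degree d < card T" unfolding d_def using r cT by (intro degree_diff_less) auto
    have "d = 0"
    proof (rule ccontr)
      assume "d \<noteq> 0"
      then have "card (root_set d) \<le> degree d" "finite (root_set d)"
        by (auto intro: card_poly_roots_bound poly_roots_finite)
      moreover have "card T \<le> card (root_set d)"
        using root \<open>finite (root_set d)\<close> by (intro card_mono) auto
      ultimately show False using dd by simp
    qed
    then show ?thesis using that[of c] by (simp add: d_def)
  qed
qed

section \<open>Restricting logarithmic fields to a new line\<close>

lemma arrangement_iff: "arrangement A \<longleftrightarrow> finite A \<and> (\<forall>H\<in>A. is_line H)"
  by (simp add: arrangement_def is_line_def)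

lemma arrangement_finite: "arrangement A \<Longrightarrow> finite A"
  and arrangement_line: "arrangement A \<Longrightarrow> H \<in> A \<Longrightarrow> is_line H"
  and arrangement_subset: "arrangement A \<Longrightarrow> B \<subseteq> A \<Longrightarrow> arrangement B"
  and arrangement_insert: "arrangement A \<Longrightarrow> is_line H \<Longrightarrow> arrangement (insert H A)"
  by (auto simp: arrangement_iff intro: finite_subset)

lemma coordinate_field_log:
  assumes A: "arrangement A"
  shows "field_scale (defining_poly A) (K2 u, K2 v) \<in> log_fields A"
    and "field_deg_le (field_scale (defining_poly A) (K2 u, K2 v)) (card A)"
proof -
  have n: "normal H (field_scale (defining_poly A) (K2 u, K2 v)) =
      defining_poly A * K2 (la H * u + lb H * v)" for H
    unfolding normal_scale by (simp add: normal_def)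
  show "field_scale (defining_poly A) (K2 u, K2 v) \<in> log_fields A"
    using A by (auto simp: log_fields_def n arrangement_iff simp del: mult_pCons_right
        intro!: dvd_mult2 alpha_dvd_defining_poly)
  show "field_deg_le (field_scale (defining_poly A) (K2 u, K2 v)) (card A)"
    using field_deg_le_scale[of "defining_poly A" "card A" "(K2 u, K2 v)" 0]
      tdeg_defining_poly[of A] A by (simp add: field_deg_le_def arrangement_iff)
qed

text \<open>
  The constant field along \<open>H\<close>, multiplied by the forms of the other lines.
\<close>

definition tangent_field :: "('k::field ^ 2) set set \<Rightarrow> ('k ^ 2) set \<Rightarrow> 'k field2" where
  "tangent_field A H = field_scale (defining_poly (A - {H})) (K2 (lb H), K2 (- la H))"

lemma normal_tangent_field:
  "normal H' (tangent_field A H) = defining_poly (A - {H}) * K2 (la H' * lb H - lb H' * la H)"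
  unfolding tangent_field_def normal_scale by (simp add: normal_def)

lemma tangent_field_log:
  assumes A: "arrangement A" and H: "H \<in> A"
  shows "tangent_field A H \<in> log_fields A" "field_deg_le (tangent_field A H) (card A - 1)"
proof -
  let ?D = "A - {H}"
  have D: "arrangement ?D" using A by (auto intro: arrangement_subset)
  have "alpha H' dvd normal H' (tangent_field A H)" if "H' \<in> A" for H'
  proof (cases "H' = H")
    case True
    then have "normal H' (tangent_field A H) = 0" unfolding normal_tangent_field by simp
    then show ?thesis by simp
  next
    case False
    then show ?thesis unfolding normal_tangent_field using that D
      by (intro dvd_mult2 alpha_dvd_defining_poly) (auto simp: arrangement_iff)
  qed
  then show "tangent_field A H \<in> log_fields A" by (simp add: log_fields_def)
  show "field_deg_le (tangent_field A H) (card A - 1)"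
    using field_deg_le_scale[of "defining_poly ?D" "card A - 1" "(K2 (lb H), K2 (- la H))" 0]
      tdeg_defining_poly[of ?D] D H by (simp add: tangent_field_def field_deg_le_def arrangement_iff)
qed

lemma unit_normal:
  assumes H: "is_line H" obtains u v where "la H * u + lb H * v = 1"
proof (cases "la H = 0")
  case True
  then show thesis using line_coeffs(1)[OF H] that[of 0 "1 / lb H"] by simp
next
  case False
  then show thesis using that[of "1 / la H" 0] by simp
qed

definition line_point :: "('k::field ^ 2) set \<Rightarrow> 'k \<Rightarrow> 'k ^ 2" where
  "line_point H t = vector [base H $ 1 - lb H * t, base H $ 2 + la H * t]"

lemma line_point_nth [simp]:
  "line_point H t $ 1 = base H $ 1 - lb H * t" "line_point H t $ 2 = base H $ 2 + la H * t"
  by (simp_all add: line_point_def)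

lemma poly_restr_alpha:
  assumes "is_line H'" shows "poly (restr H (alpha H')) t = 0 \<longleftrightarrow> line_point H t \<in> H'"
  unfolding in_line_iff[OF assms] alpha_def restr_lform by (simp add: algebra_simps)

lemma line_point_bij:
  assumes H: "is_line H" shows "bij_betw (line_point H) UNIV H"
proof (intro bij_betw_imageI injI subset_antisym subsetI)
  fix s t assume "line_point H s = line_point H t"
  then have "line_point H s $ 1 = line_point H t $ 1" "line_point H s $ 2 = line_point H t $ 2" by simp_all
  then show "s = t" using line_coeffs(1)[OF H] by auto
next
  fix v assume "v \<in> range (line_point H)"
  then show "v \<in> H" using base_eq[OF H] by (auto simp: in_line_iff[OF H] algebra_simps)
next
  fix v assume v: "v \<in> H"
  have e: "la H * (v $ 1 - base H $ 1) + lb H * (v $ 2 - base H $ 2) = 0"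
    using v base_eq[OF H] unfolding in_line_iff[OF H] by (simp add: algebra_simps add_eq_0_iff)
  define t where "t = (if la H = 0 then (base H $ 1 - v $ 1) / lb H else (v $ 2 - base H $ 2) / la H)"
  have "v $ 1 = line_point H t $ 1" "v $ 2 = line_point H t $ 2"
    using e line_coeffs(1)[OF H] by (auto simp: t_def field_simps add_eq_0_iff)
  then have "v = line_point H t" by (simp add: vec_eq_iff forall_2)
  then show "v \<in> range (line_point H)" by blast
qed

lemma root_set_restr:
  assumes C: "arrangement C"
  shows "root_set (restr H (defining_poly C)) = {t. line_point H t \<in> \<Union>C}"
  using C poly_restr_alpha[of _ H]
  by (auto simp: restr_defining_poly poly_prod arrangement_iff prod_zero_iff)

lemma meets_eq_card_roots:
  assumes C: "arrangement C" and H: "is_line H"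
  shows "meets C H = card (root_set (restr H (defining_poly C)))"
proof -
  have "bij_betw (line_point H) {t. line_point H t \<in> \<Union>C} (H \<inter> \<Union>C)"
  proof -
    have "line_point H ` {t. line_point H t \<in> \<Union>C} = range (line_point H) \<inter> \<Union>C" by blast
    then show ?thesis
      using line_point_bij[OF H] inj_on_subset[of "line_point H" UNIV]
      unfolding bij_betw_def by simp
  qed
  then show ?thesis unfolding meets_def root_set_restr[OF C] by (metis bij_betw_same_card)
qed

text \<open>
  The lines of \<open>C\<close> that meet \<open>H\<close> at infinity.  Their forms are constant on \<open>H\<close>, so they contribute
  to degrees and not to roots.
\<close>

definition parallels :: "('k::field ^ 2) set set \<Rightarrow> ('k ^ 2) set \<Rightarrow> ('k ^ 2) set set" where
  "parallels C H = {H' \<in> C. lb H' * la H - la H' * lb H = 0}"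

lemma degree_restr_alpha:
  "degree (restr H (alpha H')) = (if lb H' * la H - la H' * lb H = 0 then 0 else 1)"
  unfolding alpha_def restr_lform by simp

context
  fixes C :: "('k::field ^ 2) set set" and H :: "('k ^ 2) set"
  assumes C: "arrangement C" and H: "is_line H" and HC: "H \<notin> C"
begin

lemma restr_alpha_nonzero: "H' \<in> C \<Longrightarrow> restr H (alpha H') \<noteq> 0"
  using line_eqI[OF H, of H'] C HC by (auto simp: arrangement_iff)

lemma splits_restr: "splits (restr H (defining_poly C))"
  unfolding restr_defining_poly
proof (rule splits_prod)
  fix H' assume "H' \<in> C"
  then have "restr H (alpha H') \<noteq> 0" by (rule restr_alpha_nonzero)
  then show "splits (restr H (alpha H'))"
    unfolding alpha_def restr_lform using splits_const splits_linear by (metis pCons_0_0)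
qed

lemma degree_restr_defining_poly:
  "degree (restr H (defining_poly C)) + card (parallels C H) = card C"
proof -
  have fin: "finite C" using C by (rule arrangement_finite)
  have "degree (restr H (defining_poly C)) = (\<Sum>H'\<in>C. degree (restr H (alpha H')))"
    unfolding restr_defining_poly using restr_alpha_nonzero by (intro degree_prod_eq_sum_degree) auto
  also have "\<dots> = card (C - parallels C H)"
    unfolding degree_restr_alpha using fin
    by (subst card_eq_sum, intro sum.mono_neutral_cong_right) (auto simp: parallels_def)
  also have "\<dots> = card C - card (parallels C H)"
    using fin by (intro card_Diff_subset) (auto simp: parallels_def intro: finite_subset)
  moreover have "card (parallels C H) \<le> card C"
    using fin by (intro card_mono) (auto simp: parallels_def)
  ultimately show ?thesis by simp
qed

text \<open>
  Let \<open>p\<close> be the point of \<open>H\<close> with parameter \<open>t\<close>.  The determinant of \<open>\<theta>\<close> with the radial field around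
  \<open>p\<close> is divisible by the form of every line through \<open>p\<close>, because the radial field is tangent to these
  lines.  Along \<open>H\<close> the radial field points in the direction of \<open>H\<close>, so that there the determinant is the
  normal component of \<open>\<theta>\<close> times one linear factor.
\<close>

lemma root_order_bound:
  assumes \<theta>: "\<theta> \<in> log_fields C" and nz: "restr H (normal H \<theta>) \<noteq> 0"
  shows "order t (restr H (defining_poly C)) \<le> 1 + order t (restr H (normal H \<theta>))"
proof -
  define p where "p = line_point H t"
  define C0 where "C0 = {H' \<in> C. p \<in> H'}"
  \<comment> \<open>the determinant of \<open>\<theta>\<close> and the radial field around \<open>p\<close>\<close>
  define e where "e = (lform 0 1 (- p $ 2) * fst \<theta> - lform 1 0 (- p $ 1) * snd \<theta>)"
  have C0: "arrangement C0" "arrangement (C - C0)" 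
    using C by (auto simp: C0_def intro: arrangement_subset)
  have fin: "finite C0" "finite C" using C C0 by (auto simp: arrangement_iff)
  have "alpha H' dvd e" if H': "H' \<in> C0" for H'
  proof -
    have l: "is_line H'" using C0 H' by (auto simp: arrangement_iff)
    have d: "alpha H' dvd normal H' \<theta>" using \<theta> H' by (auto simp: log_fields_def C0_def)
    have "la H' * p $ 1 + lb H' * p $ 2 + lc H' = 0"
      using H' l by (simp add: C0_def in_line_iff)
    then have lc: "lc H' = la H' * - p $ 1 + lb H' * - p $ 2"
      by (simp add: eq_neg_iff_add_eq_0 algebra_simps)
    have al: "alpha H' = K2 (la H') * lform 1 0 (- p $ 1) + K2 (lb H') * lform 0 1 (- p $ 2)"
      unfolding alpha_def lc by (simp add: lform_def)
    have 1: "K2 (la H') * e = lform 0 1 (- p $ 2) * normal H' \<theta> - snd \<theta> * alpha H'"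
      unfolding e_def normal_def al
      by (simp add: algebra_simps del: mult_pCons_left mult_pCons_right)
    have 2: "K2 (lb H') * e = fst \<theta> * alpha H' - lform 1 0 (- p $ 1) * normal H' \<theta>"
      unfolding e_def normal_def al
      by (simp add: algebra_simps del: mult_pCons_left mult_pCons_right)
    have "alpha H' dvd K2 (la H') * e" "alpha H' dvd K2 (lb H') * e"
      unfolding 1 2 using d by (auto intro!: dvd_diff dvd_mult)
    then show ?thesis using line_coeffs(1)[OF l] K2_dvd_cancel by blast
  qed
  then have "defining_poly C0 dvd e"
    using C0 fin by (intro defining_poly_dvd) (auto simp: arrangement_iff)
  then have "restr H (defining_poly C0) dvd restr H e" by (rule ring_hom_dvd[OF ring_hom_restr])
  also have "restr H e = [:- t, 1:] * restr H (normal H \<theta>)"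
  proof -
    have r1: "restr H (lform 0 1 (- p $ 2)) = [:la H:] * [:- t, 1:]"
      and r2: "restr H (lform 1 0 (- p $ 1)) = [:- lb H:] * [:- t, 1:]"
      unfolding restr_lform p_def by (simp_all add: algebra_simps)
    have "restr H e = [:- t, 1:] * ([:la H:] * restr H (fst \<theta>) + [:lb H:] * restr H (snd \<theta>))"
      unfolding e_def restr_simps r1 r2
      by (simp add: smult_diff_right smult_add_right algebra_simps)
    then show ?thesis unfolding normal_def restr_simps by simp
  qed
  finally have dv: "restr H (defining_poly C0) dvd [:- t, 1:] * restr H (normal H \<theta>)" .
  have nz2: "[:- t, 1:] * restr H (normal H \<theta>) \<noteq> 0"
    using nz unfolding mult_eq_0_iff by simp
  have H0: "restr H (defining_poly C0) \<noteq> 0"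
    using H HC C0 by (intro restr_defining_poly_nonzero) (auto simp: arrangement_iff C0_def)
  have H1: "restr H (defining_poly (C - C0)) \<noteq> 0"
    using H HC C0 by (intro restr_defining_poly_nonzero) (auto simp: arrangement_iff C0_def)
  have "defining_poly C = defining_poly C0 * defining_poly (C - C0)"
    unfolding defining_poly_def using fin
    by (subst prod.subset_diff[of C0 C]) (auto simp: C0_def mult.commute)
  then have "order t (restr H (defining_poly C)) =
      order t (restr H (defining_poly C0)) + order t (restr H (defining_poly (C - C0)))"
    using H0 H1 by (simp add: restr_simps order_mult)
  moreover have "poly (restr H (defining_poly (C - C0))) t \<noteq> 0"
    using root_set_restr[OF C0(2), of H] by (auto simp: C0_def p_def)
  then have "order t (restr H (defining_poly (C - C0))) = 0" by (rule order_0I)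
  moreover have "order t (restr H (defining_poly C0)) \<le> order t ([:- t, 1:] * restr H (normal H \<theta>))"
    using dv nz2 by (rule dvd_imp_order_le[rotated])
  moreover have "order t ([:- t, 1:] * restr H (normal H \<theta>)) = 1 + order t (restr H (normal H \<theta>))"
    using nz2 order_linear[of "1::'k" t "- t"] by (subst order_mult) auto
  ultimately show ?thesis by simp
qed

text \<open>
  A line parallel to \<open>H\<close> has a proportional normal vector, so its form divides the normal component
  along \<open>H\<close> as well; on \<open>H\<close> that factor becomes constant and lowers the degree by one.
\<close>

lemma degree_restr_normal:
  assumes \<theta>: "\<theta> \<in> log_fields C" and d: "field_deg_le \<theta> d" and nz: "restr H (normal H \<theta>) \<noteq> 0"
  shows "degree (restr H (normal H \<theta>)) + card (parallels C H) \<le> d"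
proof -
  let ?P = "parallels C H"
  have P: "arrangement ?P" using C by (rule arrangement_subset) (auto simp: parallels_def)
  then have fin: "finite ?P" by (rule arrangement_finite)
  have "alpha H' dvd normal H \<theta>" if H': "H' \<in> ?P" for H'
  proof -
    have l: "is_line H'" and d: "alpha H' dvd normal H' \<theta>"
      using P H' \<theta> by (auto simp: arrangement_iff log_fields_def parallels_def)
    have e: "lb H' * la H = la H' * lb H" using H' by (simp add: parallels_def)
    have 1: "K2 (la H') * normal H \<theta> = K2 (la H) * normal H' \<theta>"
      unfolding normal_def distrib_left mult.assoc[symmetric] K2_mult
      by (simp only: e mult.commute[of "la H'" "la H"] mult.commute[of "la H" "lb H'"])
    have 2: "K2 (lb H') * normal H \<theta> = K2 (lb H) * normal H' \<theta>"
      unfolding normal_def distrib_left mult.assoc[symmetric] K2_mult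
      by (simp only: e mult.commute[of "lb H'" "lb H"] mult.commute[of "lb H" "la H'"])
    have "alpha H' dvd K2 (la H') * normal H \<theta>" "alpha H' dvd K2 (lb H') * normal H \<theta>"
      unfolding 1 2 using d by (auto simp only: intro!: dvd_mult)
    then show ?thesis using line_coeffs(1)[OF l] K2_dvd_cancel by blast
  qed
  then have "defining_poly ?P dvd normal H \<theta>"
    using P fin by (intro defining_poly_dvd) (auto simp: arrangement_iff)
  then obtain s where s: "normal H \<theta> = defining_poly ?P * s" by (elim dvdE)
  have nn: "normal H \<theta> \<noteq> 0" using nz by (auto simp: restr_simps)
  then have "tdeg (normal H \<theta>) = card ?P + tdeg s"
    unfolding s using P fin tdeg_defining_poly[of ?P]
    by (subst tdeg_mult) (auto simp: arrangement_iff)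
  then have ds: "tdeg s + card ?P \<le> d" using tdeg_normal[OF d, of H] by simp
  have "degree (restr H (defining_poly ?P)) = 0"
    unfolding restr_defining_poly using restr_alpha_nonzero
    by (subst degree_prod_eq_sum_degree) (auto simp: parallels_def degree_restr_alpha)
  then have "degree (restr H (normal H \<theta>)) \<le> degree (restr H s)"
    unfolding s restr_simps using degree_mult_le[of "restr H (defining_poly ?P)" "restr H s"] by simp
  also have "\<dots> \<le> tdeg s" by (intro degree_restr_le) simp
  finally show ?thesis using ds by simp
qed

abbreviation (input) "bq \<equiv> radical_quotient (restr H (defining_poly C))"

text \<open>
  The fixed divisor has order \<open>k - 1\<close> at a point through which \<open>k\<close> lines of \<open>C\<close> pass, hence degree
  \<open>|C|\<close> minus the number of parallels minus the number of points.
\<close>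

lemma restr_normal_factor:
  assumes \<theta>: "\<theta> \<in> log_fields C" and d: "field_deg_le \<theta> d"
  obtains h where "restr H (normal H \<theta>) = bq * h"
    "h = 0 \<or> degree h + card C \<le> d + meets C H"
proof (cases "restr H (normal H \<theta>) = 0")
  case True
  then show ?thesis using that[of 0] by simp
next
  case False
  let ?q = "restr H (defining_poly C)" and ?f = "restr H (normal H \<theta>)"
  have q0: "?q \<noteq> 0" using splits_restr by (simp add: splits_def)
  have "bq dvd ?f"
    unfolding radical_quotient_def
  proof (rule prod_linear_power_dvd)
    show "finite (root_set ?q)" using q0 by (rule poly_roots_finite)
    fix t
    show "[:- t, 1:] ^ (order t ?q - 1) dvd ?f"
      using root_order_bound[OF \<theta> False, of t] by (subst order_divides) auto
  qed
  then obtain h where h: "?f = bq * h" by (elim dvdE)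
  have "degree ?q = degree bq + card (root_set ?q)"
    using splits_radical_quotient[OF splits_restr] by metis
  moreover have "degree ?f = degree bq + degree h"
    unfolding h using False h by (intro degree_mult_eq) auto
  ultimately have "degree h + card C \<le> d + meets C H"
    using degree_restr_normal[OF \<theta> d False] degree_restr_defining_poly
      meets_eq_card_roots[OF C H] by linarith
  then show ?thesis using that h by blast
qed

definition "normal_image m = {restr H (normal H \<theta>) | \<theta>. \<theta> \<in> log_fields C \<and> field_deg_le \<theta> m}"

lemma normal_imageI:
  "\<theta> \<in> log_fields C \<Longrightarrow> field_deg_le \<theta> m \<Longrightarrow> restr H (normal H \<theta>) = f \<Longrightarrow> f \<in> normal_image m"
  unfolding normal_image_def by blast

lemma normal_image_add: "f \<in> normal_image m \<Longrightarrow> g \<in> normal_image m \<Longrightarrow> f + g \<in> normal_image m"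
proof -
  assume "f \<in> normal_image m" "g \<in> normal_image m"
  then obtain \<theta> \<eta> where "f = restr H (normal H \<theta>)" "\<theta> \<in> log_fields C" "field_deg_le \<theta> m"
    "g = restr H (normal H \<eta>)" "\<eta> \<in> log_fields C" "field_deg_le \<eta> m"
    unfolding normal_image_def by blast
  then have "f + g = restr H (normal H (\<theta> + \<eta>))" "\<theta> + \<eta> \<in> log_fields C" "field_deg_le (\<theta> + \<eta>) m"
    by (simp_all add: normal_add restr_simps log_fields_add field_deg_le_add)
  then show ?thesis unfolding normal_image_def by blast
qed

lemma normal_image_mult:
  assumes "f \<in> normal_image m" "degree h \<le> e" shows "h * f \<in> normal_image (e + m)"
proof -
  obtain \<theta> where \<theta>: "f = restr H (normal H \<theta>)" "\<theta> \<in> log_fields C" "field_deg_le \<theta> m"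
    using assms(1) unfolding normal_image_def by blast
  obtain p where p: "tdeg p \<le> e" "restr H p = h" using restr_lift[OF H assms(2)] by blast
  have "h * f = restr H (normal H (field_scale p \<theta>))"
    by (simp add: normal_scale restr_simps p \<theta>)
  moreover have "field_scale p \<theta> \<in> log_fields C" "field_deg_le (field_scale p \<theta>) (e + m)"
    using \<theta> p by (simp_all add: log_fields_scale field_deg_le_scale)
  ultimately show ?thesis unfolding normal_image_def by blast
qed

lemma normal_image_sum:
  "finite T \<Longrightarrow> (\<And>t. t \<in> T \<Longrightarrow> f t \<in> normal_image m) \<Longrightarrow> sum f T \<in> normal_image m"
proof (induction T rule: finite_induct)
  case empty
  have "0 = restr H (normal H 0)" "0 \<in> log_fields C" "field_deg_le (0 :: 'k field2) m"
    by (simp_all add: normal_def restr_simps log_fields_def field_deg_le_def)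
  then show ?case unfolding normal_image_def by (simp only: sum.empty mem_Collect_eq) blast
qed (auto intro: normal_image_add)

lemma normal_image_smult: "f \<in> normal_image m \<Longrightarrow> Polynomial.smult c f \<in> normal_image m"
  using normal_image_mult[of f m "[:c:]" 0] by simp

lemma defining_poly_in_image: "restr H (defining_poly C) \<in> normal_image (card C)"
proof -
  obtain u v where uv: "la H * u + lb H * v = 1" using unit_normal[OF H] .
  have "normal H (field_scale (defining_poly C) (K2 u, K2 v)) = defining_poly C * K2 (la H * u + lb H * v)"
    unfolding normal_scale by (simp add: normal_def)
  then have "restr H (normal H (field_scale (defining_poly C) (K2 u, K2 v))) = restr H (defining_poly C)"
    by (simp only: uv restr_simps restr_const one_pCons[symmetric] mult_1_right)
  then show ?thesis by (rule normal_imageI[OF coordinate_field_log[OF C]])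
qed

lemma partial_defining_poly_in_image:
  assumes H1: "H1 \<in> C" "H1 \<notin> parallels C H"
  shows "restr H (defining_poly (C - {H1})) \<in> normal_image (card C - 1)"
proof -
  let ?c = "la H * lb H1 - lb H * la H1"
  have c: "?c \<noteq> 0" using H1 by (auto simp: parallels_def mult.commute)
  have "restr H (normal H (tangent_field C H1)) = Polynomial.smult ?c (restr H (defining_poly (C - {H1})))"
    unfolding normal_tangent_field restr_simps restr_const by (simp add: algebra_simps)
  then have "Polynomial.smult ?c (restr H (defining_poly (C - {H1}))) \<in> normal_image (card C - 1)"
    by (rule normal_imageI[OF tangent_field_log[OF C H1(1)]])
  then have "Polynomial.smult (1 / ?c) (Polynomial.smult ?c (restr H (defining_poly (C - {H1}))))
      \<in> normal_image (card C - 1)"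
    by (rule normal_image_smult)
  then show ?thesis using c by simp
qed

text \<open>
  Up to constants, the restriction of \<open>Q\<close> is the fixed divisor times the product \<open>R\<close> of the linear factors
  at all intersection points.  The tangent field of a line meeting \<open>H\<close> at the point with parameter \<open>t\<close>
  yields the fixed divisor times \<open>R / (X - t)\<close>.  These quotients are a Lagrange basis of the
  polynomials of degree below that of \<open>R\<close>; together with multiples of \<open>R\<close> itself they exhaust all
  cofactors of the permitted degree.
\<close>

lemma restr_normal_surj:
  assumes m: "card C \<le> m" and h: "h = 0 \<or> degree h + card C \<le> m + meets C H"
  shows "bq * h \<in> normal_image m"
proof -
  let ?q = "restr H (defining_poly C)"
  let ?T = "root_set ?q"
  let ?R = "\<Prod>t\<in>?T. [:- t, 1:]"
  let ?Rt = "\<lambda>t. \<Prod>s\<in>?T - {t}. [:- s, 1:]"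
  obtain c where c: "c \<noteq> 0" "?q = Polynomial.smult c (bq * ?R)"
    using splits_radical_quotient[OF splits_restr] by metis
  have q0: "?q \<noteq> 0" using splits_restr by (simp add: splits_def)
  then have T: "finite ?T" by (rule poly_roots_finite)
  have dR: "degree ?R = card ?T" using degree_prod_linear_power[OF T, of "\<lambda>_. 1"] by simp
  have R0: "?R \<noteq> 0" using T by simp
  have R: "bq * ?R \<in> normal_image (card C)"
  proof -
    have "bq * ?R = Polynomial.smult (1 / c) (Polynomial.smult c (bq * ?R))" using c(1) by simp
    also have "\<dots> \<in> normal_image (card C)"
      unfolding c(2)[symmetric] by (rule normal_image_smult[OF defining_poly_in_image])
    finally show ?thesis .
  qed
  have Rt: "bq * ?Rt t \<in> normal_image (card C - 1)" if t: "t \<in> ?T" for t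
  proof -
    have "line_point H t \<in> \<Union>C" using t root_set_restr[OF C, of H] by blast
    then obtain H1 where H1: "H1 \<in> C" "line_point H t \<in> H1" by blast
    have l: "is_line H1" using C H1 by (auto simp: arrangement_iff)
    have r0: "poly (restr H (alpha H1)) t = 0" using poly_restr_alpha[OF l] H1 by blast
    obtain k where k: "k \<noteq> 0" "restr H (alpha H1) = Polynomial.smult k [:- t, 1:]"
    proof -
      obtain a b where ab: "restr H (alpha H1) = [:b, a:]" unfolding alpha_def restr_lform by blast
      have "b = - (a * t)" using r0 unfolding ab by (simp add: algebra_simps eq_neg_iff_add_eq_0)
      then have "restr H (alpha H1) = Polynomial.smult a [:- t, 1:]" unfolding ab by simp
      moreover from this have "a \<noteq> 0" using restr_alpha_nonzero[OF H1(1)] by auto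
      ultimately show thesis using that by blast
    qed
    have np: "H1 \<notin> parallels C H"
      using degree_restr_alpha[of H H1] k by (auto simp: parallels_def)
    have "?q = restr H (alpha H1) * restr H (defining_poly (C - {H1}))"
      unfolding restr_defining_poly using H1 C by (intro prod.remove) (auto simp: arrangement_iff)
    then have "[:- t, 1:] * Polynomial.smult k (restr H (defining_poly (C - {H1}))) = ?q"
      by (simp only: k(2) mult_smult_left mult_smult_right)
    also have "\<dots> = Polynomial.smult c (bq * ?R)" by (rule c(2))
    also have "?R = [:- t, 1:] * ?Rt t" using T t by (intro prod.remove) auto
    also have "Polynomial.smult c (bq * ([:- t, 1:] * ?Rt t)) = [:- t, 1:] * Polynomial.smult c (bq * ?Rt t)"
      by (simp only: mult_smult_right mult.left_commute)
    finally have "Polynomial.smult k (restr H (defining_poly (C - {H1}))) = Polynomial.smult c (bq * ?Rt t)"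
      by (rule mult_left_cancel[THEN iffD1, rotated]) simp
    then have "Polynomial.smult (1 / c) (Polynomial.smult c (bq * ?Rt t)) \<in> normal_image (card C - 1)"
      using normal_image_smult partial_defining_poly_in_image[OF H1(1) np] by metis
    then show ?thesis using c(1) by simp
  qed
  have n: "meets C H = card ?T" by (rule meets_eq_card_roots[OF C H])
  have split: "h = ?R * (h div ?R) + h mod ?R" by simp
  have "(h div ?R) * (bq * ?R) \<in> normal_image m"
  proof -
    have "degree (h div ?R) \<le> m - card C"
    proof (cases "h div ?R = 0")
      case False
      have "degree (?R * (h div ?R)) = card ?T + degree (h div ?R)"
        using False R0 dR by (simp add: degree_mult_eq)
      moreover have "degree (?R * (h div ?R)) \<le> degree h"
      proof (rule ccontr)
        assume "\<not> ?thesis"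
        moreover have "degree (h mod ?R) < card ?T \<or> h mod ?R = 0"
          using degree_mod_less[OF R0, of h] dR by auto
        ultimately have "degree (h - h mod ?R) < degree (?R * (h div ?R))"
          using \<open>degree (?R * (h div ?R)) = _\<close> by (intro degree_diff_less) auto
        moreover have "h - h mod ?R = ?R * (h div ?R)" by (rule minus_mod_eq_mult_div)
        ultimately show False by simp
      qed
      moreover have "h \<noteq> 0" using False by auto
      ultimately show ?thesis using h n m by auto
    qed simp
    then have "(h div ?R) * (bq * ?R) \<in> normal_image ((m - card C) + card C)"
      by (intro normal_image_mult R)
    then show ?thesis using m by simp
  qed
  moreover have "bq * (h mod ?R) \<in> normal_image m"
  proof -
    have "h mod ?R = 0 \<or> degree (h mod ?R) < card ?T"
      using degree_mod_less[OF R0, of h] dR by simp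
    then obtain k where k: "h mod ?R = (\<Sum>t\<in>?T. Polynomial.smult (k t) (?Rt t))"
      by (rule lagrange_basis_spans[OF T])
    have e: "bq * (h mod ?R) = (\<Sum>t\<in>?T. Polynomial.smult (k t) (bq * ?Rt t))"
      unfolding k by (simp add: sum_distrib_left)
    have "[:k t:] * (bq * ?Rt t) \<in> normal_image ((m - (card C - 1)) + (card C - 1))" if "t \<in> ?T" for t
      using Rt[OF that] by (intro normal_image_mult) simp_all
    then have "Polynomial.smult (k t) (bq * ?Rt t) \<in> normal_image m" if "t \<in> ?T" for t
      using that m by simp
    then show ?thesis unfolding e using T by (intro normal_image_sum) auto
  qed
  moreover have "bq * h = (h div ?R) * (bq * ?R) + bq * (h mod ?R)"
    by (subst split) (simp only: distrib_left ac_simps)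
  ultimately show ?thesis using normal_image_add by metis
qed

text \<open>
  The normal component vanishes on \<open>H\<close>, because the bound on the degree of the cofactor is negative.
\<close>

lemma log_field_extends:
  assumes \<theta>: "\<theta> \<in> log_fields C" and d: "field_deg_le \<theta> d" and lt: "d + meets C H < card C"
  shows "\<theta> \<in> log_fields (insert H C)"
proof -
  obtain h where h: "restr H (normal H \<theta>) = bq * h" "h = 0 \<or> degree h + card C \<le> d + meets C H"
    using restr_normal_factor[OF \<theta> d] .
  then have "restr H (normal H \<theta>) = 0" using lt by auto
  then show ?thesis using \<theta> by (simp add: log_fields_insert restr_eq_0_iff[OF H])
qed

end

section \<open>Dimension counts\<close>

text \<open>
  The finite spanning set excludes the default value that \<open>dim\<close> takes on infinite-dimensional spaces.
\<close>

definition has_dim :: "('k::field \<Rightarrow> 'v::ab_group_add \<Rightarrow> 'v) \<Rightarrow> 'v set \<Rightarrow> nat \<Rightarrow> bool" where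
  "has_dim s V n \<longleftrightarrow> module.subspace s V \<and> vector_space.dim s V = n \<and>
     (\<exists>B. finite B \<and> V \<subseteq> module.span s B)"

lemma has_dim_unique: "has_dim s V m \<Longrightarrow> has_dim s V n \<Longrightarrow> m = n"
  by (auto simp: has_dim_def)

lemma has_dim_basis:
  assumes "vector_space s" "has_dim s V n"
  obtains B where "finite B" "B \<subseteq> V" "\<not> module.dependent s B" "V \<subseteq> module.span s B" "card B = n"
proof -
  interpret vector_space s by fact
  obtain B where B: "B \<subseteq> V" "independent B" "V \<subseteq> span B" "card B = dim V"
    using basis_exists by metis
  obtain F where F: "finite F" "V \<subseteq> span F" using assms(2) by (auto simp: has_dim_def)
  have "finite B" using independent_span_bound[OF F(1) B(2)] B(1) F(2) by blast
  then show thesis using that B assms(2) by (auto simp: has_dim_def)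
qed

text \<open>The dimension is additive in short exact sequences.\<close>

lemma has_dim_exact:
  assumes f: "Vector_Spaces.linear s1 s2 f" and V: "module.subspace s1 V"
    and K: "has_dim s1 {x \<in> V. f x = 0} a" and I: "has_dim s2 (f ` V) b"
  shows "has_dim s1 V (a + b)"
proof -
  interpret f: Vector_Spaces.linear s1 s2 f by fact
  obtain BK where BK: "finite BK" "BK \<subseteq> {x \<in> V. f x = 0}" "f.vs1.independent BK"
    "{x \<in> V. f x = 0} \<subseteq> f.vs1.span BK" "card BK = a"
    using has_dim_basis[OF f.vs1.vector_space_axioms K] .
  obtain BI where BI: "finite BI" "BI \<subseteq> f ` V" "f.vs2.independent BI"
    "f ` V \<subseteq> f.vs2.span BI" "card BI = b"
    using has_dim_basis[OF f.vs2.vector_space_axioms I] .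
  define g where "g = inv_into V f"
  have g: "g y \<in> V" "f (g y) = y" if "y \<in> BI" for y
    using that BI(2) by (auto simp: g_def inv_into_into f_inv_into_f)
  have fg: "f ` g ` BI = BI" using g by force
  have ginj: "inj_on g BI" using g(2) by (metis inj_onI)
  have gBI: "f.vs1.span (g ` BI) \<subseteq> V"
    using g(1) V by (intro f.vs1.span_minimal) auto
  have indI: "f.vs1.independent (g ` BI)"
  proof
    assume "f.vs1.dependent (g ` BI)"
    then obtain u where u: "\<exists>v\<in>g ` BI. u v \<noteq> 0" "(\<Sum>v\<in>g ` BI. s1 (u v) v) = 0"
      using f.vs1.dependent_finite[of "g ` BI"] BI(1) by auto
    then have "f (\<Sum>v\<in>g ` BI. s1 (u v) v) = 0" by simp
    then have "(\<Sum>v\<in>g ` BI. s2 (u v) (f v)) = 0" by (simp add: f.sum f.scale)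
    then have "(\<Sum>y\<in>BI. s2 (u (g y)) y) = 0"
      using ginj g(2) by (simp add: sum.reindex)
    then have "\<forall>y\<in>BI. u (g y) = 0"
      using f.vs2.independentD[OF BI(3,1) subset_refl, of "\<lambda>y. u (g y)"] by blast
    then show False using u(1) by blast
  qed
  have meet0: "x = 0" if x: "x \<in> f.vs1.span (g ` BI)" "f x = 0" for x
  proof -
    obtain u where u: "x = (\<Sum>v\<in>g ` BI. s1 (u v) v)"
      using x(1) BI(1) f.vs1.span_finite[of "g ` BI"] by auto
    have "(\<Sum>v\<in>g ` BI. s2 (u v) (f v)) = 0" using x(2) by (simp add: u f.sum f.scale)
    then have "(\<Sum>y\<in>BI. s2 (u (g y)) y) = 0"
      using ginj g(2) by (simp add: sum.reindex)
    then have "\<forall>y\<in>BI. u (g y) = 0"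
      using f.vs2.independentD[OF BI(3,1) subset_refl, of "\<lambda>y. u (g y)"] by blast
    then show "x = 0" unfolding u using ginj by (simp add: sum.reindex)
  qed
  have disj: "BK \<inter> g ` BI = {}"
  proof -
    have "x = 0" if "x \<in> BK" "x \<in> g ` BI" for x
      using that BK(2) meet0[of x] by (auto intro: f.vs1.span_base)
    moreover have "0 \<notin> BK" using BK(3) f.vs1.dependent_zero by blast
    ultimately show ?thesis by (metis disjoint_iff)
  qed
  have ind: "f.vs1.independent (BK \<union> g ` BI)"
  proof
    assume "f.vs1.dependent (BK \<union> g ` BI)"
    then obtain u where u: "\<exists>v\<in>BK \<union> g ` BI. u v \<noteq> 0" "(\<Sum>v\<in>BK \<union> g ` BI. s1 (u v) v) = 0"
      using f.vs1.dependent_finite[of "BK \<union> g ` BI"] BI(1) BK(1) by auto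
    have s0: "(\<Sum>v\<in>BK. s1 (u v) v) + (\<Sum>v\<in>g ` BI. s1 (u v) v) = 0"
      using u(2) disj BI(1) BK(1) by (simp add: sum.union_disjoint)
    have "f (\<Sum>v\<in>BK. s1 (u v) v) = 0"
      using BK(2) by (auto simp: f.sum f.scale intro!: sum.neutral)
    then have "f (\<Sum>v\<in>g ` BI. s1 (u v) v) = 0"
      using arg_cong[OF s0, of f] by (simp add: f.add)
    moreover have "(\<Sum>v\<in>g ` BI. s1 (u v) v) \<in> f.vs1.span (g ` BI)"
      by (intro f.vs1.span_sum f.vs1.span_scale f.vs1.span_base)
    ultimately have z: "(\<Sum>v\<in>g ` BI. s1 (u v) v) = 0" using meet0 by blast
    then have "\<forall>v\<in>g ` BI. u v = 0"
      using f.vs1.independentD[OF indI finite_imageI[OF BI(1)] subset_refl] by blast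
    moreover have "\<forall>v\<in>BK. u v = 0"
      using s0 z f.vs1.independentD[OF BK(3,1) subset_refl] by simp
    ultimately show False using u(1) by blast
  qed
  have span: "V \<subseteq> f.vs1.span (BK \<union> g ` BI)"
  proof
    fix x assume x: "x \<in> V"
    then have "f x \<in> f.vs2.span (f ` g ` BI)" using BI(4) fg by auto
    then obtain y where y: "y \<in> f.vs1.span (g ` BI)" "f x = f y"
      unfolding f.span_image by blast
    have "x - y \<in> V" using x y gBI V f.vs1.subspace_diff by blast
    then have "x - y \<in> f.vs1.span BK" using BK(4) y by (auto simp: f.diff)
    then have "(x - y) + y \<in> f.vs1.span (BK \<union> g ` BI)"
      using y(1) by (intro f.vs1.span_add) (auto intro: f.vs1.span_mono[THEN subsetD, rotated])
    then show "x \<in> f.vs1.span (BK \<union> g ` BI)" by simp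
  qed
  have sub: "BK \<union> g ` BI \<subseteq> V" using BK(2) g(1) by auto
  have fin: "finite (BK \<union> g ` BI)" using BK(1) BI(1) by simp
  have "card (BK \<union> g ` BI) = a + b"
    using disj BK BI ginj by (simp add: card_Un_disjoint card_image)
  then have "f.vs1.dim V = a + b"
    using f.vs1.basis_card_eq_dim[OF sub span ind] by simp
  then show ?thesis unfolding has_dim_def using V span fin by blast
qed

lemma has_dim_zero:
  assumes "vector_space s" shows "has_dim s {0} 0"
proof -
  interpret vector_space s by fact
  have "dim {0} = 0" using dim_unique[of "{}" "{0}" 0] independent_empty by simp
  moreover have "{0} \<subseteq> span {}" by simp
  ultimately show ?thesis unfolding has_dim_def using subspace_single_0 by blast
qed

lemma has_dim_image:
  assumes f: "Vector_Spaces.linear s1 s2 f" and V: "has_dim s1 V n"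
    and inj: "\<And>x. x \<in> V \<Longrightarrow> f x = 0 \<Longrightarrow> x = 0"
  shows "has_dim s2 (f ` V) n"
proof -
  interpret f: Vector_Spaces.linear s1 s2 f by fact
  obtain B where B: "finite B" "B \<subseteq> V" "f.vs1.independent B" "V \<subseteq> f.vs1.span B" "card B = n"
    using has_dim_basis[OF f.vs1.vector_space_axioms V] .
  have sV: "f.vs1.subspace V" using V by (simp add: has_dim_def)
  have VB: "V = f.vs1.span B" using B sV f.vs1.span_minimal by blast
  have injB: "inj_on f (f.vs1.span B)"
    using inj f.inj_on_iff_eq_0[of "f.vs1.span B"] VB by auto
  have ind: "f.vs2.independent (f ` B)" using B(3) injB by (rule f.independent_injective_image)
  have "inj_on f B" using injB f.vs1.span_superset by (rule inj_on_subset)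
  then have "card (f ` B) = n" using B(5) by (simp add: card_image)
  moreover have sp: "f ` V = f.vs2.span (f ` B)" unfolding VB f.span_image ..
  ultimately have "f.vs2.dim (f ` V) = n"
    using f.vs2.dim_span_eq_card_independent[OF ind] by simp
  then show ?thesis unfolding has_dim_def using sp B(1) f.vs2.subspace_span
    by (metis finite_imageI subset_refl)
qed

lemma has_dim_subspace:
  assumes "vector_space s" "has_dim s V n" "module.subspace s U" "U \<subseteq> V"
  obtains k where "has_dim s U k"
  using assms(2,3,4) unfolding has_dim_def by (meson dual_order.trans)

lemma linear_scalesI:
  assumes "vector_space s1" "vector_space s2"
    "\<And>x y. f (x + y) = f x + f y" "\<And>c x. f (s1 c x) = s2 c (f x)"
  shows "Vector_Spaces.linear s1 s2 f"
proof -
  interpret a: vector_space s1 by fact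
  interpret b: vector_space s2 by fact
  show ?thesis by unfold_locales (simp_all add: assms)
qed

abbreviation scale1 :: "'k::field \<Rightarrow> 'k poly \<Rightarrow> 'k poly" where "scale1 \<equiv> Polynomial.smult"

definition scale2 :: "'k::field \<Rightarrow> 'k poly poly \<Rightarrow> 'k poly poly" where "scale2 c f = K2 c * f"

definition scaleF :: "'k::field \<Rightarrow> 'k field2 \<Rightarrow> 'k field2" where "scaleF c = field_scale (K2 c)"

lemma vector_space_scale1: "vector_space (scale1 :: 'k::field \<Rightarrow> _)"
  by unfold_locales (simp_all add: smult_add_left smult_add_right)

lemma vector_space_scale2: "vector_space (scale2 :: 'k::field \<Rightarrow> _)"
proof unfold_locales
  fix a b :: 'k and x y
  show "scale2 a (x + y) = scale2 a x + scale2 a y" by (simp only: scale2_def distrib_left)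
  show "scale2 (a + b) x = scale2 a x + scale2 b x" by (simp add: scale2_def smult_add_left[symmetric])
  show "scale2 a (scale2 b x) = scale2 (a * b) x" by (simp add: scale2_def)
  show "scale2 1 x = x" by (simp add: scale2_def one_pCons[symmetric])
qed

lemma scaleF_alt: "scaleF c \<theta> = (scale2 c (fst \<theta>), scale2 c (snd \<theta>))"
  by (simp add: scaleF_def field_scale_def scale2_def)

lemma vector_space_scaleF: "vector_space (scaleF :: 'k::field \<Rightarrow> _)"
proof -
  interpret vector_space "scale2 :: 'k \<Rightarrow> _" by (rule vector_space_scale2)
  show ?thesis
    by unfold_locales (simp_all add: scaleF_alt scale_right_distrib scale_left_distrib prod_eq_iff)
qed

lemma subspace_closedI:
  assumes "vector_space s" "0 \<in> V" "\<And>x y. x \<in> V \<Longrightarrow> y \<in> V \<Longrightarrow> x + y \<in> V"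
    "\<And>c x. x \<in> V \<Longrightarrow> s c x \<in> V"
  shows "module.subspace s V"
proof -
  interpret vector_space s by fact
  show ?thesis using assms by (simp add: subspace_def)
qed

lemma has_dim_self: "has_dim ((*) :: 'k::field \<Rightarrow> 'k \<Rightarrow> 'k) UNIV 1"
proof -
  note V = vector_space_over_itself.dependent_single[where 'a = 'k]
    vector_space_over_itself.span_singleton[where 'a = 'k]
    vector_space_over_itself.dim_unique[where 'a = 'k]
  have i: "vector_space_over_itself.independent {1 :: 'k}" by (simp add: V(1))
  have s: "UNIV \<subseteq> vector_space_over_itself.span {1 :: 'k}" by (auto simp: V(2))
  have "vector_space_over_itself.dim (UNIV :: 'k set) = 1" using V(3)[of "{1}" UNIV 1] i s by simp
  moreover have "vector_space_over_itself.subspace (UNIV :: 'k set)"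
    by (rule vector_space_over_itself.subspace_UNIV)
  ultimately show ?thesis unfolding has_dim_def using s by blast
qed

definition polys_below :: "nat \<Rightarrow> 'k::field poly set" where
  "polys_below n = {p. \<forall>i\<ge>n. coeff p i = 0}"

definition polys2_below :: "nat \<Rightarrow> 'k::field poly poly set" where
  "polys2_below n = {f. \<forall>i j. i + j \<ge> n \<longrightarrow> coeff (coeff f j) i = 0}"

lemma polys_below_iff: "p \<in> polys_below n \<longleftrightarrow> p = 0 \<or> degree p < n"
proof
  assume "p \<in> polys_below n"
  then show "p = 0 \<or> degree p < n" unfolding polys_below_def
    by (metis (mono_tags, lifting) leading_coeff_0_iff linorder_not_le mem_Collect_eq)
qed (auto simp: polys_below_def intro: coeff_eq_0)

lemma polys2_below_iff: "f \<in> polys2_below n \<longleftrightarrow> f = 0 \<or> tdeg f < n"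
proof (cases n)
  case 0
  then show ?thesis by (auto simp: polys2_below_def poly_eq_iff)
next
  case (Suc m)
  have "f \<in> polys2_below n \<longleftrightarrow> tdeg f \<le> m"
    unfolding tdeg_le_iff polys2_below_def Suc by (simp add: Suc_le_eq)
  then show ?thesis using Suc by auto
qed

lemma subspace_polys_below: "module.subspace scale1 (polys_below n)"
  by (rule subspace_closedI[OF vector_space_scale1]) (auto simp: polys_below_def)

lemma subspace_polys2_below: "module.subspace scale2 (polys2_below n)"
  by (rule subspace_closedI[OF vector_space_scale2]) (auto simp: polys2_below_def scale2_def)

lemma has_dim_polys_below: "has_dim scale1 (polys_below n :: 'k::field poly set) n"
proof (induction n)
  case 0
  have "polys_below 0 = {0 :: 'k poly}" by (auto simp: polys_below_def poly_eq_iff)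
  then show ?case using has_dim_zero[OF vector_space_scale1] by simp
next
  case (Suc n)
  have lin: "Vector_Spaces.linear scale1 (*) (\<lambda>p :: 'k poly. coeff p n)"
    by (rule linear_scalesI[OF vector_space_scale1 vector_space_over_itself.vector_space_axioms]) simp_all
  have "{p \<in> polys_below (Suc n). coeff p n = 0} = (polys_below n :: 'k poly set)"
    by (auto simp: polys_below_def) (metis Suc_leI le_neq_implies_less)
  moreover have "c \<in> (\<lambda>p. coeff p n) ` polys_below (Suc n)" for c :: 'k
    by (rule image_eqI[of _ _ "monom c n"]) (auto simp: polys_below_def)
  then have "(\<lambda>p. coeff p n) ` polys_below (Suc n) = (UNIV :: 'k set)" by blast
  ultimately have "has_dim scale1 (polys_below (Suc n) :: 'k poly set) (n + 1)"
    using has_dim_exact[OF lin subspace_polys_below, of "Suc n" n 1] Suc.IH has_dim_self by simp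
  then show ?case by simp
qed

text \<open>
  Evaluating at \<open>y = 0\<close> peels off the polynomials in \<open>x\<close>; the kernel consists of the multiples of \<open>y\<close>.
\<close>

lemma has_dim_polys2_below: "has_dim scale2 (polys2_below n :: 'k::field poly poly set) (\<Sum>i\<le>n. i)"
proof (induction n)
  case 0
  have "polys2_below 0 = {0 :: 'k poly poly}" by (auto simp: polys2_below_def poly_eq_iff)
  then show ?case using has_dim_zero[OF vector_space_scale2] by simp
next
  case (Suc n)
  have lin: "Vector_Spaces.linear scale2 scale1 (\<lambda>f :: 'k poly poly. coeff f 0)"
    by (rule linear_scalesI[OF vector_space_scale2 vector_space_scale1]) (simp_all add: scale2_def)
  have lin2: "Vector_Spaces.linear scale2 scale2 (\<lambda>f :: 'k poly poly. pCons 0 f)"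
    by (rule linear_scalesI[OF vector_space_scale2 vector_space_scale2]) (simp_all add: scale2_def)
  have k: "{f \<in> polys2_below (Suc n). coeff f 0 = 0} = pCons 0 ` (polys2_below n :: 'k poly poly set)"
  proof (intro subset_antisym subsetI)
    fix f :: "'k poly poly" assume f: "f \<in> {f \<in> polys2_below (Suc n). coeff f 0 = 0}"
    obtain c g where cg: "f = pCons c g" by (cases f)
    have "c = 0" using f by (simp add: cg)
    moreover have "g \<in> polys2_below n"
      unfolding polys2_below_def mem_Collect_eq
    proof (intro allI impI)
      fix i j assume "n \<le> i + j"
      then have "coeff (coeff f (Suc j)) i = 0" using f by (simp add: polys2_below_def)
      then show "coeff (coeff g j) i = 0" by (simp add: cg)
    qed
    ultimately show "f \<in> pCons 0 ` polys2_below n" by (simp add: cg)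
  next
    fix f :: "'k poly poly" assume "f \<in> pCons 0 ` polys2_below n"
    then show "f \<in> {f \<in> polys2_below (Suc n). coeff f 0 = 0}"
      by (auto simp: polys2_below_def coeff_pCons split: nat.splits)
  qed
  have K: "has_dim scale2 {f \<in> polys2_below (Suc n). coeff f 0 = (0 :: 'k poly)} (\<Sum>i\<le>n. i)"
    unfolding k by (rule has_dim_image[OF lin2 Suc.IH]) simp
  have "(\<lambda>f. coeff f 0) ` polys2_below (Suc n) = (polys_below (Suc n) :: 'k poly set)"
  proof (intro subset_antisym subsetI)
    fix p :: "'k poly" assume "p \<in> polys_below (Suc n)"
    then show "p \<in> (\<lambda>f. coeff f 0) ` polys2_below (Suc n)"
      by (intro image_eqI[of _ _ "[:p:]"])
         (auto simp: polys_below_def polys2_below_def coeff_pCons split: nat.splits)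
  qed (force simp: polys_below_def polys2_below_def)
  then have "has_dim scale1 ((\<lambda>f. coeff f 0) ` polys2_below (Suc n) :: 'k poly set) (Suc n)"
    using has_dim_polys_below by simp
  from has_dim_exact[OF lin subspace_polys2_below K this]
  show ?case by (simp add: add.commute)
qed

lemma has_dim_Times_polys2:
  "has_dim scaleF (polys2_below a \<times> polys2_below b :: 'k::field field2 set) ((\<Sum>i\<le>a. i) + (\<Sum>i\<le>b. i))"
proof -
  have lin: "Vector_Spaces.linear scaleF scale2 (snd :: 'k field2 \<Rightarrow> _)"
    by (rule linear_scalesI[OF vector_space_scaleF vector_space_scale2]) (simp_all add: scaleF_alt)
  have lin2: "Vector_Spaces.linear scale2 scaleF (\<lambda>f :: 'k poly poly. (f, 0))"
    by (rule linear_scalesI[OF vector_space_scale2 vector_space_scaleF]) (simp_all add: scaleF_alt scale2_def)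
  have sub: "module.subspace scaleF (polys2_below a \<times> polys2_below b :: 'k field2 set)"
    by (rule subspace_closedI[OF vector_space_scaleF]) (auto simp: polys2_below_def scaleF_alt scale2_def zero_prod_def)
  have k: "{x \<in> polys2_below a \<times> polys2_below b. snd x = (0 :: 'k poly poly)} = (\<lambda>f. (f, 0)) ` polys2_below a"
    by (auto simp: polys2_below_def)
  have K: "has_dim scaleF {x \<in> polys2_below a \<times> polys2_below b. snd x = (0 :: 'k poly poly)} (\<Sum>i\<le>a. i)"
    unfolding k by (rule has_dim_image[OF lin2 has_dim_polys2_below]) (simp add: zero_prod_def)
  have "snd ` (polys2_below a \<times> polys2_below b :: 'k field2 set) = polys2_below b"
  proof -
    have "(0 :: 'k poly poly) \<in> polys2_below a" by (simp add: polys2_below_def)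
    then have "polys2_below a \<noteq> ({} :: 'k poly poly set)" by blast
    then show ?thesis by (simp add: snd_image_times)
  qed
  then have "has_dim scale2 (snd ` (polys2_below a \<times> polys2_below b :: 'k field2 set)) (\<Sum>i\<le>b. i)"
    using has_dim_polys2_below by simp
  from has_dim_exact[OF lin sub K this] show ?thesis .
qed

section \<open>The characteristic polynomial of a line arrangement\<close>

definition point_mult :: "('k ^ 2) set set \<Rightarrow> 'k ^ 2 \<Rightarrow> nat" where
  "point_mult A p = card {H \<in> A. p \<in> H}"

definition multiple_points :: "('k ^ 2) set set \<Rightarrow> ('k ^ 2) set" where
  "multiple_points A = {p. point_mult A p \<ge> 2}"

text \<open>
  The sum of \<open>\<mu>\<close> over the points of the intersection poset, which is the constant coefficient of the
  characteristic polynomial.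
\<close>

definition b2 :: "('k ^ 2) set set \<Rightarrow> nat" where
  "b2 A = (\<Sum>p\<in>multiple_points A. point_mult A p - 1)"

lemma lines_meet_once:
  assumes H: "is_line H" and H': "is_line H'" and ne: "H \<noteq> H'"
    and p: "p \<in> H" "p \<in> H'" and q: "q \<in> H" "q \<in> H'"
  shows "p = q"
proof -
  obtain s t where st: "p = line_point H s" "q = line_point H t"
    using line_point_bij[OF H] p(1) q(1) unfolding bij_betw_def by blast
  obtain a b where ab: "restr H (alpha H') = [:b, a:]" unfolding alpha_def restr_lform by blast
  have "poly (restr H (alpha H')) s = 0" "poly (restr H (alpha H')) t = 0"
    using p q st poly_restr_alpha[OF H'] by auto
  then have e: "b + s * a = 0" "b + t * a = 0" unfolding ab by simp_all
  have "a \<noteq> 0" using e line_eqI[OF H H'] ne unfolding ab by auto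
  moreover have "s * a = t * a" using e by (metis add_left_cancel)
  ultimately show ?thesis using st by simp
qed

lemma mult_ge_2_iff:
  assumes "finite A"
  shows "point_mult A p \<ge> 2 \<longleftrightarrow> (\<exists>H\<in>A. \<exists>H'\<in>A. H \<noteq> H' \<and> p \<in> H \<and> p \<in> H')"
proof -
  have f: "finite {H \<in> A. p \<in> H}" using assms by simp
  have "point_mult A p \<ge> 2 \<longleftrightarrow> \<not> card {H \<in> A. p \<in> H} \<le> Suc 0" by (auto simp: point_mult_def)
  also have "\<dots> \<longleftrightarrow> \<not> (\<forall>x\<in>{H \<in> A. p \<in> H}. \<forall>y\<in>{H \<in> A. p \<in> H}. x = y)"
    using card_le_Suc0_iff_eq[OF f] by simp
  finally show ?thesis by auto
qed

lemma finite_multiple_points: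
  assumes A: "arrangement A"
  shows "finite (multiple_points A)"
proof -
  have "multiple_points A \<subseteq> (\<Union>H\<in>A. \<Union>H'\<in>A - {H}. H \<inter> H')"
    using mult_ge_2_iff[OF arrangement_finite[OF A]] by (fastforce simp: multiple_points_def)
  moreover have "finite (H \<inter> H')" if "H \<in> A" "H' \<in> A - {H}" for H H'
  proof (cases "H \<inter> H' = {}")
    case False
    then obtain p where "p \<in> H \<inter> H'" by blast
    then have "H \<inter> H' = {p}" using that lines_meet_once[of H H'] A by (auto simp: arrangement_iff)
    then show ?thesis by simp
  qed simp
  then have "finite (\<Union>H\<in>A. \<Union>H'\<in>A - {H}. H \<inter> H')"
    using arrangement_finite[OF A] by (intro finite_UN_I) auto
  ultimately show ?thesis by (rule finite_subset)
qed

lemma mult_insert: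
  "finite A \<Longrightarrow> H \<notin> A \<Longrightarrow> point_mult (insert H A) p = point_mult A p + (if p \<in> H then 1 else 0)"
proof -
  assume A: "finite A" "H \<notin> A"
  have "{H' \<in> insert H A. p \<in> H'} = (if p \<in> H then insert H {H' \<in> A. p \<in> H'} else {H' \<in> A. p \<in> H'})"
    by auto
  then show ?thesis using A by (simp add: point_mult_def)
qed

text \<open>
  Deletion and restriction: each point in which \<open>H\<close> meets an older line gains one unit of \<open>\<mu>\<close>.
\<close>

lemma b2_insert:
  assumes A: "arrangement A" and H: "is_line H" "H \<notin> A"
  shows "b2 (insert H A) = b2 A + meets A H"
proof -
  let ?T = "multiple_points (insert H A)"
  have fin: "finite A" using A by (rule arrangement_finite)
  have T: "finite ?T" using A H by (intro finite_multiple_points arrangement_insert)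
  have m: "point_mult (insert H A) p = point_mult A p + (if p \<in> H then 1 else 0)" for p
    using fin H by (simp add: mult_insert)
  have sub: "multiple_points A \<subseteq> ?T" by (auto simp: multiple_points_def m)
  have "b2 A = (\<Sum>p\<in>?T. point_mult A p - 1)"
    unfolding b2_def using T sub by (intro sum.mono_neutral_left) (auto simp: multiple_points_def)
  moreover have "b2 (insert H A) = (\<Sum>p\<in>?T. (point_mult A p - 1) + (if p \<in> H then 1 else 0))"
    unfolding b2_def by (intro sum.cong) (auto simp: m multiple_points_def)
  moreover have "(\<Sum>p\<in>?T. if p \<in> H then 1 else 0) = meets A H"
  proof -
    have "point_mult A p \<ge> 1 \<longleftrightarrow> p \<in> \<Union>A" for p
      using fin by (auto simp: point_mult_def Suc_le_eq card_gt_0_iff)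
    then have "?T \<inter> H = H \<inter> \<Union>A" by (auto simp: multiple_points_def m)
    then show ?thesis using T by (simp add: meets_def sum.If_cases)
  qed
  ultimately show ?thesis by (simp add: sum.distrib)
qed

lemma b2_empty [simp]: "b2 {} = 0"
  by (simp add: b2_def multiple_points_def point_mult_def)

lemma line_two_points:
  assumes H: "is_line H" obtains p q where "p \<in> H" "q \<in> H" "p \<noteq> q"
  using that[of "line_point H 0" "line_point H 1"] line_point_bij[OF H]
  unfolding bij_betw_def inj_on_def by (metis UNIV_I rangeI zero_neq_one)

lemma line_not_UNIV: assumes H: "is_line H" shows "H \<noteq> UNIV"
proof
  assume U: "H = UNIV"
  have "vector [0,0] \<in> H" "vector [1,0] \<in> H" "vector [0,1] \<in> H" unfolding U by simp_all
  then show False using line_coeffs(1)[OF H] unfolding in_line_iff[OF H] by simp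
qed

lemma line_not_singleton: "is_line H \<Longrightarrow> H \<noteq> {p}"
  by (metis line_two_points singletonD)

text \<open>
  Two distinct lines share at most one point, so the nonempty intersections are the plane, the
  lines and the points on at least two lines.
\<close>

lemma intersection_poset_eq:
  assumes A: "arrangement A"
  shows "intersection_poset A = insert UNIV (A \<union> (\<lambda>p. {p}) ` multiple_points A)"
proof (intro subset_antisym subsetI)
  fix X assume "X \<in> intersection_poset A"
  then obtain F where F: "F \<subseteq> A" "X = \<Inter>F" "\<Inter>F \<noteq> {}" by (auto simp: intersection_poset_def)
  show "X \<in> insert UNIV (A \<union> (\<lambda>p. {p}) ` multiple_points A)"
  proof (cases "F = {}")
    case False
    then obtain H where H: "H \<in> F" by blast
    show ?thesis
    proof (cases "F = {H}")
      case True
      then show ?thesis using F by simp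
    next
      case False
      then obtain H' where H': "H' \<in> F" "H' \<noteq> H" using H by blast
      obtain p where p: "p \<in> \<Inter>F" using F(3) by blast
      have "q = p" if "q \<in> \<Inter>F" for q
        using that p H H' F(1) A lines_meet_once[of H H' q p] by (auto simp: arrangement_iff)
      then have "X = {p}" using F p by blast
      moreover have "p \<in> multiple_points A"
        unfolding multiple_points_def mem_Collect_eq mult_ge_2_iff[OF arrangement_finite[OF A]]
        using p H H' F(1) by blast
      ultimately show ?thesis by blast
    qed
  qed (use F in simp)
next
  fix X assume X: "X \<in> insert UNIV (A \<union> (\<lambda>p. {p}) ` multiple_points A)"
  have "\<exists>F. X = \<Inter>F \<and> F \<subseteq> A \<and> \<Inter>F \<noteq> {}"
  proof -
    consider "X = UNIV" | "X \<in> A" | p where "X = {p}" "p \<in> multiple_points A" using X by blast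
    then show ?thesis
    proof cases
      case 1
      then show ?thesis by (intro exI[of _ "{}"]) simp
    next
      case 2
      then have "X \<noteq> {}" using base_in A by (auto simp: arrangement_iff)
      then show ?thesis using 2 by (intro exI[of _ "{X}"]) simp
    next
      case 3
      obtain H H' where H: "H \<in> A" "H' \<in> A" "H \<noteq> H'" "p \<in> H" "p \<in> H'"
        using 3(2) unfolding multiple_points_def mem_Collect_eq mult_ge_2_iff[OF arrangement_finite[OF A]]
        by blast
      have "q = p" if "q \<in> H" "q \<in> H'" for q
        by (rule lines_meet_once[OF arrangement_line[OF A H(1)] arrangement_line[OF A H(2)] H(3) that H(4,5)])
      then have "X = \<Inter>{H, H'}" using 3(1) H by blast
      moreover have "{H, H'} \<subseteq> A" "\<Inter>{H, H'} \<noteq> {}" using H by blast+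
      ultimately show ?thesis by blast
    qed
  qed
  then show "X \<in> intersection_poset A" by (auto simp: intersection_poset_def)
qed

lemma flat_dim_UNIV: "flat_dim (UNIV :: ('k::field ^ 2) set) = 2"
proof -
  have "v \<in> {p - q | p q. p \<in> UNIV \<and> q \<in> UNIV}" for v :: "'k ^ 2"
    using diff_zero[of v] by (metis (mono_tags, lifting) UNIV_I mem_Collect_eq)
  then have "{p - q | p q. p \<in> UNIV \<and> q \<in> UNIV} = (UNIV :: ('k ^ 2) set)" by blast
  then show ?thesis by (simp only: flat_dim_def vec_dim_card) simp
qed

lemma flat_dim_singleton: "flat_dim {p :: 'k::field ^ 2} = 0"
proof -
  have "{x - y | x y. x \<in> {p} \<and> y \<in> {p}} = {0}" by auto
  then show ?thesis unfolding flat_dim_def by (simp only:) (simp add: vec.dim_singleton)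
qed

lemma flat_dim_line:
  assumes H: "is_line (H :: ('k::field ^ 2) set)" shows "flat_dim H = 1"
proof -
  define w where "w = line_point H 1 - line_point H 0"
  have w: "line_point H s - line_point H t = (s - t) *s w" for s t
    by (simp add: w_def vec_eq_iff forall_2 algebra_simps)
  have w0: "w \<noteq> 0"
    using line_point_bij[OF H] unfolding w_def bij_betw_def inj_on_def by (metis UNIV_I eq_iff_diff_eq_0 zero_neq_one)
  have Heq: "H = range (line_point H)" using line_point_bij[OF H] by (simp add: bij_betw_def)
  have "{p - q | p q. p \<in> H \<and> q \<in> H} = range (\<lambda>k. k *s w)"
  proof (intro subset_antisym subsetI)
    fix v assume "v \<in> {p - q | p q. p \<in> H \<and> q \<in> H}"
    then obtain p q where pq: "v = p - q" "p \<in> H" "q \<in> H" by blast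
    then obtain s t where "p = line_point H s" "q = line_point H t" using Heq by blast
    then have "v = (s - t) *s w" using pq w by simp
    then show "v \<in> range (\<lambda>k. k *s w)" by blast
  next
    fix v assume "v \<in> range (\<lambda>k. k *s w)"
    then obtain k where "v = k *s w" by blast
    then have "v = line_point H k - line_point H 0" using w[of k 0] by simp
    then show "v \<in> {p - q | p q. p \<in> H \<and> q \<in> H}" using Heq by blast
  qed
  also have "\<dots> = vec.span {w}" by (simp add: vec.span_singleton)
  finally have "flat_dim H = vec.dim (vec.span {w})" by (simp add: flat_dim_def)
  then show ?thesis using w0 by (simp add: vec.dim_singleton)
qed

lemma mobius_line:
  assumes A: "arrangement A" and H: "H \<in> A"
  shows "mobius A H = - 1"
proof -
  have l: "is_line H" using A H by (auto simp: arrangement_iff)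
  have "{Y \<in> intersection_poset A. H \<subset> Y} = {UNIV}"
  proof (intro subset_antisym subsetI)
    fix Y assume Y: "Y \<in> {Y \<in> intersection_poset A. H \<subset> Y}"
    obtain p q where pq: "p \<in> H" "q \<in> H" "p \<noteq> q" using line_two_points[OF l] .
    have "Y \<notin> A" using lines_meet_once[OF l, of Y p q] pq Y A by (auto simp: arrangement_iff)
    moreover have "Y \<noteq> {x}" for x using pq Y by blast
    ultimately show "Y \<in> {UNIV}" using Y intersection_poset_eq[OF A] by auto
  qed (use line_not_UNIV[OF l] intersection_poset_eq[OF A] in auto)
  moreover have "mobius A UNIV = 1" by (simp add: mobius.simps)
  ultimately show ?thesis using line_not_UNIV[OF l] arrangement_finite[OF A]
    by (subst mobius.simps) simp
qed

lemma mobius_point: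
  assumes A: "arrangement A" and p: "p \<in> multiple_points A"
  shows "mobius A {p} = int (point_mult A p - 1)"
proof -
  have fin: "finite A" using A by (rule arrangement_finite)
  have lines: "is_line H" if "H \<in> A" for H using A that by (auto simp: arrangement_iff)
  have m2: "point_mult A p \<ge> 2" using p by (simp add: multiple_points_def)
  obtain H0 where H0: "H0 \<in> A" "p \<in> H0"
    using m2 mult_ge_2_iff[OF fin] by blast
  have pU: "{p} \<noteq> UNIV"
  proof -
    obtain x y where "x \<in> H0" "y \<in> H0" "x \<noteq> y" using line_two_points[OF lines[OF H0(1)]] .
    then show ?thesis by (metis UNIV_I singletonD)
  qed
  have "{Y \<in> intersection_poset A. {p} \<subset> Y} = insert UNIV {H \<in> A. p \<in> H}"
    unfolding intersection_poset_eq[OF A] using pU line_not_singleton[OF lines] by auto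
  moreover have "UNIV \<notin> {H \<in> A. p \<in> H}" using line_not_UNIV[OF lines] by blast
  moreover have "mobius A UNIV = 1" by (simp add: mobius.simps)
  moreover have "(\<Sum>Y\<in>{H \<in> A. p \<in> H}. mobius A Y) = - int (point_mult A p)"
    using mobius_line[OF A] by (simp add: point_mult_def)
  ultimately show ?thesis using pU fin m2
    by (subst mobius.simps) simp
qed

lemma char_poly_eq:
  assumes A: "arrangement A"
  shows "char_poly A = [:int (b2 A), - int (card A), 1:]"
proof -
  have fin: "finite A" using A by (rule arrangement_finite)
  have lines: "is_line H" if "H \<in> A" for H using A that by (auto simp: arrangement_iff)
  let ?P = "(\<lambda>p. {p}) ` multiple_points A"
  have finP: "finite ?P" using finite_multiple_points[OF A] by simp
  have d1: "A \<inter> ?P = {}" using line_not_singleton[OF lines] by blast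
  have d2: "UNIV \<notin> A \<union> ?P"
  proof
    assume "UNIV \<in> A \<union> ?P"
    then obtain p where p: "UNIV = {p}" "p \<in> multiple_points A" using line_not_UNIV[OF lines] by blast
    then obtain H where "H \<in> A" using mult_ge_2_iff[OF fin, of p] by (auto simp: multiple_points_def)
    then show False using line_two_points[OF lines] p(1) by (metis UNIV_I singletonD)
  qed
  have "char_poly A = monom (mobius A UNIV) (flat_dim (UNIV :: ('a ^ 2) set))
      + (\<Sum>X\<in>A. monom (mobius A X) (flat_dim X)) + (\<Sum>X\<in>?P. monom (mobius A X) (flat_dim X))"
    unfolding char_poly_def intersection_poset_eq[OF A] using fin finP d1 d2
    by (simp add: sum.union_disjoint add.assoc)
  also have "monom (mobius A UNIV) (flat_dim (UNIV :: ('a ^ 2) set)) = [:0, 0, 1:]"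
    by (simp add: flat_dim_UNIV mobius.simps monom_altdef numeral_2_eq_2)
  also have "(\<Sum>X\<in>A. monom (mobius A X) (flat_dim X)) = (\<Sum>X\<in>A. [:0, - 1:])"
    using mobius_line[OF A] flat_dim_line[OF lines]
    by (intro sum.cong) (auto simp: monom_altdef)
  also have "\<dots> = [:0, - int (card A):]"
    by (simp add: of_nat_poly)
  also have "(\<Sum>X\<in>?P. monom (mobius A X) (flat_dim X)) = (\<Sum>p\<in>multiple_points A. [:int (point_mult A p - 1):])"
    using mobius_point[OF A]
    by (subst sum.reindex) (auto simp: flat_dim_singleton monom_0 intro!: sum.cong)
  also have "\<dots> = [:int (b2 A):]"
    unfolding b2_def of_nat_sum by (rule ring_hom_sum[OF ring_hom_const, symmetric])
  finally show ?thesis by simp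
qed

section \<open>Free bases of logarithmic fields\<close>

text \<open>
  Saito's criterion for the dehomogenized module.  The condition \<open>d + e = |A|\<close> carries the information about
  the line at infinity, which is invisible in the affine determinant.
\<close>

definition affine_free_basis ::
    "('k::field ^ 2) set set \<Rightarrow> nat \<Rightarrow> nat \<Rightarrow> 'k field2 \<Rightarrow> 'k field2 \<Rightarrow> bool" where
  "affine_free_basis A d e \<theta> \<eta> \<longleftrightarrow>
     \<theta> \<in> log_fields A \<and> \<eta> \<in> log_fields A \<and> field_deg_le \<theta> d \<and> field_deg_le \<eta> e \<and>
     d + e = card A \<and> (\<exists>c. c \<noteq> 0 \<and> det2 \<theta> \<eta> = K2 c * defining_poly A)"

definition affine_free :: "('k::field ^ 2) set set \<Rightarrow> nat \<Rightarrow> nat \<Rightarrow> bool" where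
  "affine_free A d e \<longleftrightarrow> (\<exists>\<theta> \<eta>. affine_free_basis A d e \<theta> \<eta>)"

lemma det2_swap: "det2 \<eta> \<theta> = - det2 \<theta> \<eta>"
  by (simp add: det2_def)

lemma affine_free_basis_swap: "affine_free_basis A d e \<theta> \<eta> \<Longrightarrow> affine_free_basis A e d \<eta> \<theta>"
proof -
  assume b: "affine_free_basis A d e \<theta> \<eta>"
  then obtain c where c: "c \<noteq> 0" "det2 \<theta> \<eta> = K2 c * defining_poly A"
    by (auto simp: affine_free_basis_def)
  have "K2 (- c) = - K2 c" by simp
  then have "det2 \<eta> \<theta> = K2 (- c) * defining_poly A"
    by (simp only: det2_swap[of \<eta>] c minus_mult_left)
  then show ?thesis using b c(1) unfolding affine_free_basis_def by (metis add.commute neg_equal_0_iff_equal)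
qed

lemma affine_free_swap: "affine_free A d e \<Longrightarrow> affine_free A e d"
  unfolding affine_free_def using affine_free_basis_swap by blast

lemma det2_scale_right: "det2 \<theta> (field_scale p \<eta>) = p * det2 \<theta> \<eta>"
  by (simp add: det2_def field_scale_def algebra_simps)

lemma det2_add_scale: "det2 \<theta> (\<eta> + field_scale p \<theta>) = det2 \<theta> \<eta>"
  by (simp add: det2_def field_scale_def algebra_simps)

text \<open>
  If one basis field happens to be tangent to the new line, multiplying the other one by the new
  form restores Saito's criterion.
\<close>

lemma affine_free_basis_insert:
  assumes A: "arrangement A" and H: "is_line H" "H \<notin> A"
    and b: "affine_free_basis A d e \<theta> \<eta>" and \<theta>: "\<theta> \<in> log_fields (insert H A)"
  shows "affine_free_basis (insert H A) d (Suc e) \<theta> (field_scale (alpha H) \<eta>)"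
proof -
  have fin: "finite A" using A by (rule arrangement_finite)
  obtain c where c: "c \<noteq> 0" "det2 \<theta> \<eta> = K2 c * defining_poly A"
    using b by (auto simp: affine_free_basis_def)
  have "field_scale (alpha H) \<eta> \<in> log_fields (insert H A)"
    using b by (simp add: log_fields_insert log_fields_scale normal_scale affine_free_basis_def)
  moreover have "field_deg_le (field_scale (alpha H) \<eta>) (Suc e)"
    using field_deg_le_scale[of "alpha H" 1 \<eta> e] tdeg_alpha[OF H(1)] b by (simp add: affine_free_basis_def)
  moreover have "det2 \<theta> (field_scale (alpha H) \<eta>) = K2 c * defining_poly (insert H A)"
    unfolding det2_scale_right c defining_poly_insert[OF fin H(2)] by (simp only: ac_simps)
  ultimately show ?thesis using b \<theta> c(1) H(2) fin by (auto simp: affine_free_basis_def)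
qed

lemma affine_free_basis_det_nonzero:
  assumes A: "arrangement A" and b: "affine_free_basis A d e \<theta> \<eta>"
  shows "det2 \<theta> \<eta> \<noteq> 0"
  using b defining_poly_nonzero[of A] A by (auto simp: affine_free_basis_def arrangement_iff simp del: mult_pCons_left)

text \<open>
  Cramer's rule: the determinants of \<open>\<zeta>\<close> with the basis fields are divisible by \<open>Q\<close>, which cancels
  against the determinant of the basis.  The degree bounds are additive because \<open>Q\<close> has degree \<open>d + e\<close>.
\<close>

lemma affine_free_basis_spans:
  assumes A: "arrangement A" and b: "affine_free_basis A d e \<theta> \<eta>"
    and \<zeta>: "\<zeta> \<in> log_fields A" "field_deg_le \<zeta> m"
  obtains p q where "\<zeta> = field_scale p \<theta> + field_scale q \<eta>"
    "p = 0 \<or> tdeg p + d \<le> m" "q = 0 \<or> tdeg q + e \<le> m"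
proof -
  have fin: "finite A" and lines: "\<And>H. H \<in> A \<Longrightarrow> is_line H" using A by (auto simp: arrangement_iff)
  have \<theta>: "\<theta> \<in> log_fields A" "field_deg_le \<theta> d" and \<eta>: "\<eta> \<in> log_fields A" "field_deg_le \<eta> e"
    and de: "d + e = card A" using b by (auto simp: affine_free_basis_def)
  obtain c where c: "c \<noteq> 0" "det2 \<theta> \<eta> = K2 c * defining_poly A"
    using b by (auto simp: affine_free_basis_def)
  have *: "\<exists>p. det2 \<alpha> \<beta> = p * defining_poly A \<and> (p = 0 \<or> tdeg p + card A \<le> a + a')"
    if "\<alpha> \<in> log_fields A" "\<beta> \<in> log_fields A" "field_deg_le \<alpha> a" "field_deg_le \<beta> a'" for \<alpha> \<beta> a a'
  proof -
    have "defining_poly A dvd det2 \<alpha> \<beta>"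
      using that lines fin by (intro defining_poly_dvd alpha_dvd_det2) (auto simp: log_fields_def)
    then obtain p where "det2 \<alpha> \<beta> = defining_poly A * p" by (elim dvdE)
    then have p: "det2 \<alpha> \<beta> = p * defining_poly A" by (simp only: mult.commute)
    have "tdeg (det2 \<alpha> \<beta>) \<le> a + a'"
      unfolding det2_def using that by (intro tdeg_diff_le tdeg_mult_le) (auto simp: field_deg_le_def)
    moreover have "p \<noteq> 0 \<Longrightarrow> tdeg (det2 \<alpha> \<beta>) = tdeg p + card A"
      unfolding p using defining_poly_nonzero[OF lines] tdeg_defining_poly[OF fin lines]
      by (simp add: tdeg_mult)
    ultimately have "p = 0 \<or> tdeg p + card A \<le> a + a'" by (cases "p = 0") auto
    then show ?thesis using p by blast
  qed
  obtain p where p: "det2 \<zeta> \<eta> = p * defining_poly A" "p = 0 \<or> tdeg p + card A \<le> m + e"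
    using *[OF \<zeta>(1) \<eta>(1) \<zeta>(2) \<eta>(2)] by blast
  obtain q where q: "det2 \<theta> \<zeta> = q * defining_poly A" "q = 0 \<or> tdeg q + card A \<le> d + m"
    using *[OF \<theta>(1) \<zeta>(1) \<theta>(2) \<zeta>(2)] by blast
  have e1: "det2 \<theta> \<eta> * fst \<zeta> = det2 \<zeta> \<eta> * fst \<theta> + det2 \<theta> \<zeta> * fst \<eta>"
    and e2: "det2 \<theta> \<eta> * snd \<zeta> = det2 \<zeta> \<eta> * snd \<theta> + det2 \<theta> \<zeta> * snd \<eta>"
    by (simp_all add: det2_def algebra_simps)
  have Q0: "defining_poly A \<noteq> 0" using lines by (rule defining_poly_nonzero)
  have inv: "K2 (1 / c) * K2 c = 1" using c(1) by (simp add: one_pCons)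
  have "defining_poly A * (K2 c * fst \<zeta>) = defining_poly A * (p * fst \<theta> + q * fst \<eta>)"
    "defining_poly A * (K2 c * snd \<zeta>) = defining_poly A * (p * snd \<theta> + q * snd \<eta>)"
    using e1 e2 unfolding c p(1) q(1) by (simp_all only: distrib_left ac_simps)
  then have "K2 c * fst \<zeta> = p * fst \<theta> + q * fst \<eta>" "K2 c * snd \<zeta> = p * snd \<theta> + q * snd \<eta>"
    using mult_left_cancel[OF Q0] by blast+
  then have "(K2 (1 / c) * K2 c) * fst \<zeta> = K2 (1 / c) * (p * fst \<theta> + q * fst \<eta>)"
    "(K2 (1 / c) * K2 c) * snd \<zeta> = K2 (1 / c) * (p * snd \<theta> + q * snd \<eta>)"
    by (simp_all only: mult.assoc)
  then have "fst \<zeta> = (K2 (1 / c) * p) * fst \<theta> + (K2 (1 / c) * q) * fst \<eta>"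
    "snd \<zeta> = (K2 (1 / c) * p) * snd \<theta> + (K2 (1 / c) * q) * snd \<eta>"
    unfolding inv by (simp_all only: distrib_left mult_1_left mult.assoc)
  then have "\<zeta> = field_scale (K2 (1 / c) * p) \<theta> + field_scale (K2 (1 / c) * q) \<eta>"
    by (simp add: prod_eq_iff field_scale_def)
  moreover have "tdeg (K2 (1 / c) * p) \<le> tdeg p" "tdeg (K2 (1 / c) * q) \<le> tdeg q"
    using tdeg_mult_le[of "K2 (1 / c)" 0 p "tdeg p"] tdeg_mult_le[of "K2 (1 / c)" 0 q "tdeg q"] by simp_all
  moreover have "p = 0 \<Longrightarrow> K2 (1 / c) * p = 0" "q = 0 \<Longrightarrow> K2 (1 / c) * q = 0" by simp_all
  ultimately show thesis using that[of "K2 (1 / c) * p" "K2 (1 / c) * q"] p(2) q(2) de by fastforce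
qed

section \<open>The second coefficient of the characteristic polynomial of a free arrangement\<close>

definition log_fields_upto :: "('k::field ^ 2) set set \<Rightarrow> nat \<Rightarrow> 'k field2 set" where
  "log_fields_upto A m = {\<theta> \<in> log_fields A. field_deg_le \<theta> m}"

lemma subspace_log_fields_upto: "module.subspace scaleF (log_fields_upto A m)"
proof (rule subspace_closedI[OF vector_space_scaleF])
  show "0 \<in> log_fields_upto A m"
    by (simp add: log_fields_upto_def log_fields_def normal_def field_deg_le_def)
  fix \<theta> :: "'a field2" and c assume "\<theta> \<in> log_fields_upto A m"
  then show "scaleF c \<theta> \<in> log_fields_upto A m"
    using field_deg_le_scale[of "K2 c" 0 \<theta> m]
    by (simp add: log_fields_upto_def scaleF_def log_fields_scale)
qed (simp add: log_fields_upto_def log_fields_add field_deg_le_add)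

text \<open>
  The basis identifies the fields of degree at most \<open>m\<close> with pairs of polynomials of degrees at most
  \<open>m - d\<close> and \<open>m - e\<close>.
\<close>

lemma has_dim_affine_free:
  assumes A: "arrangement A" and b: "affine_free_basis A d e \<theta> \<eta>" and m: "d \<le> m" "e \<le> m"
  shows "has_dim scaleF (log_fields_upto A m) ((\<Sum>i\<le>Suc (m - d). i) + (\<Sum>i\<le>Suc (m - e). i))"
proof -
  let ?V = "polys2_below (Suc (m - d)) \<times> polys2_below (Suc (m - e)) :: 'a field2 set"
  let ?f = "\<lambda>x. field_scale (fst x) \<theta> + field_scale (snd x) \<eta>"
  have lin: "Vector_Spaces.linear scaleF scaleF ?f"
    by (rule linear_scalesI[OF vector_space_scaleF vector_space_scaleF])
       (simp_all add: scaleF_def field_scale_def algebra_simps del: mult_pCons_left mult_pCons_right)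
  have img: "?f ` ?V = log_fields_upto A m"
  proof (intro subset_antisym subsetI)
    fix \<zeta> assume "\<zeta> \<in> ?f ` ?V"
    then obtain p q where pq: "\<zeta> = field_scale p \<theta> + field_scale q \<eta>"
      "p \<in> polys2_below (Suc (m - d))" "q \<in> polys2_below (Suc (m - e))" by auto
    have "tdeg p \<le> m - d" "tdeg q \<le> m - e" using pq(2,3) by (auto simp: polys2_below_iff)
    then have "field_deg_le (field_scale p \<theta>) (m - d + d)" "field_deg_le (field_scale q \<eta>) (m - e + e)"
      using b by (auto simp: affine_free_basis_def intro: field_deg_le_scale)
    then show "\<zeta> \<in> log_fields_upto A m"
      using b m pq(1) by (simp add: log_fields_upto_def field_deg_le_add log_fields_add log_fields_scale affine_free_basis_def)
  next
    fix \<zeta> assume \<zeta>: "\<zeta> \<in> log_fields_upto A m"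
    then obtain p q where pq: "\<zeta> = field_scale p \<theta> + field_scale q \<eta>"
      "p = 0 \<or> tdeg p + d \<le> m" "q = 0 \<or> tdeg q + e \<le> m"
      using affine_free_basis_spans[OF A b] unfolding log_fields_upto_def by blast
    have "(p, q) \<in> ?V" using pq(2,3) by (auto simp: polys2_below_iff)
    then show "\<zeta> \<in> ?f ` ?V" by (rule image_eqI[rotated]) (simp add: pq(1))
  qed
  have inj: "x = 0" if "?f x = 0" for x
  proof -
    have z: "fst x * fst \<theta> + snd x * fst \<eta> = 0" "fst x * snd \<theta> + snd x * snd \<eta> = 0"
      using that by (simp_all add: field_scale_def prod_eq_iff)
    have "fst x * det2 \<theta> \<eta> = (fst x * fst \<theta> + snd x * fst \<eta>) * snd \<eta> - (fst x * snd \<theta> + snd x * snd \<eta>) * fst \<eta>"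
      "snd x * det2 \<theta> \<eta> = (fst x * snd \<theta> + snd x * snd \<eta>) * fst \<theta> - (fst x * fst \<theta> + snd x * fst \<eta>) * snd \<theta>"
      by (simp_all add: det2_def algebra_simps)
    then have "fst x * det2 \<theta> \<eta> = 0" "snd x * det2 \<theta> \<eta> = 0" unfolding z by simp_all
    then show ?thesis using affine_free_basis_det_nonzero[OF A b] by (simp add: prod_eq_iff)
  qed
  have "has_dim scaleF (?f ` ?V) ((\<Sum>i\<le>Suc (m - d). i) + (\<Sum>i\<le>Suc (m - e). i))"
    by (rule has_dim_image[OF lin has_dim_Times_polys2]) (rule inj)
  then show ?thesis unfolding img .
qed

lemma const_mult: "[:c:] * p = Polynomial.smult c p"
  by simp

text \<open>
  The fields tangent to the new line form the kernel of the restricted normal component, whose image is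
  known exactly in degrees \<open>m \<ge> |A|\<close>.
\<close>

lemma has_dim_insert_line:
  assumes A: "arrangement A" and H: "is_line H" "H \<notin> A" and m: "card A \<le> m"
    and d: "has_dim scaleF (log_fields_upto A m) n"
  obtains k where "has_dim scaleF (log_fields_upto (insert H A) m) k"
    "n + card A = k + m + meets A H + 1"
proof -
  let ?T = "\<lambda>\<theta>. restr H (normal H \<theta>)"
  let ?b = "radical_quotient (restr H (defining_poly A))"
  let ?E = "polys_below (m + meets A H - card A + 1) :: 'a poly set"
  have lin: "Vector_Spaces.linear scaleF scale1 ?T"
    by (rule linear_scalesI[OF vector_space_scaleF vector_space_scale1])
       (simp_all only: scaleF_def normal_scale normal_add restr_simps restr_const const_mult[symmetric])
  have lin2: "Vector_Spaces.linear scale1 scale1 (\<lambda>h. ?b * h)"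
    by (rule linear_scalesI[OF vector_space_scale1 vector_space_scale1]) (simp_all add: algebra_simps)
  have ker: "{\<theta> \<in> log_fields_upto A m. ?T \<theta> = 0} = log_fields_upto (insert H A) m"
    by (auto simp: log_fields_upto_def log_fields_insert restr_eq_0_iff[OF H(1)])
  have E: "h \<in> ?E \<longleftrightarrow> h = 0 \<or> degree h + card A \<le> m + meets A H" for h :: "'a poly"
    using m by (auto simp: polys_below_iff)
  have im: "?T ` log_fields_upto A m = (\<lambda>h. ?b * h) ` ?E"
  proof (intro subset_antisym subsetI)
    fix f assume "f \<in> ?T ` log_fields_upto A m"
    then obtain \<theta> where \<theta>: "f = ?T \<theta>" "\<theta> \<in> log_fields A" "field_deg_le \<theta> m"
      by (auto simp: log_fields_upto_def)
    show "f \<in> (\<lambda>h. ?b * h) ` ?E"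
      using restr_normal_factor[OF A H \<theta>(2,3)] \<theta>(1) E by blast
  next
    fix f assume "f \<in> (\<lambda>h. ?b * h) ` ?E"
    then obtain h where h: "f = ?b * h" "h \<in> ?E" by blast
    then have "f \<in> normal_image A H m" using restr_normal_surj[OF A H m] E by blast
    then show "f \<in> ?T ` log_fields_upto A m"
      unfolding normal_image_def[OF A H] log_fields_upto_def by blast
  qed
  have I: "has_dim scale1 (?T ` log_fields_upto A m) (m + meets A H - card A + 1)"
    unfolding im by (rule has_dim_image[OF lin2 has_dim_polys_below]) (simp add: radical_quotient_nonzero)
  obtain k where k: "has_dim scaleF (log_fields_upto (insert H A) m) k"
    using has_dim_subspace[OF vector_space_scaleF d subspace_log_fields_upto, of "insert H A" m]
      ker by auto
  then have "has_dim scaleF (log_fields_upto A m) (k + (m + meets A H - card A + 1))"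
    using has_dim_exact[OF lin subspace_log_fields_upto _ I, of k] unfolding ker by blast
  then have "n = k + (m + meets A H - card A + 1)" using d has_dim_unique by blast
  then show thesis using that k m by simp
qed

text \<open>
  Adding up the drops in dimension, starting from all fields on the empty arrangement.  The
  contributions of the intersection numbers add up to \<open>b2\<close>.
\<close>

lemma log_fields_dim_count:
  assumes "arrangement A" "card A \<le> m"
  obtains k where "has_dim scaleF (log_fields_upto A m) k"
    "int (m + 1) * int (m + 2) = int k + int (card A) * int (m + 1) - (\<Sum>i<card A. int i) + int (b2 A)"
proof -
  have "\<exists>k. has_dim scaleF (log_fields_upto A m) k \<and>
    int (m + 1) * int (m + 2) = int k + int (card A) * int (m + 1) - (\<Sum>i<card A. int i) + int (b2 A)"
    using arrangement_finite[OF assms(1)] assms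
  proof (induction A rule: finite_induct)
    case empty
    have "affine_free_basis {} 0 0 (1, 0 :: 'a poly poly) (0, 1)"
      by (auto simp: affine_free_basis_def log_fields_def field_deg_le_def det2_def defining_poly_def
          one_pCons intro!: exI[of _ 1])
    from has_dim_affine_free[OF empty(1) this, of m]
    have e: "has_dim scaleF (log_fields_upto ({} :: ('a ^ 2) set set) m) ((\<Sum>i\<le>Suc m. i) + (\<Sum>i\<le>Suc m. i))"
      by simp
    have "(\<Sum>i\<le>Suc n. i) + (\<Sum>i\<le>Suc n. i) = (n + 1) * (n + 2)" for n :: nat
      by (induction n) simp_all
    then have "has_dim scaleF (log_fields_upto ({} :: ('a ^ 2) set set) m) ((m + 1) * (m + 2))"
      using e by (simp only:)
    then show ?case by (intro exI[of _ "(m + 1) * (m + 2)"]) (simp add: algebra_simps)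
  next
    case (insert H A)
    have A: "arrangement A" and H: "is_line H" using insert.prems by (auto simp: arrangement_iff)
    have c: "card A \<le> m" using insert by simp
    obtain n where n: "has_dim scaleF (log_fields_upto A m) n"
      "int (m + 1) * int (m + 2) = int n + int (card A) * int (m + 1) - (\<Sum>i<card A. int i) + int (b2 A)"
      using insert.IH[OF A c] by blast
    obtain k where k: "has_dim scaleF (log_fields_upto (insert H A) m) k" "n + card A = k + m + meets A H + 1"
      using has_dim_insert_line[OF A H insert(2) c n(1)] .
    have "int n + int (card A) = int k + int m + int (meets A H) + 1"
      using k(2) by linarith
    then have "int (m + 1) * int (m + 2) =
        int k + int (card (insert H A)) * int (m + 1) - (\<Sum>i<card (insert H A). int i) + int (b2 (insert H A))"
      using n(2) insert(1,2) b2_insert[OF A H insert(2)] by (simp add: algebra_simps)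
    then show ?case using k(1) by blast
  qed
  then show thesis using that by blast
qed

text \<open>
  The factorization of the characteristic polynomial of a free arrangement.  It results from comparing
  the two dimension counts in degree \<open>m = |A|\<close>.
\<close>

theorem b2_affine_free:
  assumes A: "arrangement A" and f: "affine_free A d e"
  shows "card A = d + e" "b2 A = d * e"
proof -
  obtain \<theta> \<eta> where b: "affine_free_basis A d e \<theta> \<eta>" using f by (auto simp: affine_free_def)
  then show c: "card A = d + e" by (simp add: affine_free_basis_def)
  let ?m = "d + e"
  have tri: "2 * (\<Sum>i\<le>Suc n. int i) = int (n + 1) * int (n + 2)" for n
    by (induction n) (simp_all add: algebra_simps)
  have tri2: "2 * (\<Sum>i<n. int i) = int n * (int n - 1)" for n
    by (induction n) (simp_all add: algebra_simps)
  obtain k where k: "has_dim scaleF (log_fields_upto A ?m) k"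
    "int (?m + 1) * int (?m + 2) = int k + int ?m * int (?m + 1) - (\<Sum>i<?m. int i) + int (b2 A)"
    using log_fields_dim_count[OF A, of ?m] c by auto
  have "has_dim scaleF (log_fields_upto A ?m) ((\<Sum>i\<le>Suc e. i) + (\<Sum>i\<le>Suc d. i))"
    using has_dim_affine_free[OF A b, of ?m] by simp
  then have "k = (\<Sum>i\<le>Suc e. i) + (\<Sum>i\<le>Suc d. i)" using has_dim_unique[OF k(1)] by blast
  then have "int k = (\<Sum>i\<le>Suc e. int i) + (\<Sum>i\<le>Suc d. int i)" by (simp only: of_nat_add of_nat_sum)
  then have "2 * int k = int (e + 1) * int (e + 2) + int (d + 1) * int (d + 2)"
    using tri[of e] tri[of d] by simp
  moreover have "2 * (int (?m + 1) * int (?m + 2)) =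
      2 * int k + 2 * (int ?m * int (?m + 1)) - 2 * (\<Sum>i<?m. int i) + 2 * int (b2 A)"
    using k(2) by linarith
  ultimately have "int (b2 A) = int d * int e"
    unfolding tri2 by (simp add: algebra_simps)
  then show "b2 A = d * e" by (metis of_nat_eq_iff of_nat_mult)
qed

section \<open>Adding lines to a free arrangement\<close>

text \<open>
  The field of degree \<open>d\<close> stays logarithmic since \<open>d + n_H < d + e = |A|\<close>.
\<close>

lemma affine_free_add_small:
  assumes A: "arrangement A" and H: "is_line H" "H \<notin> A"
    and f: "affine_free A d e" and lt: "meets A H < e"
  shows "affine_free (insert H A) d (Suc e)"
proof -
  obtain \<theta> \<eta> where b: "affine_free_basis A d e \<theta> \<eta>" using f by (auto simp: affine_free_def)
  have "\<theta> \<in> log_fields (insert H A)"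
    using b lt by (intro log_field_extends[OF A H]) (auto simp: affine_free_basis_def)
  then show ?thesis unfolding affine_free_def using affine_free_basis_insert[OF A H b] by blast
qed

lemma meets_affine_free_insert:
  assumes A: "arrangement A" and H: "is_line H" "H \<notin> A"
    and f: "affine_free A d e" and f': "affine_free (insert H A) d (Suc e)"
  shows "meets A H = d"
  using b2_insert[OF A H] b2_affine_free[OF A f] b2_affine_free[OF arrangement_insert[OF A H(1)] f']
  by simp

text \<open>
  In the critical case \<open>n_H = e\<close> the cofactor \<open>g\<close> of \<open>\<theta>\<close> is constant.  If it is nonzero, a multiple of \<open>\<theta>\<close>
  can be subtracted from \<open>\<eta>\<close> so as to cancel the normal component of \<open>\<eta>\<close> on \<open>H\<close>; the multiplier has
  degree at most \<open>e - d\<close>.  If it is zero, \<open>\<theta>\<close> itself is tangent to \<open>H\<close>, and comparing \<open>b2\<close> shows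
  \<open>d = e\<close>.
\<close>

lemma affine_free_add_le:
  assumes A: "arrangement A" and H: "is_line H" "H \<notin> A"
    and f: "affine_free A d e" and n: "meets A H = e" and de: "d \<le> e"
  shows "affine_free (insert H A) (Suc d) e"
proof -
  obtain \<theta> \<eta> where b: "affine_free_basis A d e \<theta> \<eta>" using f by (auto simp: affine_free_def)
  then have \<theta>: "\<theta> \<in> log_fields A" "field_deg_le \<theta> d" and \<eta>: "\<eta> \<in> log_fields A" "field_deg_le \<eta> e"
    and c: "d + e = card A" by (auto simp: affine_free_basis_def)
  let ?b = "radical_quotient (restr H (defining_poly A))"
  obtain g where g: "restr H (normal H \<theta>) = ?b * g" "g = 0 \<or> degree g + card A \<le> d + meets A H"
    using restr_normal_factor[OF A H \<theta>] .
  obtain h where h: "restr H (normal H \<eta>) = ?b * h" "h = 0 \<or> degree h + card A \<le> e + meets A H"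
    using restr_normal_factor[OF A H \<eta>] .
  show ?thesis
  proof (cases "g = 0")
    case True
    then have "\<theta> \<in> log_fields (insert H A)"
      using \<theta>(1) g by (simp add: log_fields_insert restr_eq_0_iff[OF H(1), symmetric])
    then have f': "affine_free (insert H A) d (Suc e)"
      unfolding affine_free_def using affine_free_basis_insert[OF A H b] by blast
    then have "d = e" using meets_affine_free_insert[OF A H f] n by simp
    then show ?thesis using affine_free_swap[OF f'] by simp
  next
    case False
    then have "degree g = 0" using g(2) n c by simp
    then obtain u where u: "g = [:u:]" by (elim degree_eq_zeroE)
    then have u0: "u \<noteq> 0" using False by simp
    have "degree (Polynomial.smult (1 / u) h) \<le> e - d" using h(2) n c by auto
    then obtain p where p: "tdeg p \<le> e - d" "restr H p = Polynomial.smult (1 / u) h"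
      using restr_lift[OF H(1)] by blast
    define \<eta>' where "\<eta>' = \<eta> + field_scale (- p) \<theta>"
    have "restr H (normal H \<eta>') = 0"
      unfolding \<eta>'_def normal_add normal_scale restr_simps h(1) g(1) p(2) u using u0 by simp
    then have l: "\<eta>' \<in> log_fields (insert H A)"
      using \<theta>(1) \<eta>(1) by (simp add: log_fields_insert restr_eq_0_iff[OF H(1), symmetric] \<eta>'_def
          log_fields_add log_fields_scale)
    have "field_deg_le \<eta>' e"
      unfolding \<eta>'_def using field_deg_le_scale[of "- p" "e - d" \<theta> d] p(1) \<theta>(2) \<eta>(2) de
      by (intro field_deg_le_add) auto
    moreover have "det2 \<theta> \<eta>' = det2 \<theta> \<eta>" unfolding \<eta>'_def by (rule det2_add_scale)
    ultimately have "affine_free_basis A d e \<theta> \<eta>'"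
      using b l by (auto simp: affine_free_basis_def log_fields_insert)
    then have "affine_free_basis (insert H A) e (Suc d) \<eta>' (field_scale (alpha H) \<theta>)"
      using affine_free_basis_insert[OF A H] l affine_free_basis_swap by blast
    then show ?thesis using affine_free_swap unfolding affine_free_def by blast
  qed
qed

lemma affine_free_add:
  assumes A: "arrangement A" and H: "is_line H" "H \<notin> A"
    and f: "affine_free A d e" and n: "meets A H = e"
  shows "affine_free (insert H A) (Suc d) e"
proof (cases "d \<le> e")
  case False
  then have "affine_free (insert H A) e (Suc d)"
    using n by (intro affine_free_add_small[OF A H affine_free_swap[OF f]]) simp
  then show ?thesis by (rule affine_free_swap)
qed (rule affine_free_add_le[OF assms])

lemma meets_mono:
  assumes "arrangement A" "B \<subseteq> A" "is_line H" "H \<notin> A" shows "meets B H \<le> meets A H"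
proof -
  have "finite (root_set (restr H (defining_poly A)))"
    using assms by (intro poly_roots_finite restr_defining_poly_nonzero) (auto simp: arrangement_iff)
  then have "finite {t. line_point H t \<in> \<Union>A}" using root_set_restr[OF assms(1), of H] by simp
  moreover have "H \<inter> \<Union>A \<subseteq> line_point H ` {t. line_point H t \<in> \<Union>A}"
  proof
    fix v assume v: "v \<in> H \<inter> \<Union>A"
    then obtain t where "v = line_point H t"
      using bij_betw_imp_surj_on[OF line_point_bij[OF assms(3)]] by blast
    then show "v \<in> line_point H ` {t. line_point H t \<in> \<Union>A}" using v by simp
  qed
  ultimately have "finite (H \<inter> \<Union>A)" by (meson finite_imageI finite_subset)
  then show ?thesis unfolding meets_def using assms(2) by (intro card_mono) auto
qed

text \<open>
  The lines outside \<open>C\<close> may be added in any order, and the intersection numbers only grow on the way.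
\<close>

lemma b2_lower_bound:
  assumes A: "arrangement A" and C: "C \<subseteq> A" and n: "\<And>H. H \<in> A - C \<Longrightarrow> N \<le> meets C H"
  shows "b2 C + N * card (A - C) \<le> b2 A"
  using C n
proof (induction "card (A - C)" arbitrary: C)
  case 0
  then have "A = C" using arrangement_finite[OF A] by simp
  then show ?case by simp
next
  case (Suc k)
  have fin: "finite A" using A by (rule arrangement_finite)
  obtain H where H: "H \<in> A - C" using Suc.hyps(2) by (metis card.empty ex_in_conv nat.distinct(1))
  have l: "is_line H" and CA: "arrangement C" using A H Suc.prems(1) arrangement_line arrangement_subset by blast+
  have e: "A - insert H C = (A - C) - {H}" by blast
  have ck: "card (A - insert H C) = k" unfolding e using H Suc.hyps(2) by simp
  have "N \<le> meets (insert H C) H'" if H': "H' \<in> A - insert H C" for H'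
  proof -
    have "N \<le> meets C H'" using Suc.prems(2) H' by blast
    also have "\<dots> \<le> meets (insert H C) H'"
      using H' A CA l arrangement_line by (intro meets_mono arrangement_insert) auto
    finally show ?thesis .
  qed
  then have "b2 (insert H C) + N * k \<le> b2 A"
    using Suc.hyps(1)[of "insert H C"] ck H Suc.prems(1) by simp
  moreover have "b2 (insert H C) = b2 C + meets C H" using b2_insert[OF CA l] H by simp
  moreover have "N \<le> meets C H" using Suc.prems(2) H by blast
  moreover have "N * card (A - C) = N + N * k" by (simp add: Suc.hyps(2)[symmetric])
  ultimately show ?case by linarith
qed

text \<open>
  The bound on \<open>b2 A\<close> is the smallest value permitted by the intersection numbers.  Hence every added line
  meets its predecessors in exactly \<open>e\<close> points, and each step raises the first exponent by one.
\<close>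

lemma affine_free_of_tight_b2:
  assumes A: "arrangement A" and C: "C \<subseteq> A" and f: "affine_free C d e"
    and n: "\<And>H. H \<in> A - C \<Longrightarrow> e \<le> meets C H" and b: "b2 A \<le> e * (d + card (A - C))"
  shows "\<exists>d'. affine_free A d' e"
  using C f n b
proof (induction "card (A - C)" arbitrary: C d)
  case 0
  then have "A = C" using arrangement_finite[OF A] by simp
  then show ?case using 0 by blast
next
  case (Suc k)
  have fin: "finite A" using A by (rule arrangement_finite)
  obtain H where H: "H \<in> A - C" using Suc.hyps(2) by (metis card.empty ex_in_conv nat.distinct(1))
  have l: "is_line H" and CA: "arrangement C" using A H Suc.prems(1) arrangement_line arrangement_subset by blast+
  have H2: "H \<notin> C" using H by blast
  have e: "A - insert H C = (A - C) - {H}" by blast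
  have ck: "card (A - insert H C) = k" unfolding e using H Suc.hyps(2) by simp
  have n': "e \<le> meets (insert H C) H'" if H': "H' \<in> A - insert H C" for H'
  proof -
    have "e \<le> meets C H'" using Suc.prems(3) H' by blast
    also have "\<dots> \<le> meets (insert H C) H'"
      using H' A CA l arrangement_line by (intro meets_mono arrangement_insert) auto
    finally show ?thesis .
  qed
  have sub: "insert H C \<subseteq> A" using H Suc.prems(1) by blast
  have "b2 C + meets C H + e * k \<le> b2 A"
    using b2_lower_bound[OF A sub n'] ck b2_insert[OF CA l H2] by simp
  then have "meets C H \<le> e"
    using Suc.prems(4) Suc.hyps(2)[symmetric] b2_affine_free(2)[OF CA Suc.prems(2)] by (simp add: algebra_simps)
  then have "meets C H = e" using Suc.prems(3)[OF H] by simp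
  then have "affine_free (insert H C) (Suc d) e"
    using affine_free_add[OF CA l H2 Suc.prems(2)] by simp
  moreover have "b2 A \<le> e * (Suc d + card (A - insert H C))"
    using Suc.prems(4) unfolding ck Suc.hyps(2)[symmetric] by simp
  ultimately show ?case
    using Suc.hyps(1)[OF ck[symmetric] sub _ n'] by blast
qed

section \<open>Derivations of the polynomial ring in three variables\<close>

text \<open>
  Additivity and the Leibniz rule over an arbitrary ring.  Unlike linearity over the ground field
  these make sense for each layer of the iterated polynomial ring.
\<close>

definition is_der :: "('a::comm_ring_1 \<Rightarrow> 'a) \<Rightarrow> bool" where
  "is_der d \<longleftrightarrow> (\<forall>a b. d (a + b) = d a + d b) \<and> (\<forall>a b. d (a * b) = a * d b + b * d a)"

lemma is_der_0: assumes "is_der d" shows "d 0 = 0"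
proof -
  have "d (0 + 0) = d 0 + d 0" using assms unfolding is_der_def by blast
  then show ?thesis by simp
qed

lemma is_der_pderiv: "is_der (pderiv :: 'a::idom poly \<Rightarrow> _)"
  by (simp add: is_der_def pderiv_add pderiv_mult)

lemma is_der_map_poly:
  assumes d: "is_der d" shows "is_der (map_poly d)"
proof -
  note [simp] = is_der_0[OF d] map_poly_pCons
  have da: "d (a + b) = d a + d b" "d (a * b) = a * d b + b * d a" for a b
    using d unfolding is_der_def by blast+
  have add: "map_poly d (p + q) = map_poly d p + map_poly d q" for p q
    by (induction p q rule: poly_induct2) (simp_all add: da)
  have smult: "map_poly d (Polynomial.smult a q) = Polynomial.smult a (map_poly d q) + Polynomial.smult (d a) q" for a q
    by (induction q) (simp_all add: da algebra_simps)
  have "map_poly d (p * q) = p * map_poly d q + q * map_poly d p" for p q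
    by (induction p) (simp_all add: add smult algebra_simps)
  then show ?thesis using add unfolding is_der_def by blast
qed

text \<open>
  The derivation \<open>F \<partial>\<^sub>x + G \<partial>\<^sub>y + K \<partial>\<^sub>z\<close>.
\<close>

definition mk_der :: "'k::field poly3 \<Rightarrow> 'k poly3 \<Rightarrow> 'k poly3 \<Rightarrow> 'k poly3 \<Rightarrow> 'k poly3" where
  "mk_der F G K f = F * map_poly (map_poly pderiv) f + G * map_poly pderiv f + K * pderiv f"

lemma derivation_mk_der: "derivation (mk_der F G K)"
proof -
  have d: "is_der (mk_der F G K)"
    using is_der_pderiv[where 'a = "'a poly poly"] is_der_map_poly[OF is_der_pderiv[where 'a = "'a poly"]]
      is_der_map_poly[OF is_der_map_poly[OF is_der_pderiv[where 'a = 'a]]]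
    unfolding is_der_def mk_der_def by (simp add: algebra_simps)
  have "mk_der F G K (Const3 c) = 0" for c
    by (simp add: mk_der_def Const3_def map_poly_pCons)
  then show ?thesis using d unfolding derivation_def is_der_def by simp
qed

lemma mk_der_vars:
  "mk_der F G K X3 = F" "mk_der F G K Y3 = G" "mk_der F G K Z3 = K"
proof -
  have "map_poly (map_poly pderiv) X3 = (1 :: 'a poly3)" "map_poly pderiv X3 = (0 :: 'a poly3)"
    "pderiv X3 = (0 :: 'a poly3)" "map_poly (map_poly pderiv) Y3 = (0 :: 'a poly3)"
    "map_poly pderiv Y3 = (1 :: 'a poly3)" "pderiv Y3 = (0 :: 'a poly3)"
    "map_poly (map_poly pderiv) Z3 = (0 :: 'a poly3)" "map_poly pderiv Z3 = (0 :: 'a poly3)"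
    "pderiv Z3 = (1 :: 'a poly3)"
    by (simp_all add: X3_def Y3_def Z3_def map_poly_pCons pderiv_pCons one_pCons)
  then show "mk_der F G K X3 = F" "mk_der F G K Y3 = G" "mk_der F G K Z3 = K"
    by (simp_all add: mk_der_def)
qed

lemma euler_eq_mk_der: "euler = mk_der X3 Y3 Z3"
  by (rule ext) (simp add: euler_def mk_der_def)

lemma derivation_simps:
  assumes "derivation \<theta>"
  shows "\<theta> (f + g) = \<theta> f + \<theta> g" "\<theta> (Const3 c * f) = Const3 c * \<theta> f"
    "\<theta> (f * g) = f * \<theta> g + g * \<theta> f" "\<theta> (Const3 c) = 0"
proof -
  show a: "\<theta> (f + g) = \<theta> f + \<theta> g" and c: "\<theta> (Const3 c * f) = Const3 c * \<theta> f"
    and m: "\<theta> (f * g) = f * \<theta> g + g * \<theta> f" for f g c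
    using assms unfolding derivation_def by blast+
  have "\<theta> 1 = \<theta> 1 + \<theta> 1" using m[of 1 1] by (simp only: mult_1_left)
  then have "\<theta> 1 = 0" by (simp only: add_cancel_right_right)
  then show "\<theta> (Const3 c) = 0" using c[of c 1] by simp
qed

lemma derivation_eqI:
  assumes t: "derivation \<theta>" and e: "derivation \<eta>"
    and X: "\<theta> X3 = \<eta> X3" and Y: "\<theta> Y3 = \<eta> Y3" and Z: "\<theta> Z3 = \<eta> Z3"
  shows "\<theta> = \<eta>"
proof
  fix f :: "'a poly3"
  have z: "\<theta> 0 = 0" "\<eta> 0 = 0"
    using derivation_simps(4)[OF t, of 0] derivation_simps(4)[OF e, of 0] by (simp_all add: Const3_def)
  have 1: "\<theta> [:[:p:]:] = \<eta> [:[:p:]:]" for p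
  proof (induction p)
    case (pCons a p)
    have "[:[:pCons a p:]:] = Const3 a + X3 * [:[:p:]:]" by (simp add: Const3_def X3_def)
    then show ?case using pCons by (simp only: derivation_simps[OF t] derivation_simps[OF e] X)
  qed (simp add: z)
  have 2: "\<theta> [:q:] = \<eta> [:q:]" for q
  proof (induction q)
    case (pCons a q)
    have "[:pCons a q:] = [:[:a:]:] + Y3 * [:q:]" by (simp add: Y3_def)
    then show ?case using pCons 1 by (simp only: derivation_simps[OF t] derivation_simps[OF e] Y)
  qed (simp add: z)
  show "\<theta> f = \<eta> f"
  proof (induction f)
    case (pCons a f)
    have "pCons a f = [:a:] + Z3 * f" by (simp add: Z3_def)
    then show ?case using pCons 2 by (simp only: derivation_simps[OF t] derivation_simps[OF e] Z)
  qed (simp add: z)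
qed

lemma derivation_combination:
  "derivation \<theta> \<Longrightarrow> derivation (der_scale p \<theta>)"
  "derivation \<theta> \<Longrightarrow> derivation \<eta> \<Longrightarrow> derivation (\<theta> + \<eta>)"
proof -
  assume t: "derivation \<theta>"
  show "derivation (der_scale p \<theta>)"
    unfolding derivation_def der_scale_def
    by (intro conjI allI) (simp_all add: derivation_simps[OF t] distrib_left ac_simps)
next
  assume t: "derivation \<theta>" and e: "derivation \<eta>"
  show "derivation (\<theta> + \<eta>)"
    unfolding derivation_def plus_fun_apply
    by (intro conjI allI) (simp_all add: derivation_simps[OF t] derivation_simps[OF e] distrib_left ac_simps)
qed

section \<open>Homogenization\<close>

lemma homogeneous_iff: "homogeneous d F \<longleftrightarrow> grade3 F = monom F d"
proof -
  have "grade3 F = monom F d \<longleftrightarrow>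
      (\<forall>m k j i. (if i + j + k = m then coeff (coeff (coeff F k) j) i else 0) =
         (if d = m then coeff (coeff (coeff F k) j) i else 0))"
    unfolding poly_eq_iff coeff_grade3[symmetric] by (auto split: if_splits)
  also have "\<dots> \<longleftrightarrow> homogeneous d F"
    unfolding homogeneous_def by (auto split: if_splits)
  finally show ?thesis by simp
qed

lemma homogeneous_add: "homogeneous d F \<Longrightarrow> homogeneous d G \<Longrightarrow> homogeneous d (F + G)"
  by (simp add: homogeneous_iff ring_hom_simps[OF ring_hom_grade3] add_monom)

lemma homogeneous_diff: "homogeneous d F \<Longrightarrow> homogeneous d G \<Longrightarrow> homogeneous d (F - G)"
  by (simp add: homogeneous_iff ring_hom_simps[OF ring_hom_grade3] diff_monom)

lemma homogeneous_mult: "homogeneous a F \<Longrightarrow> homogeneous b G \<Longrightarrow> homogeneous (a + b) (F * G)"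
  by (simp add: homogeneous_iff ring_hom_simps[OF ring_hom_grade3] mult_monom)

lemma homogeneous_0: "homogeneous d 0"
  by (simp add: homogeneous_def)

lemma homogeneous_Const3: "homogeneous 0 (Const3 c)"
  and homogeneous_X3: "homogeneous 1 X3"
  and homogeneous_Y3: "homogeneous 1 Y3"
  and homogeneous_Z3: "homogeneous 1 Z3"
  by (auto simp: homogeneous_def Const3_def X3_def Y3_def Z3_def coeff_pCons split: nat.splits)

lemma homogeneous_Const3_mult: "homogeneous d F \<Longrightarrow> homogeneous d (Const3 c * F)"
  using homogeneous_mult[OF homogeneous_Const3] by fastforce

lemma homogeneous_component: "homogeneous m (coeff (grade3 F) m)"
  by (auto simp: homogeneous_def coeff_grade3 split: if_splits)

lemma component_mult_homogeneous:
  assumes "homogeneous d G"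
  shows "coeff (grade3 (p * G)) m = (if d \<le> m then coeff (grade3 p) (m - d) * G else 0)"
  using assms unfolding homogeneous_iff ring_hom_simps(3)[OF ring_hom_grade3]
  by (simp add: mult.commute[of "grade3 p"] coeff_monom_mult mult.commute[of G])

lemma component_homogeneous: "homogeneous d G \<Longrightarrow> coeff (grade3 G) m = (if m = d then G else 0)"
  unfolding homogeneous_iff by (simp add: coeff_monom)

lemma poly_1_eq_sum: "degree p \<le> m \<Longrightarrow> poly p 1 = (\<Sum>k\<le>m. coeff p k)" for p :: "'a::comm_ring_1 poly"
  unfolding poly_altdef by (auto intro!: sum.mono_neutral_left coeff_eq_0)

text \<open>
  In a homogeneous polynomial of known degree the exponents of \<open>x\<close> and \<open>y\<close> determine the one of \<open>z\<close>,
  so setting \<open>z = 1\<close> merges no two monomials.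
\<close>

lemma coeff_dehomogenize:
  assumes "homogeneous d F"
  shows "coeff (coeff (poly F 1) j) i = (if i + j \<le> d then coeff (coeff (coeff F (d - i - j)) j) i else 0)"
proof -
  define m where "m = max d (degree F)"
  have "coeff (coeff (poly F 1) j) i = (\<Sum>k\<le>m. coeff (coeff (coeff F k) j) i)"
    by (subst poly_1_eq_sum[of F m]) (simp_all add: m_def coeff_sum)
  also have "\<dots> = (\<Sum>k\<le>m. if k = d - i - j then (if i + j \<le> d then coeff (coeff (coeff F k) j) i else 0) else 0)"
    using assms unfolding homogeneous_def by (intro sum.cong refl) fastforce
  also have "\<dots> = (if i + j \<le> d then coeff (coeff (coeff F (d - i - j)) j) i else 0)"
    by (subst sum.delta) (auto simp: m_def)
  finally show ?thesis .
qed

lemma tdeg_dehomogenize: "homogeneous d F \<Longrightarrow> tdeg (poly F 1) \<le> d"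
  by (auto simp: tdeg_le_iff coeff_dehomogenize)

lemma homogeneous_eqI:
  assumes F: "homogeneous d F" and G: "homogeneous d G" and e: "poly F 1 = poly G 1"
  shows "F = G"
proof -
  have "coeff (coeff (coeff F k) j) i = coeff (coeff (coeff G k) j) i" for i j k
  proof (cases "i + j + k = d")
    case True
    then have "d - i - j = k" "i + j \<le> d" by auto
    then show ?thesis
      using arg_cong[OF e, of "\<lambda>p. coeff (coeff p j) i"] coeff_dehomogenize[OF F, of j i] coeff_dehomogenize[OF G, of j i]
      by simp
  next
    case False
    then show ?thesis using F G unfolding homogeneous_def by metis
  qed
  then show ?thesis by (simp add: poly_eq_iff)
qed

definition homogenize :: "nat \<Rightarrow> 'k::field poly poly \<Rightarrow> 'k poly3" where
  "homogenize m f = (\<Sum>k\<le>m. monom (coeff (grade2 f) k) (m - k))"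

lemma homogeneous_homogenize: "homogeneous m (homogenize m f)"
  unfolding homogeneous_def
proof (intro allI impI)
  fix i j l assume "coeff (coeff (coeff (homogenize m f) l) j) i \<noteq> 0"
  then have "(\<Sum>k\<le>m. coeff (coeff (coeff (monom (coeff (grade2 f) k) (m - k)) l) j) i) \<noteq> 0"
    by (simp add: homogenize_def coeff_sum)
  then obtain k where "k \<le> m" "coeff (coeff (coeff (monom (coeff (grade2 f) k) (m - k)) l) j) i \<noteq> 0"
    by (metis (no_types, lifting) atMost_iff sum.not_neutral_contains_not_neutral)
  then show "i + j + l = m" by (auto simp: coeff_grade2 split: if_splits)
qed

lemma poly_homogenize: "tdeg f \<le> m \<Longrightarrow> poly (homogenize m f) 1 = f"
  using poly_1_eq_sum[of "grade2 f" m]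
  by (simp add: homogenize_def poly_sum poly_monom tdeg_def)

text \<open>
  Divisibility can be tested at \<open>z = 1\<close> provided that \<open>P\<close> is not divisible by \<open>z\<close>, which is the
  meaning of the condition on the degree of \<open>poly P 1\<close>.
\<close>

lemma homogeneous_dvdI:
  fixes P D :: "'k::field poly3"
  assumes P: "homogeneous a P" "tdeg (poly P 1) = a" and D: "homogeneous m D"
    and dvd: "poly P 1 dvd poly D 1"
  shows "P dvd D"
proof (cases "D = 0")
  case False
  then have D1: "poly D 1 \<noteq> 0" using homogeneous_eqI[OF D homogeneous_0] by auto
  obtain u where u: "poly D 1 = poly P 1 * u" using dvd by (elim dvdE)
  have n: "poly P 1 \<noteq> 0" "u \<noteq> 0" using D1 u by auto
  have "a + tdeg u \<le> m" using tdeg_dehomogenize[OF D] tdeg_mult[OF n] u P(2) by simp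
  then have m: "m = a + (m - a)" "tdeg u \<le> m - a" by auto
  have "homogeneous m (P * homogenize (m - a) u)"
    using homogeneous_mult[OF P(1) homogeneous_homogenize] m(1) by metis
  moreover have "poly (P * homogenize (m - a) u) 1 = poly D 1"
    using poly_homogenize[OF m(2)] u by simp
  ultimately have "D = P * homogenize (m - a) u" using homogeneous_eqI[OF D] by metis
  then show ?thesis by simp
qed simp

section \<open>The cone over an arrangement\<close>

definition form3 :: "('k::field ^ 2) set \<Rightarrow> 'k poly3" where
  "form3 H = Const3 (la H) * X3 + Const3 (lb H) * Y3 + Const3 (lc H) * Z3"

lemma poly_vars_1:
  "poly (Const3 c) 1 = K2 c" "poly X3 1 = [:[:0, 1:]:]" "poly Y3 1 = [:0, 1:]" "poly Z3 1 = 1"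
  by (simp_all add: Const3_def X3_def Y3_def Z3_def one_pCons)

lemma poly_form3: "poly (form3 H) 1 = alpha H"
  by (simp add: form3_def poly_vars_1 alpha_def lform_def)

lemma homogeneous_form3: "homogeneous 1 (form3 H)"
  unfolding form3_def
  by (intro homogeneous_add homogeneous_Const3_mult homogeneous_X3 homogeneous_Y3 homogeneous_Z3)

lemma form3_dvdI:
  assumes "is_line H" "homogeneous m D" "alpha H dvd poly D 1"
  shows "form3 H dvd D"
  using assms homogeneous_form3 tdeg_alpha
  by (intro homogeneous_dvdI[of 1 "form3 H" m D]) (simp_all add: poly_form3)

lemma Const3_mult: "Const3 a * Const3 b = Const3 (a * b)"
  by (simp add: Const3_def)

lemma Const3_1: "Const3 1 = 1"
  by (simp add: Const3_def one_pCons)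

lemma Const3_dvd_cancel:
  assumes "a \<noteq> 0" "p dvd Const3 a * f" shows "p dvd f"
proof -
  have "f = Const3 (1 / a) * (Const3 a * f)"
    using assms(1) by (simp add: mult.assoc[symmetric] Const3_mult Const3_1)
  then show ?thesis using assms(2) by (metis dvd_mult)
qed

lemma line_eq_proportional:
  assumes H: "is_line H" and ab: "a \<noteq> 0 \<or> b \<noteq> 0" and e: "line a b c = H"
  obtains k where "a = k * la H" "b = k * lb H" "c = k * lc H"
proof -
  have p: "line_point H t \<in> line a b c" for t
    using line_point_bij[OF H] unfolding e bij_betw_def by blast
  have 0: "a * base H $ 1 + b * base H $ 2 + c = 0"
    using p[of 0] by (simp add: line_def)
  have "a * (base H $ 1 - lb H) + b * (base H $ 2 + la H) + c = 0"
    using p[of 1] by (simp add: line_def)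
  then have "(a * base H $ 1 + b * base H $ 2 + c) + (b * la H - a * lb H) = 0"
    by (simp add: algebra_simps)
  then have "b * la H - a * lb H = 0" using 0 by simp
  then show thesis
    using proportional_lines[OF line_coeffs(1)[OF H] ab base_eq[OF H] 0] that by blast
qed

text \<open>
  All equations of a line are proportional, so one of them may represent the others.
\<close>

lemma log_derivations_iff:
  assumes A: "arrangement A"
  shows "\<theta> \<in> log_derivations A \<longleftrightarrow>
     derivation \<theta> \<and> Z3 dvd \<theta> Z3 \<and> (\<forall>H\<in>A. form3 H dvd \<theta> (form3 H))"
proof
  assume l: "\<theta> \<in> log_derivations A"
  have "form3 H \<in> cone_forms A" if "H \<in> A" for H
  proof -
    have "(la H \<noteq> 0 \<or> lb H \<noteq> 0) \<and> line (la H) (lb H) (lc H) \<in> A"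
      using line_coeffs[OF arrangement_line[OF A that]] that by simp
    then show ?thesis unfolding cone_forms_def form3_def by blast
  qed
  moreover have "Z3 \<in> cone_forms A" by (simp add: cone_forms_def)
  ultimately show "derivation \<theta> \<and> Z3 dvd \<theta> Z3 \<and> (\<forall>H\<in>A. form3 H dvd \<theta> (form3 H))"
    using l unfolding log_derivations_def by blast
next
  assume r: "derivation \<theta> \<and> Z3 dvd \<theta> Z3 \<and> (\<forall>H\<in>A. form3 H dvd \<theta> (form3 H))"
  have "\<alpha> dvd \<theta> \<alpha>" if \<alpha>_in: "\<alpha> \<in> cone_forms A" for \<alpha>
  proof (cases "\<alpha> = Z3")
    case False
    then obtain a b c where abc: "\<alpha> = Const3 a * X3 + Const3 b * Y3 + Const3 c * Z3"
      "a \<noteq> 0 \<or> b \<noteq> 0" "line a b c \<in> A" using \<alpha>_in unfolding cone_forms_def by blast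
    let ?H = "line a b c"
    obtain k where k: "a = k * la ?H" "b = k * lb ?H" "c = k * lc ?H"
      using line_eq_proportional[OF arrangement_line[OF A abc(3)] abc(2) refl] .
    have \<alpha>: "\<alpha> = Const3 k * form3 ?H"
      unfolding abc(1) form3_def distrib_left mult.assoc[symmetric] Const3_mult k[symmetric] ..
    have "\<theta> \<alpha> = Const3 k * \<theta> (form3 ?H)"
      unfolding \<alpha> using r by (simp add: derivation_simps)
    then show ?thesis unfolding \<alpha> using r abc(3) by (simp add: mult_dvd_mono)
  qed (use r in simp)
  then show "\<theta> \<in> log_derivations A" using r unfolding log_derivations_def by blast
qed

lemma derivation_form3:
  "derivation \<theta> \<Longrightarrow> \<theta> (form3 H) = Const3 (la H) * \<theta> X3 + Const3 (lb H) * \<theta> Y3 + Const3 (lc H) * \<theta> Z3"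
  by (simp add: form3_def derivation_simps)

lemma mk_der_log:
  assumes A: "arrangement A"
    and f: "(f, g) \<in> log_fields A" "field_deg_le (f, g) m"
  shows "mk_der (homogenize m f) (homogenize m g) 0 \<in> log_derivations A" (is "?\<theta> \<in> _")
  unfolding log_derivations_iff[OF A]
proof (intro conjI ballI)
  show "derivation ?\<theta>" by (rule derivation_mk_der)
  show "Z3 dvd ?\<theta> Z3" by (simp add: mk_der_vars)
  fix H assume H: "H \<in> A"
  have e: "?\<theta> (form3 H) = Const3 (la H) * homogenize m f + Const3 (lb H) * homogenize m g"
    by (simp add: derivation_form3[OF derivation_mk_der] mk_der_vars)
  have "poly (?\<theta> (form3 H)) 1 = normal H (f, g)"
    unfolding e using f(2) by (simp add: normal_def poly_vars_1 poly_homogenize field_deg_le_def)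
  then have "alpha H dvd poly (?\<theta> (form3 H)) 1" using f(1) H by (simp add: log_fields_def)
  moreover have "homogeneous m (?\<theta> (form3 H))"
    unfolding e by (intro homogeneous_add homogeneous_Const3_mult homogeneous_homogenize)
  ultimately show "form3 H dvd ?\<theta> (form3 H)"
    using form3_dvdI[OF arrangement_line[OF A H]] by blast
qed

section \<open>Dehomogenizing a free basis\<close>

text \<open>
  The derivation \<open>\<theta> - (\<theta>(z) / z) \<theta>_E\<close>, which annihilates \<open>z\<close>, evaluated at \<open>z = 1\<close>.
\<close>

definition dehomogenize_der :: "('k::field poly3 \<Rightarrow> 'k poly3) \<Rightarrow> 'k field2" where
  "dehomogenize_der \<theta> = (poly (\<theta> X3) 1 - poly X3 1 * poly (\<theta> Z3) 1, poly (\<theta> Y3) 1 - poly Y3 1 * poly (\<theta> Z3) 1)"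

lemma dehomogenize_der_log:
  assumes A: "arrangement A" and l: "\<theta> \<in> log_derivations A"
  shows "dehomogenize_der \<theta> \<in> log_fields A"
  unfolding log_fields_def mem_Collect_eq
proof
  fix H assume H: "H \<in> A"
  have d: "derivation \<theta>" and "form3 H dvd \<theta> (form3 H)"
    using l H unfolding log_derivations_iff[OF A] by blast+
  then obtain s where s: "\<theta> (form3 H) = form3 H * s" by (elim dvdE)
  have "K2 (la H) * poly (\<theta> X3) 1 + K2 (lb H) * poly (\<theta> Y3) 1 + K2 (lc H) * poly (\<theta> Z3) 1
      = alpha H * poly s 1"
    using arg_cong[OF s, of "\<lambda>p. poly p 1"]
    unfolding derivation_form3[OF d] by (simp only: poly_add poly_mult poly_vars_1 poly_form3)
  moreover have "alpha H = K2 (la H) * poly X3 1 + K2 (lb H) * poly Y3 1 + K2 (lc H)"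
    by (simp add: poly_form3[symmetric] form3_def poly_vars_1)
  ultimately have "normal H (dehomogenize_der \<theta>) = alpha H * poly s 1 - alpha H * poly (\<theta> Z3) 1"
    unfolding normal_def dehomogenize_der_def fst_conv snd_conv
    by (simp only:) (simp add: algebra_simps del: mult_pCons_left mult_pCons_right)
  then show "alpha H dvd normal H (dehomogenize_der \<theta>)" by simp
qed

text \<open>
  Stated for a product so that the quotient of a homogeneous polynomial by \<open>z\<close> can be treated without
  distinguishing the degree \<open>d = 0\<close>.
\<close>

lemma homogeneous_exchange_Z3:
  assumes "homogeneous d (Z3 * p)" "homogeneous 1 V"
  shows "homogeneous d (V * p)"
proof -
  have Z: "grade3 (Z3 :: 'a poly3) = monom Z3 1" and V: "grade3 V = monom V 1"
    using homogeneous_Z3 assms(2) by (simp_all add: homogeneous_iff)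
  have g: "monom Z3 1 * grade3 p = monom (Z3 * p) d"
    using assms(1) by (simp add: homogeneous_iff ring_hom_simps[OF ring_hom_grade3] Z)
  have "monom Z3 1 * grade3 (V * p) = monom V 1 * (monom Z3 1 * grade3 p)"
    by (simp only: ring_hom_simps[OF ring_hom_grade3] V ac_simps)
  also have "\<dots> = monom Z3 1 * monom (V * p) d"
    unfolding g by (simp add: mult_monom ac_simps)
  finally have "grade3 (V * p) = monom (V * p) d"
    by (rule mult_left_cancel[THEN iffD1, rotated]) (simp add: Z3_def monom_eq_0_iff)
  then show ?thesis by (simp add: homogeneous_iff)
qed

text \<open>
  The naive bound is \<open>d + 1\<close> because of the factors \<open>x\<close> and \<open>y\<close>; it improves to \<open>d\<close> since \<open>\<theta>(z)\<close> is
  divisible by \<open>z\<close>, so that \<open>x \<theta>(z)\<close> at \<open>z = 1\<close> comes from the form \<open>x \<theta>(z) / z\<close> of degree \<open>d\<close>.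
\<close>

lemma dehomogenize_der_deg:
  assumes h: "homogeneous_derivation d \<theta>" and z: "Z3 dvd \<theta> Z3"
  shows "field_deg_le (dehomogenize_der \<theta>) d"
proof -
  have hom: "homogeneous d (\<theta> X3)" "homogeneous d (\<theta> Y3)" "homogeneous d (\<theta> Z3)"
    using h by (auto simp: homogeneous_derivation_def)
  obtain p where p: "\<theta> Z3 = Z3 * p" using z by (elim dvdE)
  have hp: "homogeneous d (X3 * p)" "homogeneous d (Y3 * p)"
    using homogeneous_exchange_Z3 hom(3) homogeneous_X3 homogeneous_Y3 unfolding p by blast+
  have e: "dehomogenize_der \<theta> = (poly (\<theta> X3) 1 - poly (X3 * p) 1, poly (\<theta> Y3) 1 - poly (Y3 * p) 1)"
    unfolding dehomogenize_der_def p by (simp add: poly_vars_1(4))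
  show ?thesis unfolding e field_deg_le_def fst_conv snd_conv
    using hom hp by (intro conjI tdeg_diff_le tdeg_dehomogenize)
qed

text \<open>
  The statement \<open>deg p \<le> m - d\<close> with integer subtraction, where zero has degree \<open>-\<infinity>\<close>.
\<close>

definition deg_shift_le :: "'k::field poly poly \<Rightarrow> nat \<Rightarrow> nat \<Rightarrow> bool" where
  "deg_shift_le p d m \<longleftrightarrow> p = 0 \<or> tdeg p + d \<le> m"

text \<open>
  The homogenization of \<open>\<zeta>\<close> is a combination of \<open>\<theta>_E\<close>, \<open>\<theta>1\<close> and \<open>\<theta>2\<close>.  Keeping only the components
  of degree \<open>m\<close> makes the coefficients homogeneous of degrees \<open>m - 1\<close>, \<open>m - d\<close> and \<open>m - e\<close>, and
  dehomogenizing removes \<open>\<theta>_E\<close>.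
\<close>

lemma dehomogenized_basis_spans:
  assumes A: "arrangement A"
    and h1: "homogeneous_derivation d \<theta>1" and h2: "homogeneous_derivation e \<theta>2"
    and span: "der.span {euler, \<theta>1, \<theta>2} = log_derivations A"
    and \<zeta>: "\<zeta> \<in> log_fields A" "field_deg_le \<zeta> m"
  obtains p q where "\<zeta> = field_scale p (dehomogenize_der \<theta>1) + field_scale q (dehomogenize_der \<theta>2)"
    "deg_shift_le p d m" "deg_shift_le q e m"
proof -
  obtain f g where fg: "\<zeta> = (f, g)" by (cases \<zeta>)
  let ?F = "homogenize m f" and ?G = "homogenize m g"
  have td: "tdeg f \<le> m" "tdeg g \<le> m" using \<zeta>(2) by (simp_all add: fg field_deg_le_def)
  have "mk_der ?F ?G 0 \<in> der.span {euler, \<theta>1, \<theta>2}"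
    unfolding span using mk_der_log[OF A] \<zeta> fg by blast
  then obtain a where "mk_der ?F ?G 0 - der_scale a euler \<in> der.span {\<theta>1, \<theta>2}"
    using der.span_breakdown_eq by blast
  then obtain b where "mk_der ?F ?G 0 - der_scale a euler - der_scale b \<theta>1 \<in> der.span {\<theta>2}"
    using der.span_breakdown_eq by blast
  then obtain c where "mk_der ?F ?G 0 - der_scale a euler - der_scale b \<theta>1 = der_scale c \<theta>2"
    unfolding der.span_singleton by blast
  then have "mk_der ?F ?G 0 = der_scale a euler + der_scale b \<theta>1 + der_scale c \<theta>2"
    by (simp add: algebra_simps)
  then have v: "mk_der ?F ?G 0 V = a * euler V + b * \<theta>1 V + c * \<theta>2 V" for V
    by (simp add: der_scale_def)
  have hom: "homogeneous d (\<theta>1 X3)" "homogeneous d (\<theta>1 Y3)" "homogeneous d (\<theta>1 Z3)"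
    "homogeneous e (\<theta>2 X3)" "homogeneous e (\<theta>2 Y3)" "homogeneous e (\<theta>2 Z3)"
    using h1 h2 by (auto simp: homogeneous_derivation_def)
  define comp where "comp p k = (if k \<le> m then coeff (grade3 p) (m - k) else 0)" for p :: "'a poly3" and k
  have comp: "coeff (grade3 (p * G)) m = comp p k * G" if "homogeneous k G" for p G k
    unfolding comp_def by (simp add: component_mult_homogeneous[OF that])
  have eu: "euler X3 = X3" "euler Y3 = Y3" "euler Z3 = Z3"
    by (simp_all add: euler_eq_mk_der mk_der_vars)
  have grade_sum: "coeff (grade3 (x + y + z)) m = coeff (grade3 x) m + coeff (grade3 y) m + coeff (grade3 z) m"
    for x y z :: "'a poly3" by (simp add: ring_hom_simps[OF ring_hom_grade3])
  have X: "?F = comp a 1 * X3 + comp b d * \<theta>1 X3 + comp c e * \<theta>2 X3"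
    using arg_cong[OF v[of X3], of "\<lambda>F. coeff (grade3 F) m"]
    unfolding grade_sum comp[OF hom(1)] comp[OF hom(4)] eu comp[OF homogeneous_X3] mk_der_vars
    by (simp add: component_homogeneous[OF homogeneous_homogenize])
  have Y: "?G = comp a 1 * Y3 + comp b d * \<theta>1 Y3 + comp c e * \<theta>2 Y3"
    using arg_cong[OF v[of Y3], of "\<lambda>F. coeff (grade3 F) m"]
    unfolding grade_sum comp[OF hom(2)] comp[OF hom(5)] eu comp[OF homogeneous_Y3] mk_der_vars
    by (simp add: component_homogeneous[OF homogeneous_homogenize])
  have Z: "0 = comp a 1 * Z3 + comp b d * \<theta>1 Z3 + comp c e * \<theta>2 Z3"
    using arg_cong[OF v[of Z3], of "\<lambda>F. coeff (grade3 F) m"]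
    unfolding grade_sum comp[OF hom(3)] comp[OF hom(6)] eu comp[OF homogeneous_Z3] mk_der_vars
    by (simp add: ring_hom_0[OF ring_hom_grade3])
  let ?a = "poly (comp a 1) 1" and ?b = "poly (comp b d) 1" and ?c = "poly (comp c e) 1"
  have X1: "f = ?a * poly X3 1 + ?b * poly (\<theta>1 X3) 1 + ?c * poly (\<theta>2 X3) 1"
    using arg_cong[OF X, of "\<lambda>p. poly p 1"] by (simp only: poly_homogenize[OF td(1)] poly_add poly_mult)
  have Y1: "g = ?a * poly Y3 1 + ?b * poly (\<theta>1 Y3) 1 + ?c * poly (\<theta>2 Y3) 1"
    using arg_cong[OF Y, of "\<lambda>p. poly p 1"] by (simp only: poly_homogenize[OF td(2)] poly_add poly_mult)
  have Z1: "0 = ?a + ?b * poly (\<theta>1 Z3) 1 + ?c * poly (\<theta>2 Z3) 1"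
    using arg_cong[OF Z, of "\<lambda>p. poly p 1"] by (simp only: poly_0 poly_add poly_mult poly_vars_1(4) mult_1_right)
  have elim: "x = b' * (u - w * s) + c' * (v - w * t)"
    if "x = a' * w + b' * u + c' * v" "0 = a' + b' * s + c' * t" for a' b' c' u v w s t x :: "'a poly poly"
  proof -
    have "b' * (u - w * s) + c' * (v - w * t) = a' * w + b' * u + c' * v - w * (a' + b' * s + c' * t)"
      by (simp add: algebra_simps)
    then show ?thesis using that by simp
  qed
  have "\<zeta> = field_scale ?b (dehomogenize_der \<theta>1) + field_scale ?c (dehomogenize_der \<theta>2)"
    unfolding fg prod_eq_iff field_scale_def dehomogenize_der_def fst_add snd_add fst_conv snd_conv
    using elim[OF X1 Z1] elim[OF Y1 Z1] by blast
  moreover have "deg_shift_le (poly (comp p k) 1) k m" for p k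
    using tdeg_dehomogenize[OF homogeneous_component[of "m - k" p]]
    by (auto simp: deg_shift_le_def comp_def)
  ultimately show thesis using that by blast
qed

lemma deg_shift_le_mult:
  "deg_shift_le p a m \<Longrightarrow> deg_shift_le q b n \<Longrightarrow> deg_shift_le (p * q) (a + b) (m + n)"
  by (cases "p = 0"; cases "q = 0") (auto simp: deg_shift_le_def tdeg_mult)

lemma deg_shift_le_diff:
  assumes "deg_shift_le p a m" "deg_shift_le q a m" shows "deg_shift_le (p - q) a m"
proof -
  consider "p = 0" | "q = 0" | "a \<le> m" "tdeg p \<le> m - a" "tdeg q \<le> m - a"
    using assms unfolding deg_shift_le_def by fastforce
  then show ?thesis
  proof cases
    case 3
    then have "tdeg (p - q) \<le> m - a" by (intro tdeg_diff_le)
    then have "tdeg (p - q) + a \<le> m" using 3(1) by linarith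
    then show ?thesis by (simp add: deg_shift_le_def)
  qed (use assms in \<open>auto simp: deg_shift_le_def\<close>)
qed

text \<open>
  Every form can be cancelled in turn: on its line \<open>e\<close> is nonzero, so the form divides the cofactor of
  \<open>e\<close>.
\<close>

lemma unit_if_coprime_to_lines:
  assumes "finite C" "\<And>H. H \<in> C \<Longrightarrow> is_line H" "\<And>H. H \<in> C \<Longrightarrow> restr H e \<noteq> 0" "e dvd defining_poly C"
  shows "e dvd 1"
  using assms
proof (induction C rule: finite_induct)
  case (insert H C)
  obtain u where u: "alpha H * defining_poly C = e * u"
    using insert.prems(3) insert(1,2) by (auto simp: defining_poly_insert elim: dvdE)
  have l: "is_line H" using insert.prems by simp
  have "restr H e * restr H u = 0"
    using arg_cong[OF u, of "restr H"] restr_alpha_self[OF l] by (simp add: restr_simps)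
  then have "restr H u = 0" using insert.prems(2)[of H] by simp
  then have "alpha H dvd u" by (simp add: restr_eq_0_iff[OF l])
  then obtain w where "u = alpha H * w" by (elim dvdE)
  then have "alpha H * defining_poly C = alpha H * (e * w)" using u by (simp add: ac_simps)
  then have "defining_poly C = e * w" using alpha_nonzero[OF l] by simp
  then show ?case using insert by simp
qed (simp add: defining_poly_def)

lemma det2_tangent_coordinate:
  "det2 (tangent_field A H) (field_scale (defining_poly A) (K2 s, K2 t)) =
     defining_poly (A - {H}) * defining_poly A * K2 (la H * s + lb H * t)"
proof -
  have "K2 (la H * s + lb H * t) = K2 (lb H) * K2 t - K2 (- la H) * K2 s" by simp
  then show ?thesis
    unfolding det2_def tangent_field_def field_scale_def fst_conv snd_conv
    by (simp only: right_diff_distrib ac_simps)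
qed

lemma det2_combination:
  "det2 (field_scale p \<theta> + field_scale q \<eta>) (field_scale p' \<theta> + field_scale q' \<eta>) =
     (p * q' - q * p') * det2 \<theta> \<eta>"
  by (simp add: det2_def field_scale_def algebra_simps)

text \<open>
  A generating pair satisfies Saito's criterion.  Write its determinant as \<open>Q \<epsilon>\<close>.  If \<open>u\<close> and \<open>v\<close> are
  logarithmic with determinant \<open>P Q\<close>, expressing them by the generators shows that \<open>\<epsilon>\<close> divides \<open>P\<close>.
  A tangent field of \<open>H\<close> together with \<open>Q\<close> times a constant field transversal to \<open>H\<close> realizes
  \<open>P = Q / \<alpha>_H\<close>.  Since this works for every \<open>H\<close>, \<open>\<epsilon>\<close> is a unit; for the empty arrangement the
  two coordinate fields play the part of \<open>u\<close> and \<open>v\<close>.  The test fields of \<open>H\<close> have degrees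
  \<open>|A| - 1\<close> and \<open>|A|\<close>, as small as the degree of their determinant allows; therefore the degree
  bounds in \<open>span\<close> yield \<open>d + e \<le> |A|\<close>, and the determinant of the generators yields the opposite
  inequality.
\<close>

lemma affine_free_basisI:
  assumes A: "arrangement A"
    and log: "\<theta> \<in> log_fields A" "\<eta> \<in> log_fields A"
    and deg: "field_deg_le \<theta> d" "field_deg_le \<eta> e"
    and span: "\<And>\<zeta> m. \<zeta> \<in> log_fields A \<Longrightarrow> field_deg_le \<zeta> m \<Longrightarrow>
      \<exists>p q. \<zeta> = field_scale p \<theta> + field_scale q \<eta> \<and> deg_shift_le p d m \<and> deg_shift_le q e m"
  shows "affine_free_basis A d e \<theta> \<eta>"
proof -
  have fin: "finite A" and lines: "\<And>H. H \<in> A \<Longrightarrow> is_line H" using A by (auto simp: arrangement_iff)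
  let ?Q = "defining_poly A"
  have Q0: "?Q \<noteq> 0" using lines by (rule defining_poly_nonzero)
  have "?Q dvd det2 \<theta> \<eta>"
    using log lines fin by (intro defining_poly_dvd alpha_dvd_det2) (auto simp: log_fields_def)
  then obtain \<epsilon> where \<epsilon>: "det2 \<theta> \<eta> = ?Q * \<epsilon>" by (elim dvdE)
  have test: "\<exists>M. P = \<epsilon> * M \<and> deg_shift_le M (d + e) (m + n)"
    if uv: "u \<in> log_fields A" "v \<in> log_fields A" "field_deg_le u m" "field_deg_le v n"
      and P: "det2 u v = P * ?Q" for u v P m n
  proof -
    obtain p q where pq: "u = field_scale p \<theta> + field_scale q \<eta>" "deg_shift_le p d m" "deg_shift_le q e m"
      using span[OF uv(1,3)] by blast
    obtain p' q' where pq': "v = field_scale p' \<theta> + field_scale q' \<eta>" "deg_shift_le p' d n" "deg_shift_le q' e n"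
      using span[OF uv(2,4)] by blast
    let ?M = "p * q' - q * p'"
    have "?Q * P = ?Q * (\<epsilon> * ?M)"
      using P unfolding pq(1) pq'(1) det2_combination \<epsilon> by (simp only: ac_simps)
    then have "P = \<epsilon> * ?M" using Q0 by simp
    moreover have "deg_shift_le ?M (d + e) (m + n)"
      using deg_shift_le_mult[OF pq(2) pq'(3)] deg_shift_le_mult[OF pq(3) pq'(2)]
      by (intro deg_shift_le_diff) (simp_all add: add.commute)
    ultimately show ?thesis by blast
  qed
  have "\<exists>P M. \<epsilon> dvd 1 \<and> P \<noteq> 0 \<and> P = \<epsilon> * M \<and> deg_shift_le M (d + e) (tdeg P + card A)"
  proof (cases "A = {}")
    case True
    have "\<exists>M. 1 = \<epsilon> * M \<and> deg_shift_le M (d + e) (0 + 0)"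
      by (rule test[of "(1, 0)" "(0, 1)"])
         (simp_all add: True log_fields_def field_deg_le_def det2_def defining_poly_def)
    then obtain M where M: "1 = \<epsilon> * M" "deg_shift_le M (d + e) 0" by auto
    then have "\<epsilon> dvd 1" by (metis dvd_triv_left)
    then show ?thesis using M True by (intro exI[of _ 1] exI[of _ M]) simp
  next
    case False
    have T: "\<exists>M. defining_poly (A - {H}) = \<epsilon> * M \<and> deg_shift_le M (d + e) (card A - 1 + card A)"
      if H: "H \<in> A" for H
    proof -
      obtain s t where st: "la H * s + lb H * t = 1" using unit_normal[OF lines[OF H]] .
      have "det2 (tangent_field A H) (field_scale ?Q (K2 s, K2 t)) = defining_poly (A - {H}) * ?Q"
        unfolding det2_tangent_coordinate st by (simp only: one_pCons[symmetric] mult_1_right)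
      then show ?thesis
        using test[OF tangent_field_log(1)[OF A H] coordinate_field_log(1)[OF A]
          tangent_field_log(2)[OF A H] coordinate_field_log(2)[OF A]] by blast
    qed
    have nz: "restr H \<epsilon> \<noteq> 0" if H: "H \<in> A" for H
    proof -
      have "restr H (defining_poly (A - {H})) \<noteq> 0"
        using lines H by (intro restr_defining_poly_nonzero) auto
      then show ?thesis using T[OF H] by (auto simp: restr_simps)
    qed
    obtain H where H: "H \<in> A" using False by blast
    obtain M where M: "defining_poly (A - {H}) = \<epsilon> * M" "deg_shift_le M (d + e) (card A - 1 + card A)"
      using T[OF H] by blast
    have "\<epsilon> dvd defining_poly (A - {H})" unfolding M(1) by simp
    also have "\<dots> dvd ?Q"
      unfolding defining_poly_def using fin by (intro prod_dvd_prod_subset) auto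
    finally have "\<epsilon> dvd 1" using unit_if_coprime_to_lines[OF fin lines nz] by blast
    moreover have "tdeg (defining_poly (A - {H})) = card A - 1"
      using tdeg_defining_poly[of "A - {H}"] lines fin H by simp
    moreover have "defining_poly (A - {H}) \<noteq> 0" using lines by (intro defining_poly_nonzero) blast
    ultimately show ?thesis using M by (intro exI[of _ "defining_poly (A - {H})"] exI[of _ M]) simp
  qed
  then obtain P M where PM: "\<epsilon> dvd 1" "P \<noteq> 0" "P = \<epsilon> * M" "deg_shift_le M (d + e) (tdeg P + card A)"
    by blast
  obtain w where w: "1 = \<epsilon> * w" using PM(1) by (elim dvdE)
  have ne: "\<epsilon> \<noteq> 0" "M \<noteq> 0" "w \<noteq> 0" using PM(2,3) w by auto
  have \<epsilon>0: "tdeg \<epsilon> = 0" using arg_cong[OF w, of tdeg] tdeg_mult[OF ne(1,3)] by simp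
  have "tdeg P = tdeg M" using tdeg_mult[OF ne(1,2)] \<epsilon>0 unfolding PM(3) by simp
  then have le: "d + e \<le> card A" using PM(4) ne(2) by (simp add: deg_shift_le_def)
  have "tdeg (det2 \<theta> \<eta>) = card A"
    unfolding \<epsilon> using tdeg_mult[OF Q0 ne(1)] \<epsilon>0 tdeg_defining_poly[OF fin lines] by simp
  moreover have "tdeg (det2 \<theta> \<eta>) \<le> d + e"
    unfolding det2_def using deg by (intro tdeg_diff_le tdeg_mult_le) (auto simp: field_deg_le_def)
  ultimately have de: "d + e = card A" using le by simp
  obtain c where c: "\<epsilon> = K2 c" using tdeg_eq_0_const[OF \<epsilon>0] .
  then have "c \<noteq> 0" using ne(1) by auto
  moreover have "det2 \<theta> \<eta> = K2 c * ?Q" using \<epsilon> unfolding c by (simp only: mult.commute)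
  ultimately show ?thesis unfolding affine_free_basis_def using log deg de by blast
qed

lemma free_imp_affine_free:
  assumes A: "arrangement A" and f: "free_with_exponents A d e"
  shows "affine_free A d e"
proof -
  obtain \<theta>1 \<theta>2 where h: "homogeneous_derivation d \<theta>1" "homogeneous_derivation e \<theta>2"
    and span: "der.span {euler, \<theta>1, \<theta>2} = log_derivations A"
    using f unfolding free_with_exponents_def by blast
  have l: "\<theta>1 \<in> log_derivations A" "\<theta>2 \<in> log_derivations A"
    unfolding span[symmetric] by (auto intro: der.span_base)
  then have z: "Z3 dvd \<theta>1 Z3" "Z3 dvd \<theta>2 Z3" by (simp_all add: log_derivations_iff[OF A])
  have "affine_free_basis A d e (dehomogenize_der \<theta>1) (dehomogenize_der \<theta>2)"
  proof (rule affine_free_basisI[OF A dehomogenize_der_log[OF A l(1)] dehomogenize_der_log[OF A l(2)]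
      dehomogenize_der_deg[OF h(1) z(1)] dehomogenize_der_deg[OF h(2) z(2)]])
    fix \<zeta> m assume \<zeta>: "\<zeta> \<in> log_fields A" "field_deg_le \<zeta> m"
    show "\<exists>p q. \<zeta> = field_scale p (dehomogenize_der \<theta>1) + field_scale q (dehomogenize_der \<theta>2) \<and>
        deg_shift_le p d m \<and> deg_shift_le q e m"
      using dehomogenized_basis_spans[OF A h span \<zeta>] by blast
  qed
  then show ?thesis unfolding affine_free_def by blast
qed

section \<open>Homogenizing a free basis\<close>

lemma subspace_log_derivations:
  assumes A: "arrangement A" shows "der.subspace (log_derivations A)"
  unfolding der.subspace_def
proof (intro conjI ballI allI)
  have z: "derivation (0 :: 'a poly3 \<Rightarrow> _)" by (simp add: derivation_def)
  show "0 \<in> log_derivations A" unfolding log_derivations_iff[OF A] using z by simp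
next
  fix \<theta> \<eta> assume "\<theta> \<in> log_derivations A" "\<eta> \<in> log_derivations A"
  then show "\<theta> + \<eta> \<in> log_derivations A"
    unfolding log_derivations_iff[OF A] using derivation_combination(2)[of \<theta> \<eta>] by simp
next
  fix p \<theta> assume "\<theta> \<in> log_derivations A"
  then show "der_scale p \<theta> \<in> log_derivations A"
    unfolding log_derivations_iff[OF A] using derivation_combination(1)[of \<theta> p]
    by (simp add: der_scale_def)
qed

lemma euler_log:
  assumes A: "arrangement A" shows "euler \<in> log_derivations A"
proof -
  have "euler (form3 H) = form3 H" for H :: "('a ^ 2) set"
    by (simp only: euler_eq_mk_der derivation_form3[OF derivation_mk_der] mk_der_vars)
       (simp only: form3_def)
  then show ?thesis unfolding log_derivations_iff[OF A] euler_eq_mk_der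
    by (simp add: derivation_mk_der mk_der_vars)
qed

definition cone_poly :: "('k::field ^ 2) set set \<Rightarrow> 'k poly3" where
  "cone_poly A = (\<Prod>H\<in>A. form3 H)"

lemma poly_cone_poly: "poly (cone_poly A) 1 = defining_poly A"
  by (simp add: cone_poly_def defining_poly_def poly_prod poly_form3)

lemma homogeneous_cone_poly: "finite A \<Longrightarrow> homogeneous (card A) (cone_poly A)"
proof (induction A rule: finite_induct)
  case empty
  show ?case using homogeneous_Const3[of 1] by (simp add: cone_poly_def Const3_1)
next
  case (insert H A)
  then show ?case
    using homogeneous_mult[OF homogeneous_form3[of H] insert.IH] by (simp add: cone_poly_def)
qed

text \<open>
  The polynomial \<open>D\<close> need not be homogeneous, but the forms are, so they divide each homogeneous
  component, for which the affine statement applies.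
\<close>

lemma cone_poly_dvd:
  assumes A: "arrangement A" and d: "\<And>H. H \<in> A \<Longrightarrow> form3 H dvd D"
  shows "cone_poly A dvd D"
proof -
  have fin: "finite A" and lines: "\<And>H. H \<in> A \<Longrightarrow> is_line H" using A by (auto simp: arrangement_iff)
  have comp: "cone_poly A dvd coeff (grade3 D) m" for m
  proof (rule homogeneous_dvdI[OF homogeneous_cone_poly[OF fin] _ homogeneous_component])
    show "tdeg (poly (cone_poly A) 1) = card A"
      unfolding poly_cone_poly using fin lines by (rule tdeg_defining_poly)
    have "alpha H dvd poly (coeff (grade3 D) m) 1" if H: "H \<in> A" for H
    proof -
      obtain s where s: "D = s * form3 H" using d[OF H] by (metis dvdE mult.commute)
      have "form3 H dvd coeff (grade3 D) m"
        unfolding s component_mult_homogeneous[OF homogeneous_form3] by simp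
      then show ?thesis using ring_hom_dvd[OF ring_hom_poly[of 1]] poly_form3 by metis
    qed
    then show "poly (cone_poly A) 1 dvd poly (coeff (grade3 D) m) 1"
      unfolding poly_cone_poly using fin lines by (intro defining_poly_dvd)
  qed
  have "D = (\<Sum>m\<le>degree (grade3 D). coeff (grade3 D) m)"
    using poly_1_eq_sum[of "grade3 D"] by simp
  moreover have "cone_poly A dvd (\<Sum>m\<le>degree (grade3 D). coeff (grade3 D) m)"
    using comp by (intro dvd_sum)
  ultimately show ?thesis by simp
qed

lemma form3_dvd_det:
  assumes H: "is_line H"
    and 1: "form3 H dvd Const3 (la H) * F + Const3 (lb H) * G"
    and 2: "form3 H dvd Const3 (la H) * F' + Const3 (lb H) * G'"
  shows "form3 H dvd F * G' - G * F'"
proof -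
  have e: "Const3 (la H) * (F * G' - G * F') = (Const3 (la H) * F + Const3 (lb H) * G) * G'
      - (Const3 (la H) * F' + Const3 (lb H) * G') * G"
    "Const3 (lb H) * (F * G' - G * F') = (Const3 (la H) * F' + Const3 (lb H) * G') * F
      - (Const3 (la H) * F + Const3 (lb H) * G) * F'"
    by (simp_all add: algebra_simps)
  have "form3 H dvd Const3 (la H) * (F * G' - G * F')" "form3 H dvd Const3 (lb H) * (F * G' - G * F')"
    unfolding e using 1 2 by (auto intro!: dvd_diff dvd_mult2)
  then show ?thesis using line_coeffs(1)[OF H] Const3_dvd_cancel by blast
qed

text \<open>
  The homogenized fields annihilate \<open>z\<close>, and the determinant of their remaining coefficients is a constant
  times the product of the forms.  After subtracting a multiple of \<open>\<theta>_E\<close>, a logarithmic derivation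
  annihilates \<open>z\<close> as well, and Cramer's rule expresses it by the two fields.
\<close>

lemma affine_free_imp_free:
  assumes A: "arrangement A" and f: "affine_free A d e"
  shows "free_with_exponents A d e"
proof -
  have fin: "finite A" and lines: "\<And>H. H \<in> A \<Longrightarrow> is_line H" using A by (auto simp: arrangement_iff)
  obtain f1 g1 f2 g2 where b: "affine_free_basis A d e (f1, g1) (f2, g2)"
    using f unfolding affine_free_def by fast
  obtain c where c: "c \<noteq> 0" "det2 (f1, g1) (f2, g2) = K2 c * defining_poly A" and de: "d + e = card A"
    using b by (auto simp: affine_free_basis_def)
  have l: "(f1, g1) \<in> log_fields A" "(f2, g2) \<in> log_fields A"
    and dg: "field_deg_le (f1, g1) d" "field_deg_le (f2, g2) e"
    using b by (auto simp: affine_free_basis_def)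
  define F1 G1 F2 G2 where "F1 = homogenize d f1" and "G1 = homogenize d g1"
    and "F2 = homogenize e f2" and "G2 = homogenize e g2"
  let ?\<theta>1 = "mk_der F1 G1 0" and ?\<theta>2 = "mk_der F2 G2 0"
  have l1: "?\<theta>1 \<in> log_derivations A" and l2: "?\<theta>2 \<in> log_derivations A"
    unfolding F1_def G1_def F2_def G2_def using mk_der_log[OF A] l dg by blast+
  have hom: "homogeneous d F1" "homogeneous d G1" "homogeneous e F2" "homogeneous e G2"
    by (simp_all add: F1_def G1_def F2_def G2_def homogeneous_homogenize)
  have p1: "poly F1 1 = f1" "poly G1 1 = g1" "poly F2 1 = f2" "poly G2 1 = g2"
    using dg by (simp_all add: F1_def G1_def F2_def G2_def field_deg_le_def poly_homogenize)
  let ?\<Delta> = "F1 * G2 - G1 * F2"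
  have \<Delta>: "?\<Delta> = Const3 c * cone_poly A"
  proof (rule homogeneous_eqI)
    show "homogeneous (card A) ?\<Delta>"
      unfolding de[symmetric] using hom by (intro homogeneous_diff homogeneous_mult)
    show "homogeneous (card A) (Const3 c * cone_poly A)"
      by (intro homogeneous_Const3_mult homogeneous_cone_poly fin)
    show "poly ?\<Delta> 1 = poly (Const3 c * cone_poly A) 1"
      using c(2) by (simp only: poly_diff poly_mult p1 poly_vars_1 poly_cone_poly det2_def fst_conv snd_conv)
  qed
  have "poly ?\<Delta> 1 \<noteq> 0"
    using affine_free_basis_det_nonzero[OF A b] by (simp add: p1 det2_def)
  then have \<Delta>0: "?\<Delta> \<noteq> 0" by (metis poly_0)
  have Z0: "Z3 \<noteq> (0 :: 'a poly3)" by (simp add: Z3_def)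
  have ind: "p = 0 \<and> q = 0 \<and> r = 0"
    if z: "der_scale p euler + der_scale q ?\<theta>1 + der_scale r ?\<theta>2 = 0" for p q r
  proof -
    have e: "p * euler V + q * ?\<theta>1 V + r * ?\<theta>2 V = 0" for V
      using fun_cong[OF z, of V] by (simp add: der_scale_def)
    have p: "p = 0" using e[of Z3] Z0 by (simp add: euler_eq_mk_der mk_der_vars)
    have FG: "q * F1 + r * F2 = 0" "q * G1 + r * G2 = 0"
      using e[of X3] e[of Y3] p by (simp_all add: mk_der_vars)
    have "q * ?\<Delta> = (q * F1 + r * F2) * G2 - (q * G1 + r * G2) * F2"
      "r * ?\<Delta> = (q * G1 + r * G2) * F1 - (q * F1 + r * F2) * G1"
      by (simp_all add: algebra_simps)
    then have "q * ?\<Delta> = 0" "r * ?\<Delta> = 0" unfolding FG by simp_all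
    then show ?thesis using p \<Delta>0 by simp
  qed
  have dist: "distinct [euler, ?\<theta>1, ?\<theta>2]"
  proof -
    have "euler \<noteq> ?\<theta>1" using ind[of 1 "- 1" 0] by (auto simp: der_scale_def fun_eq_iff)
    moreover have "euler \<noteq> ?\<theta>2" using ind[of 1 0 "- 1"] by (auto simp: der_scale_def fun_eq_iff)
    moreover have "?\<theta>1 \<noteq> ?\<theta>2" using ind[of 0 1 "- 1"] by (auto simp: der_scale_def fun_eq_iff)
    ultimately show ?thesis by simp
  qed
  have indep: "der.independent {euler, ?\<theta>1, ?\<theta>2}"
  proof
    assume "der.dependent {euler, ?\<theta>1, ?\<theta>2}"
    then obtain u where u: "\<exists>v\<in>{euler, ?\<theta>1, ?\<theta>2}. u v \<noteq> 0"
      "(\<Sum>v\<in>{euler, ?\<theta>1, ?\<theta>2}. der_scale (u v) v) = 0"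
      using der.dependent_finite[of "{euler, ?\<theta>1, ?\<theta>2}"] by auto
    have "der_scale (u euler) euler + der_scale (u ?\<theta>1) ?\<theta>1 + der_scale (u ?\<theta>2) ?\<theta>2 = 0"
      using u(2) dist by (simp add: add.assoc)
    then show False using ind u(1) by blast
  qed
  have "der.span {euler, ?\<theta>1, ?\<theta>2} = log_derivations A"
  proof (intro subset_antisym subsetI)
    fix \<theta> assume "\<theta> \<in> der.span {euler, ?\<theta>1, ?\<theta>2}"
    then show "\<theta> \<in> log_derivations A"
      using der.span_minimal[OF _ subspace_log_derivations[OF A], of "{euler, ?\<theta>1, ?\<theta>2}"]
        euler_log[OF A] l1 l2 by blast
  next
    fix \<theta> assume "\<theta> \<in> log_derivations A"
    then have \<theta>: "derivation \<theta>" "Z3 dvd \<theta> Z3" "\<And>H. H \<in> A \<Longrightarrow> form3 H dvd \<theta> (form3 H)"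
      unfolding log_derivations_iff[OF A] by blast+
    obtain p where p: "\<theta> Z3 = Z3 * p" using \<theta>(2) by (elim dvdE)
    define F G where "F = \<theta> X3 - p * X3" and "G = \<theta> Y3 - p * Y3"
    have FG: "form3 H dvd Const3 (la H) * F + Const3 (lb H) * G" if H: "H \<in> A" for H
    proof -
      have "Const3 (la H) * F + Const3 (lb H) * G = \<theta> (form3 H) - p * form3 H"
        unfolding derivation_form3[OF \<theta>(1)] p F_def G_def by (simp add: form3_def algebra_simps)
      then show ?thesis using \<theta>(3)[OF H] by simp
    qed
    have basis: "form3 H dvd Const3 (la H) * F1 + Const3 (lb H) * G1"
      "form3 H dvd Const3 (la H) * F2 + Const3 (lb H) * G2" if H: "H \<in> A" for H
    proof -
      have "form3 H dvd ?\<theta>1 (form3 H)" "form3 H dvd ?\<theta>2 (form3 H)"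
        using l1 l2 H unfolding log_derivations_iff[OF A] by blast+
      then show "form3 H dvd Const3 (la H) * F1 + Const3 (lb H) * G1"
        "form3 H dvd Const3 (la H) * F2 + Const3 (lb H) * G2"
        by (simp_all add: derivation_form3[OF derivation_mk_der] mk_der_vars)
    qed
    have "cone_poly A dvd F * G2 - G * F2" "cone_poly A dvd F1 * G - G1 * F"
      using FG basis lines by (intro cone_poly_dvd[OF A] form3_dvd_det; blast)+
    then have "?\<Delta> dvd F * G2 - G * F2" "?\<Delta> dvd F1 * G - G1 * F"
    proof -
      have "cone_poly A = Const3 (1 / c) * ?\<Delta>"
        unfolding \<Delta> using c(1) by (simp add: mult.assoc[symmetric] Const3_mult Const3_1)
      then have "?\<Delta> dvd cone_poly A" by (metis dvd_triv_right)
      then show "cone_poly A dvd F * G2 - G * F2 \<Longrightarrow> cone_poly A dvd F1 * G - G1 * F \<Longrightarrow> ?\<Delta> dvd F * G2 - G * F2"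
        "cone_poly A dvd F * G2 - G * F2 \<Longrightarrow> cone_poly A dvd F1 * G - G1 * F \<Longrightarrow> ?\<Delta> dvd F1 * G - G1 * F"
        by (auto intro: dvd_trans)
    qed
    then obtain q r where q: "F * G2 - G * F2 = ?\<Delta> * q" and r: "F1 * G - G1 * F = ?\<Delta> * r"
      by (elim dvdE)
    have "?\<Delta> * F = ?\<Delta> * (q * F1 + r * F2)"
    proof -
      have "?\<Delta> * F = (F * G2 - G * F2) * F1 + (F1 * G - G1 * F) * F2" by (simp add: algebra_simps)
      then show ?thesis unfolding q r by (simp only: distrib_left mult.assoc)
    qed
    then have F: "F = q * F1 + r * F2" using mult_left_cancel[OF \<Delta>0] by blast
    have "?\<Delta> * G = ?\<Delta> * (q * G1 + r * G2)"
    proof -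
      have "?\<Delta> * G = (F * G2 - G * F2) * G1 + (F1 * G - G1 * F) * G2" by (simp add: algebra_simps)
      then show ?thesis unfolding q r by (simp only: distrib_left mult.assoc)
    qed
    then have G: "G = q * G1 + r * G2" using mult_left_cancel[OF \<Delta>0] by blast
    have "\<theta> = der_scale p euler + der_scale q ?\<theta>1 + der_scale r ?\<theta>2"
    proof (rule derivation_eqI[OF \<theta>(1)])
      show "derivation (der_scale p euler + der_scale q ?\<theta>1 + der_scale r ?\<theta>2)"
        unfolding euler_eq_mk_der by (intro derivation_combination derivation_mk_der)
      show "\<theta> X3 = (der_scale p euler + der_scale q ?\<theta>1 + der_scale r ?\<theta>2) X3"
        using F by (simp add: der_scale_def euler_eq_mk_der mk_der_vars F_def algebra_simps)
      show "\<theta> Y3 = (der_scale p euler + der_scale q ?\<theta>1 + der_scale r ?\<theta>2) Y3"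
        using G by (simp add: der_scale_def euler_eq_mk_der mk_der_vars G_def algebra_simps)
      show "\<theta> Z3 = (der_scale p euler + der_scale q ?\<theta>1 + der_scale r ?\<theta>2) Z3"
        by (simp add: der_scale_def euler_eq_mk_der mk_der_vars p)
    qed
    then show "\<theta> \<in> der.span {euler, ?\<theta>1, ?\<theta>2}"
      by (simp add: der.span_add der.span_scale der.span_base)
  qed
  moreover have "homogeneous_derivation d ?\<theta>1" "homogeneous_derivation e ?\<theta>2"
    using hom by (simp_all add: homogeneous_derivation_def derivation_mk_der mk_der_vars homogeneous_0)
  ultimately show ?thesis unfolding free_with_exponents_def using dist indep by blast
qed

section \<open>Freeness from a free subarrangement\<close>

lemma exists_maximal_subarrangement:
  assumes "finite A" "B \<subseteq> A" "P B"
  shows "\<exists>C. B \<subseteq> C \<and> C \<subseteq> A \<and> P C \<and> (\<forall>H\<in>A - C. \<not> P (insert H C))"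
proof -
  define S where "S = {C. B \<subseteq> C \<and> C \<subseteq> A \<and> P C}"
  have "S \<subseteq> Pow A" unfolding S_def by blast
  then have "finite S" using assms(1) by (rule finite_subset[OF _ iffD2[OF finite_Pow_iff]])
  moreover have "B \<in> S" using assms unfolding S_def by simp
  ultimately obtain C where C: "C \<in> S" and max: "\<forall>D\<in>S. C \<le> D \<longrightarrow> C = D"
    by (metis finite_has_maximal2)
  have CS: "B \<subseteq> C" "C \<subseteq> A" "P C" using C unfolding S_def by simp_all
  have "\<not> P (insert H C)" if H: "H \<in> A - C" for H
  proof
    assume "P (insert H C)"
    then have "insert H C \<in> S" using CS H unfolding S_def by auto
    then have "C = insert H C" using max by (metis subset_insertI)
    then show False using H by (metis DiffD2 insertI1)
  qed
  then show ?thesis using CS by blast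
qed

text \<open>
  With a fixed sum, a product grows as its factors move closer together.
\<close>

lemma product_le_closer_product:
  fixes n r j :: int
  assumes "0 \<le> j" "j \<le> r"
  shows "n * (n + r) \<le> (n + j) * (n + r - j)"
proof -
  have "(n + j) * (n + r - j) = n * (n + r) + j * (r - j)" by (simp add: algebra_simps)
  then show ?thesis using assms by simp
qed

theorem free_subarrangement_imp_free:
  assumes hyp: "has_free_subarrangement_condition A n r B s"
  shows "free_arrangement A"
proof -
  have A: "arrangement A" and cA: "card A = 2 * n + r"
    and chi: "char_poly A = [:- int n, 1:] * [:- int n - int r, 1:]"
    and BA: "B \<subseteq> A" and s: "1 \<le> s"
    and no: "\<And>C u. B \<subseteq> C \<Longrightarrow> C \<subseteq> A \<Longrightarrow> u > int r + 1 \<Longrightarrow>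
        char_poly C \<noteq> [:- int n - u + 1, 1:] * [:- int n + s, 1:]"
    using hyp unfolding has_free_subarrangement_condition_def by blast+
  obtain d e where de: "int d = int n - s" "int e = int n - 1" and fB: "free_with_exponents B d e"
    using hyp unfolding has_free_subarrangement_condition_def by blast
  have fin: "finite A" using A by (rule arrangement_finite)
  have sub: "arrangement C" if "C \<subseteq> A" for C using A that by (rule arrangement_subset)
  have lines: "is_line H" if "H \<in> A" for H using A that by (rule arrangement_line)
  have free: "free_arrangement A" if "affine_free A a b" for a b
    using affine_free_imp_free[OF A that] unfolding free_arrangement_def by blast
  have ne: "n = Suc e" using de by simp
  have b2A: "b2 A = n * (n + r)"
  proof -
    have "int (b2 A) = int n * (int n + int r)"
      using chi unfolding char_poly_eq[OF A] by (simp add: algebra_simps)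
    then show ?thesis by (metis of_nat_add of_nat_eq_iff of_nat_mult)
  qed
  have aB: "affine_free B d e" by (rule free_imp_affine_free[OF sub[OF BA] fB])
  have cardB: "card B = d + e" by (rule b2_affine_free(1)[OF sub[OF BA] aB])
  have cdiff: "int (card (A - C)) = int (card A) - int (card C)" if "C \<subseteq> A" for C
  proof -
    have "card (A - C) = card A - card C" "card C \<le> card A"
      using that fin finite_subset by (auto intro: card_Diff_subset card_mono)
    then show ?thesis by simp
  qed

  \<comment> \<open>let the second exponent grow as far as possible\<close>
  obtain C where C: "B \<subseteq> C" "C \<subseteq> A" and PC: "\<exists>k. affine_free C d (e + k)"
    and maxC: "\<forall>H\<in>A - C. \<not> (\<exists>k. affine_free (insert H C) d (e + k))"
  proof -
    have "\<exists>k. affine_free B d (e + k)" using aB by (intro exI[of _ 0]) simp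
    from exists_maximal_subarrangement[where P = "\<lambda>C. \<exists>k. affine_free C d (e + k)", OF fin BA this]
    show thesis using that by blast
  qed
  obtain k where k: "affine_free C d (e + k)" using PC by blast
  have cardC: "card C = d + (e + k)" and b2C: "b2 C = d * (e + k)"
    using b2_affine_free[OF sub[OF C(2)] k] by auto
  have meetsC: "e + k \<le> meets C H" if H: "H \<in> A - C" for H
  proof (rule ccontr)
    assume "\<not> e + k \<le> meets C H"
    then have "affine_free (insert H C) d (Suc (e + k))"
      using H lines by (intro affine_free_add_small[OF sub[OF C(2)] _ _ k]) auto
    then have "affine_free (insert H C) d (e + Suc k)" by simp
    then show False using maxC H by blast
  qed
  have k_le: "int k \<le> int r + 1"
  proof (rule ccontr)
    assume "\<not> int k \<le> int r + 1"
    then have "char_poly C \<noteq> [:- int n - int k + 1, 1:] * [:- int n + s, 1:]" using no[OF C] by simp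
    moreover have "char_poly C = [:- int (e + k), 1:] * [:- int d, 1:]"
      unfolding char_poly_eq[OF sub[OF C(2)]] cardC b2C by (simp add: algebra_simps)
    moreover have "- int (e + k) = - int n - int k + 1" "- int d = - int n + s" using de by simp_all
    ultimately show False by simp
  qed
  show ?thesis
  proof (cases "k = 0")
    case False
    \<comment> \<open>the second exponent is \<open>n + j\<close>, and \<open>0 \<le> j \<le> r\<close> is what the squeeze requires\<close>
    define j where "j = int k - 1"
    have j: "0 \<le> j" "j \<le> int r" using False k_le by (auto simp: j_def)
    have ek: "int (e + k) = int n + j" using de by (simp add: j_def)
    have dc: "int (d + card (A - C)) = int n + int r - j"
      using cdiff[OF C(2)] cardC cA de by (simp add: j_def)
    have "int (b2 A) = int n * (int n + int r)" by (simp add: b2A)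
    also have "\<dots> \<le> (int n + j) * (int n + int r - j)" using j by (rule product_le_closer_product)
    also have "\<dots> = int ((e + k) * (d + card (A - C)))" unfolding of_nat_mult ek dc ..
    finally have "b2 A \<le> (e + k) * (d + card (A - C))" by (simp only: of_nat_le_iff)
    then show ?thesis using affine_free_of_tight_b2[OF A C(2) k meetsC] free by blast
  next
    case True
    have BC: "B = C"
      using card_subset_eq[OF finite_subset[OF C(2) fin] C(1)] cardB cardC True by simp
    have meetsB: "e \<le> meets B H" if "H \<in> A - B" for H
      using meetsC[of H] that True BC by simp
    \<comment> \<open>the second exponent is stuck at \<open>n - 1\<close>, so let the first one grow\<close>
    obtain D where D: "B \<subseteq> D" "D \<subseteq> A" and PD: "\<exists>i. affine_free D (d + i) e"
      and maxD: "\<forall>H\<in>A - D. \<not> (\<exists>i. affine_free (insert H D) (d + i) e)"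
    proof -
      have "\<exists>i. affine_free B (d + i) e" using aB by (intro exI[of _ 0]) simp
      from exists_maximal_subarrangement[where P = "\<lambda>D. \<exists>i. affine_free D (d + i) e", OF fin BA this]
      show thesis using that by blast
    qed
    obtain i where i: "affine_free D (d + i) e" using PD by blast
    have cardD: "card D = d + i + e" and b2D: "b2 D = (d + i) * e"
      using b2_affine_free[OF sub[OF D(2)] i] by auto
    have noD: "\<not> affine_free (insert H D) (Suc (d + i)) e" if "H \<in> A - D" for H
      using maxD that by (metis add_Suc_right)
    have meetsD: "n \<le> meets D H" if H: "H \<in> A - D" for H
    proof -
      have l: "is_line H" "H \<notin> D" using H lines by auto
      have "e \<le> meets B H" using meetsB H D(1) by blast
      also have "\<dots> \<le> meets D H" using l D by (intro meets_mono sub)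
      finally have "e \<le> meets D H" .
      moreover have "meets D H \<noteq> e"
        using affine_free_add[OF sub[OF D(2)] l i] noD[OF H] by blast
      ultimately show ?thesis using ne by simp
    qed
    have meetsD': "d + i \<le> meets D H" if H: "H \<in> A - D" for H
    proof (rule ccontr)
      assume lt: "\<not> d + i \<le> meets D H"
      have l: "is_line H" "H \<notin> D" using H lines by auto
      have "affine_free (insert H D) e (Suc (d + i))"
        using lt by (intro affine_free_add_small[OF sub[OF D(2)] l affine_free_swap[OF i]]) simp
      then show False using affine_free_swap noD[OF H] by blast
    qed
    have dD: "int (card (A - D)) = int r + 1 + s - int i"
      using cdiff[OF D(2)] cardD cA de by simp
    have si: "s \<le> int i"
    proof -
      have "b2 D + n * card (A - D) \<le> b2 A" by (rule b2_lower_bound[OF A D(2) meetsD])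
      then have "int (b2 D) + int n * int (card (A - D)) \<le> int n * (int n + int r)"
        unfolding b2A by (metis of_nat_add of_nat_le_iff of_nat_mult)
      moreover have "int (b2 D) = (int n - s + int i) * (int n - 1)"
        unfolding b2D of_nat_mult of_nat_add de ..
      ultimately have "(int n - s + int i) * (int n - 1) + int n * (int r + 1 + s - int i)
          \<le> int n * (int n + int r)" unfolding dD by simp
      then show ?thesis by (simp add: algebra_simps)
    qed
    show ?thesis
    proof (cases "A = D")
      case True
      then show ?thesis using i free by blast
    next
      case False
      \<comment> \<open>at least one line is left, which keeps the excess \<open>i - s\<close> of the first exponent within \<open>r\<close>\<close>
      then have "card (A - D) \<noteq> 0" using D(2) fin by auto
      define j where "j = int i - s"
      have j: "0 \<le> j" "j \<le> int r" using si dD \<open>card (A - D) \<noteq> 0\<close> by (auto simp: j_def)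
      have ek: "int (d + i) = int n + j" using de by (simp add: j_def)
      have dc: "int (e + card (A - D)) = int n + int r - j" using dD de by (simp add: j_def)
      have "int (b2 A) = int n * (int n + int r)" by (simp add: b2A)
      also have "\<dots> \<le> (int n + j) * (int n + int r - j)" using j by (rule product_le_closer_product)
      also have "\<dots> = int ((d + i) * (e + card (A - D)))" unfolding of_nat_mult ek dc ..
      finally have "b2 A \<le> (d + i) * (e + card (A - D))" by (simp only: of_nat_le_iff)
      then show ?thesis
        using affine_free_of_tight_b2[OF A D(2) affine_free_swap[OF i] meetsD'] free by blast
    qed
  qed
qed

theorem theorem1p6:
  shows "(\<forall>(A :: ('k::field ^ 2) set set) n r B s.
            has_free_subarrangement_condition A n r B s \<longrightarrow> free_arrangement A) \<and>
         (\<forall>(A :: ('k ^ 2) set set) (A' :: ('k ^ 2) set set).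
            (\<exists>n r B s. has_free_subarrangement_condition A n r B s) \<longrightarrow>
            (\<exists>n r B s. has_free_subarrangement_condition A' n r B s) \<longrightarrow>
            poset_isomorphic (intersection_poset A) (intersection_poset A') \<longrightarrow>
            (free_arrangement A \<longleftrightarrow> free_arrangement A'))"
  using free_subarrangement_imp_free by blast

end
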